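(* Let $N\ge 1$, $0<\tau<\beta$ and $s\ge 1$. Let $u$ be the solution of $$\tau u_{ttt}+u_{tt}-\Delta u-\beta\Delta u_t=0\quad\text{in }\mathbb{R}^N,\ t>0,$$ with $u(\cdot,0)=u_0$, $u_t(\cdot,0)=u_1$, $u_{tt}(\cdot,0)=u_2$. Let $V=(\tau u_{tt}+u_t,\ \partial_x(\tau u_t+u),\ \partial_x u_t)$ and $V_0=V(\cdot,0)=(\tau u_2+u_1,\ \partial_x(\tau u_1+u_0),\ \partial_x u_1)$, and assume that $V_0\in L^1(\mathbb{R}^N)\cap H^s(\mathbb{R}^N)$. Then there exist constants $C,c>0$, independent of $t$ and of the initial data, such that for all integers $0\le j\le s$ and all $t\ge 0$, $$\|\partial_x^jV(t)\|_{L^2(\mathbb{R}^N)}\le C(1+t)^{-N/4-j/2}\|V_0\|_{L^1(\mathbb{R}^N)}+Ce^{-ct}\|\partial_x^jV_0\|_{L^2(\mathbb{R}^N)}.$$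
   Context: $\hat f(\xi)$ denotes the Fourier transform in the space variable $x\in\mathbb{R}^N$. $\partial_x$ stands for the spatial gradient and $\partial_x^j$ for the spatial derivatives of order $j$, with the normalization (Plancherel) $\|\partial_x^jf\|_{L^2}^2=\int_{\mathbb{R}^N}|\xi|^{2j}|\hat f(\xi)|^2\,d\xi$; in particular $|\hat V|^2=|\tau\hat u_{tt}+\hat u_t|^2+|\xi|^2|\tau\hat u_t+\hat u|^2+|\xi|^2|\hat u_t|^2$. The solution $u$ is the one whose spatial Fourier transform solves, for each frequency $\xi$, the ODE $\tau\hat u_{ttt}+\hat u_{tt}+|\xi|^2\hat u+\beta|\xi|^2\hat u_t=0$ with $\hat u(\xi,0)=\hat u_0(\xi)$, $\hat u_t(\xi,0)=\hat u_1(\xi)$, $\hat u_{tt}(\xi,0)=\hat u_2(\xi)$. *)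

theory Defs
  imports "HOL-Analysis.Analysis"
begin

section \<open>Schwartz functions and tempered distributions on \<open>\<real>\<^sup>N\<close>, \<open>N = CARD('n)\<close>\<close>

definition partial_deriv :: "'n::finite \<Rightarrow> (real^'n \<Rightarrow> complex) \<Rightarrow> real^'n \<Rightarrow> complex" where
  "partial_deriv i f = (\<lambda>x. frechet_derivative f (at x) (axis i 1))"

primrec partial_derivs :: "'n::finite list \<Rightarrow> (real^'n \<Rightarrow> complex) \<Rightarrow> real^'n \<Rightarrow> complex" where
  "partial_derivs [] f = f"
| "partial_derivs (i # is) f = partial_deriv i (partial_derivs is f)"

text \<open>Total differentiability of every iterated partial derivative is smoothness.\<close>

definition schwartz :: "(real^'n::finite \<Rightarrow> complex) \<Rightarrow> bool" where
  "schwartz \<phi> \<longleftrightarrow>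
    (\<forall>is. (\<forall>x. partial_derivs is \<phi> differentiable (at x)) \<and>
          (\<forall>m. bounded (range (\<lambda>x. (1 + norm x) ^ m *\<^sub>R partial_derivs is \<phi> x))))"

definition schwartz_seminorm :: "nat \<Rightarrow> (real^'n::finite \<Rightarrow> complex) \<Rightarrow> real" where
  "schwartz_seminorm m \<phi> =
    (SUP (is, x) \<in> {is. length is \<le> m} \<times> UNIV. (1 + norm x) ^ m * norm (partial_derivs is \<phi> x))"

text \<open>Only the values of a distribution on Schwartz functions are meaningful.\<close>

type_synonym 'n dist = "(real^'n \<Rightarrow> complex) \<Rightarrow> complex"

definition tempered :: "'n::finite dist \<Rightarrow> bool" where
  "tempered T \<longleftrightarrow>
    (\<forall>\<phi> \<psi>. schwartz \<phi> \<longrightarrow> schwartz \<psi> \<longrightarrow> T (\<lambda>x. \<phi> x + \<psi> x) = T \<phi> + T \<psi>) \<and>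
    (\<forall>a \<phi>. schwartz \<phi> \<longrightarrow> T (\<lambda>x. a * \<phi> x) = a * T \<phi>) \<and>
    (\<exists>C m. \<forall>\<phi>. schwartz \<phi> \<longrightarrow> norm (T \<phi>) \<le> C * schwartz_seminorm m \<phi>)"

definition dist_partial :: "'n::finite \<Rightarrow> 'n dist \<Rightarrow> 'n dist" where
  "dist_partial i T = (\<lambda>\<phi>. - T (partial_deriv i \<phi>))"

text \<open>The distribution \<open>T\<close> is (integration against) the function \<open>f\<close>. This determines \<open>f\<close>
  up to a null set.\<close>

definition represents :: "(real^'n::finite \<Rightarrow> complex) \<Rightarrow> 'n dist \<Rightarrow> bool" where
  "represents f T \<longleftrightarrow>
    (\<forall>\<phi>. schwartz \<phi> \<longrightarrow>
      integrable lborel (\<lambda>x. f x * \<phi> x) \<and> T \<phi> = (LINT x|lborel. f x * \<phi> x))"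


section \<open>Fourier transform\<close>

text \<open>The factor \<open>(2\<pi>)\<^bsup>-N/2\<^esup>\<close> makes the transform unitary on \<open>L\<^sup>2\<close>, i.e. Plancherel's identity
  holds without a constant.\<close>

definition fourier :: "(real^'n::finite \<Rightarrow> complex) \<Rightarrow> real^'n \<Rightarrow> complex" where
  "fourier \<phi> \<xi> =
    complex_of_real ((2 * pi) powr (- real CARD('n) / 2)) * (LINT x|lborel. cis (- (x \<bullet> \<xi>)) * \<phi> x)"

definition dist_fourier :: "'n::finite dist \<Rightarrow> 'n dist" where
  "dist_fourier T = (\<lambda>\<phi>. T (fourier \<phi>))"


section \<open>Function spaces for vector-valued distributions\<close>

text \<open>A \<open>\<complex>\<^sup>K\<close>-valued distribution is the family of its components.\<close>

type_synonym ('k, 'n) vdist = "'k \<Rightarrow> 'n dist"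

definition vrepresents :: "(real^'n::finite \<Rightarrow> complex^'k::finite) \<Rightarrow> ('k, 'n) vdist \<Rightarrow> bool" where
  "vrepresents f T \<longleftrightarrow> (\<forall>k. represents (\<lambda>x. f x $ k) (T k))"

definition density_of :: "('k::finite, 'n::finite) vdist \<Rightarrow> real^'n \<Rightarrow> complex^'k" where
  "density_of T = (SOME f. vrepresents f T)"

definition vfourier :: "('k, 'n::finite) vdist \<Rightarrow> ('k, 'n) vdist" where
  "vfourier T = (\<lambda>k. dist_fourier (T k))"

definition in_L1 :: "('k::finite, 'n::finite) vdist \<Rightarrow> bool" where
  "in_L1 T \<longleftrightarrow> (\<exists>f. vrepresents f T \<and> integrable lborel f)"

definition L1_norm :: "('k::finite, 'n::finite) vdist \<Rightarrow> real" where
  "L1_norm T = (LINT x|lborel. norm (density_of T x))"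

definition in_Hs :: "real \<Rightarrow> ('k::finite, 'n::finite) vdist \<Rightarrow> bool" where
  "in_Hs s T \<longleftrightarrow>
    (\<exists>g. vrepresents g (vfourier T) \<and>
         integrable lborel (\<lambda>\<xi>. (1 + (norm \<xi>)\<^sup>2) powr s * (norm (g \<xi>))\<^sup>2))"

text \<open>The norm \<open>\<parallel>\<partial>\<^sub>x\<^sup>j T\<parallel>\<close> in \<open>L\<^sup>2\<close>, normalized by Plancherel as
  \<open>\<parallel>\<partial>\<^sub>x\<^sup>j T\<parallel>\<^sup>2 = \<integral> \<bar>\<xi>\<bar>\<^bsup>2j\<^esup> \<bar>T^(\<xi>)\<bar>\<^sup>2 d\<xi>\<close>. The value is meaningful only if the integral is finite,
  e.g. if \<open>in_Hs (real j) T\<close>.\<close>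

definition deriv_L2_norm :: "nat \<Rightarrow> ('k::finite, 'n::finite) vdist \<Rightarrow> real" where
  "deriv_L2_norm j T =
    sqrt (LINT \<xi>|lborel. norm \<xi> ^ (2 * j) * (norm (density_of (vfourier T) \<xi>))\<^sup>2)"


section \<open>The Cauchy problem for the Moore-Gibson-Thompson equation \<open>\<tau> u\<^sub>t\<^sub>t\<^sub>t + u\<^sub>t\<^sub>t - \<Delta>u - \<beta> \<Delta>u\<^sub>t = 0\<close>\<close>

definition mgt_ode ::
  "real \<Rightarrow> real \<Rightarrow> real^'n::finite \<Rightarrow> complex \<Rightarrow> complex \<Rightarrow> complex \<Rightarrow> (real \<Rightarrow> complex) \<Rightarrow> bool" where
  "mgt_ode \<tau> \<beta> \<xi> a0 a1 a2 y \<longleftrightarrow>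
    (\<exists>y' y'' y'''.
      (\<forall>t\<ge>0. (y has_vector_derivative y' t) (at t within {0..}) \<and>
             (y' has_vector_derivative y'' t) (at t within {0..}) \<and>
             (y'' has_vector_derivative y''' t) (at t within {0..}) \<and>
             of_real \<tau> * y''' t + y'' t + of_real ((norm \<xi>)\<^sup>2) * y t
               + of_real (\<beta> * (norm \<xi>)\<^sup>2) * y' t = 0) \<and>
      y 0 = a0 \<and> y' 0 = a1 \<and> y'' 0 = a2)"

text \<open>\<open>uh0\<close>, \<open>uh1\<close>, \<open>uh2\<close> and \<open>uh\<close> are the spatial Fourier transforms of \<open>u0\<close>, \<open>u1\<close>, \<open>u2\<close> and \<open>u\<close>.
  They have to be functions of \<open>\<xi>\<close> for the equation to make sense at each frequency; nothing else
  is required of \<open>u0\<close>, \<open>u1\<close>, \<open>u2\<close> and \<open>u t\<close>, which need not be integrable or square integrable.\<close>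

definition mgt_solution ::
  "real \<Rightarrow> real \<Rightarrow> 'n::finite dist \<Rightarrow> 'n dist \<Rightarrow> 'n dist \<Rightarrow> (real \<Rightarrow> 'n dist) \<Rightarrow> bool" where
  "mgt_solution \<tau> \<beta> u0 u1 u2 u \<longleftrightarrow>
    tempered u0 \<and> tempered u1 \<and> tempered u2 \<and> (\<forall>t\<ge>0. tempered (u t)) \<and>
    (\<exists>uh0 uh1 uh2 uh.
      represents uh0 (dist_fourier u0) \<and>
      represents uh1 (dist_fourier u1) \<and>
      represents uh2 (dist_fourier u2) \<and>
      (\<forall>t\<ge>0. represents (\<lambda>\<xi>. uh \<xi> t) (dist_fourier (u t))) \<and>
      (\<forall>\<xi>. mgt_ode \<tau> \<beta> \<xi> (uh0 \<xi>) (uh1 \<xi>) (uh2 \<xi>) (uh \<xi>)))"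

definition time_deriv :: "(real \<Rightarrow> 'n::finite dist) \<Rightarrow> real \<Rightarrow> 'n dist" where
  "time_deriv u t = (\<lambda>\<phi>. vector_derivative (\<lambda>r. u r \<phi>) (at t within {0..}))"

text \<open>The \<open>1 + N + N\<close> components of \<open>(\<tau> w\<^sub>2 + w\<^sub>1, \<partial>\<^sub>x (\<tau> w\<^sub>1 + w\<^sub>0), \<partial>\<^sub>x w\<^sub>1)\<close>.\<close>

definition V_vec ::
  "real \<Rightarrow> 'n::finite dist \<Rightarrow> 'n dist \<Rightarrow> 'n dist \<Rightarrow> (unit + 'n + 'n, 'n) vdist" where
  "V_vec \<tau> w0 w1 w2 k =
    (case k of
       Inl _ \<Rightarrow> (\<lambda>\<phi>. of_real \<tau> * w2 \<phi> + w1 \<phi>)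
     | Inr (Inl i) \<Rightarrow> dist_partial i (\<lambda>\<phi>. of_real \<tau> * w1 \<phi> + w0 \<phi>)
     | Inr (Inr i) \<Rightarrow> dist_partial i w1)"

definition V_sol :: "real \<Rightarrow> (real \<Rightarrow> 'n::finite dist) \<Rightarrow> real \<Rightarrow> (unit + 'n + 'n, 'n) vdist" where
  "V_sol \<tau> u t = V_vec \<tau> (u t) (time_deriv u t) (time_deriv (time_deriv u) t)"

end

theory Submission
  imports Defs "HOL-Probability.Sinc_Integral" "HOL-Probability.Characteristic_Functions"
    "HOL-Real_Asymp.Real_Asymp"
begin

text \<open>
  At a single frequency \<open>\<xi>\<close> the equation is a linear system for \<open>v = \<tau> y'' + y'\<close>, \<open>w = \<tau> y' + y\<close> and
  \<open>z = y'\<close>, and \<open>\<bar>V\<bar>\<^sup>2 = \<bar>v\<bar>\<^sup>2 + \<bar>\<xi>\<bar>\<^sup>2 \<bar>w\<bar>\<^sup>2 + \<bar>\<xi>\<bar>\<^sup>2 \<bar>z\<bar>\<^sup>2\<close>. With the weight \<open>\<tau> (\<beta> - \<tau>)\<close> on the last term this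
  is an energy that is dissipated, but only through \<open>z\<close>, at the rate \<open>2 (\<beta> - \<tau>) \<bar>\<xi>\<bar>\<^sup>2 \<bar>z\<bar>\<^sup>2\<close>. Here
  \<open>\<tau> < \<beta>\<close> enters. A small multiple of \<open>v \<bullet> w - 2 \<tau> (v \<bullet> z)\<close>, scaled by
  \<open>\<rho> = \<bar>\<xi>\<bar>\<^sup>2 / (1 + \<bar>\<xi>\<bar>\<^sup>2)\<close>, turns the energy into a Lyapunov functional that also damps \<open>v\<close> and \<open>w\<close>. Hence
  \<open>\<bar>V(\<xi>, t)\<bar>\<^sup>2 \<le> K exp (- c \<rho> t) \<bar>V(\<xi>, 0)\<bar>\<^sup>2\<close> with constants independent of \<open>\<xi>\<close>
  (\<open>energy_decay\<close>, \<open>V_freq_decay\<close>).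

  By Plancherel's identity, which is built into the norms, it remains to integrate this against
  \<open>\<bar>\<xi>\<bar>\<^sup>2\<^sup>j\<close> (\<open>frequency_splitting\<close>). On \<open>\<bar>\<xi>\<bar> \<le> 1\<close> one has \<open>\<rho> \<ge> \<bar>\<xi>\<bar>\<^sup>2 / 2\<close>, the transform of \<open>V\<^sub>0\<close>
  is bounded by a multiple of the \<open>L\<^sup>1\<close> norm of \<open>V\<^sub>0\<close>, and scaling of the Gaussian integral produces
  \<open>(1 + t)\<^bsup>-N/2-j\<^esup>\<close>. On \<open>\<bar>\<xi>\<bar> \<ge> 1\<close> one has \<open>\<rho> \<ge> 1/2\<close>, which gives the exponentially decaying term.

  The solution and \<open>V\<close> are distributions and the norms refer to chosen densities, so three facts
  connect them with the computation at single frequencies. A function is determined almost everywhere by the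
  distribution that it represents (\<open>represents_unique_AE\<close>). For an integrable function the
  distributional Fourier transform is the classical one (\<open>represents_fourier_integrable\<close>); this rests on the
  invariance of the Schwartz functions under the transform (\<open>schwartz_fourier\<close>). And the transform of
  \<open>V(t)\<close> is obtained by differentiating in time under the integral over the frequencies
  (\<open>mgt_solution_fourier\<close>), which is justified by bounds for the solutions that are uniform on compact
  time intervals and grow polynomially in \<open>\<xi>\<close> (\<open>mgt_curve_bound\<close>).
\<close>

section \<open>Smooth functions with growth conditions\<close>

lemma partial_deriv_eq:
  assumes "(f has_derivative f') (at x)"
  shows "partial_deriv i f x = f' (axis i 1)"
  using frechet_derivative_at[OF assms] by (simp add: partial_deriv_def)

lemma partial_deriv_add:
  assumes "\<And>x. f differentiable at x" "\<And>x. g differentiable at x"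
  shows "partial_deriv i (\<lambda>x. f x + g x) = (\<lambda>x. partial_deriv i f x + partial_deriv i g x)"
proof
  fix x
  from assms obtain f' g' where f: "(f has_derivative f') (at x)" and g: "(g has_derivative g') (at x)"
    unfolding differentiable_def by metis
  show "partial_deriv i (\<lambda>x. f x + g x) x = partial_deriv i f x + partial_deriv i g x"
    using partial_deriv_eq[OF has_derivative_add[OF f g]] partial_deriv_eq[OF f] partial_deriv_eq[OF g]
    by simp
qed

lemma partial_deriv_mult:
  assumes "\<And>x. f differentiable at x" "\<And>x. g differentiable at x"
  shows "partial_deriv i (\<lambda>x. f x * g x) = (\<lambda>x. partial_deriv i f x * g x + f x * partial_deriv i g x)"
proof
  fix x
  from assms obtain f' g' where f: "(f has_derivative f') (at x)" and g: "(g has_derivative g') (at x)"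
    unfolding differentiable_def by metis
  show "partial_deriv i (\<lambda>x. f x * g x) x = partial_deriv i f x * g x + f x * partial_deriv i g x"
    using partial_deriv_eq[OF has_derivative_mult[OF f g]] partial_deriv_eq[OF f] partial_deriv_eq[OF g]
    by simp
qed

lemma partial_deriv_const [simp]: "partial_deriv i (\<lambda>_. c) = (\<lambda>_. 0)"
  by (rule ext) (use partial_deriv_eq[OF has_derivative_const] in fastforce)

lemma partial_derivs_append:
  "partial_derivs (is @ js) f = partial_derivs is (partial_derivs js f)"
  by (induction "is") auto

text \<open>One notion of smoothness serves two purposes: with \<open>P\<close> rapid decay it gives Schwartz functions,
with \<open>P\<close> polynomial growth it gives the functions by which Schwartz functions can be multiplied.\<close>

definition smooth_with ::
  "((real^'n::finite \<Rightarrow> complex) \<Rightarrow> bool) \<Rightarrow> (real^'n \<Rightarrow> complex) \<Rightarrow> bool" where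
  "smooth_with P f \<longleftrightarrow>
    (\<forall>is. (\<forall>x. partial_derivs is f differentiable (at x)) \<and> P (partial_derivs is f))"

text \<open>Iterated derivatives never have to be computed: it suffices to exhibit a set of functions that
contains \<open>f\<close> and is mapped into itself by every partial derivative.\<close>

lemma smooth_with_coinduct:
  assumes "f \<in> S"
    and "\<And>f x. f \<in> S \<Longrightarrow> f differentiable at x"
    and "\<And>f. f \<in> S \<Longrightarrow> P f"
    and step: "\<And>f i. f \<in> S \<Longrightarrow> partial_deriv i f \<in> S"
  shows "smooth_with P f"
proof -
  have "partial_derivs is f \<in> S" for "is"
    by (induction "is") (auto intro: assms(1) step)
  then show ?thesis
    unfolding smooth_with_def using assms by blast
qed

lemma smooth_withD:
  assumes "smooth_with P f"
  shows "f differentiable at x" "P f" "smooth_with P (partial_deriv i f)"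
proof -
  show "f differentiable at x" "P f"
    using assms[unfolded smooth_with_def, rule_format, of "[]"] by auto
  show "smooth_with P (partial_deriv i f)"
    unfolding smooth_with_def
  proof safe
    fix "is" x
    have *: "partial_derivs is (partial_deriv i f) = partial_derivs (is @ [i]) f"
      by (simp add: partial_derivs_append)
    show "partial_derivs is (partial_deriv i f) differentiable at x" "P (partial_derivs is (partial_deriv i f))"
      using assms[unfolded smooth_with_def, rule_format, of "is @ [i]"] unfolding * by blast+
  qed
qed

definition rapid :: "(real^'n::finite \<Rightarrow> complex) \<Rightarrow> bool" where
  "rapid f \<longleftrightarrow> (\<forall>m. \<exists>B. \<forall>x. (1 + norm x) ^ m * norm (f x) \<le> B)"

definition poly_growth :: "(real^'n::finite \<Rightarrow> complex) \<Rightarrow> bool" where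
  "poly_growth f \<longleftrightarrow> (\<exists>m B. \<forall>x. norm (f x) \<le> B * (1 + norm x) ^ m)"

abbreviation moderate :: "(real^'n::finite \<Rightarrow> complex) \<Rightarrow> bool" where
  "moderate \<equiv> smooth_with poly_growth"

lemma schwartz_iff_smooth_with: "schwartz = smooth_with rapid"
proof -
  have "bounded (range (\<lambda>x. (1 + norm x) ^ m *\<^sub>R f x)) \<longleftrightarrow> (\<exists>B. \<forall>x. (1 + norm x) ^ m * norm (f x) \<le> B)"
    for f :: "real^'a::finite \<Rightarrow> complex" and m
    by (auto simp: bounded_iff)
  then show ?thesis
    by (simp add: fun_eq_iff schwartz_def smooth_with_def rapid_def)
qed

lemmas schwartz_coinduct = smooth_with_coinduct[where P = rapid, folded schwartz_iff_smooth_with]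
lemmas moderateD = smooth_withD[where P = poly_growth]
lemmas schwartzD = smooth_withD[where P = rapid, folded schwartz_iff_smooth_with]

lemma rapidD:
  assumes "rapid f"
  shows "\<exists>B. 0 < B \<and> (\<forall>x. (1 + norm x) ^ m * norm (f x) \<le> B)"
proof -
  obtain B where B: "\<And>x. (1 + norm x) ^ m * norm (f x) \<le> B"
    using assms unfolding rapid_def by blast
  have "(1 + norm x) ^ m * norm (f x) \<le> max B 1" for x
    using B[of x] by simp
  then show ?thesis by (intro exI[of _ "max B 1"]) auto
qed

lemma poly_growthD:
  assumes "poly_growth f"
  shows "\<exists>B m. 0 \<le> B \<and> (\<forall>x. norm (f x) \<le> B * (1 + norm x) ^ m)"
proof -
  obtain B m where B: "\<And>x. norm (f x) \<le> B * (1 + norm x) ^ m"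
    using assms unfolding poly_growth_def by blast
  have "norm (f x) \<le> max B 0 * (1 + norm x) ^ m" for x
    by (rule order.trans[OF B mult_right_mono]) auto
  then show ?thesis by (intro exI[of _ "max B 0"] exI[of _ m]) auto
qed

lemma rapid_add: "rapid f \<Longrightarrow> rapid g \<Longrightarrow> rapid (\<lambda>x. f x + g x)"
  unfolding rapid_def
proof
  fix m
  assume "\<forall>m. \<exists>B. \<forall>x. (1 + norm x) ^ m * norm (f x) \<le> B" "\<forall>m. \<exists>B. \<forall>x. (1 + norm x) ^ m * norm (g x) \<le> B"
  then obtain A B where AB: "\<And>x. (1 + norm x) ^ m * norm (f x) \<le> A" "\<And>x. (1 + norm x) ^ m * norm (g x) \<le> B"
    by metis
  have "(1 + norm x) ^ m * norm (f x + g x) \<le> A + B" for x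
  proof -
    have "(1 + norm x) ^ m * norm (f x + g x) \<le> (1 + norm x) ^ m * (norm (f x) + norm (g x))"
      by (intro mult_left_mono norm_triangle_ineq) auto
    then show ?thesis using AB[of x] by (simp add: algebra_simps)
  qed
  then show "\<exists>B. \<forall>x. (1 + norm x) ^ m * norm (f x + g x) \<le> B" by blast
qed

lemma rapid_mult: assumes "poly_growth a" "rapid f" shows "rapid (\<lambda>x. a x * f x)"
  unfolding rapid_def
proof
  fix m
  obtain A l where A: "0 \<le> A" "\<And>x. norm (a x) \<le> A * (1 + norm x) ^ l"
    using poly_growthD[OF assms(1)] by blast
  obtain B where B: "\<And>x. (1 + norm x) ^ (m + l) * norm (f x) \<le> B"
    using assms(2) unfolding rapid_def by blast
  have "(1 + norm x) ^ m * norm (a x * f x) \<le> A * B" for x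
  proof -
    have "(1 + norm x) ^ m * norm (a x * f x) \<le> (1 + norm x) ^ m * ((A * (1 + norm x) ^ l) * norm (f x))"
      unfolding norm_mult by (intro mult_left_mono mult_right_mono A) auto
    also have "\<dots> = A * ((1 + norm x) ^ (m + l) * norm (f x))"
      by (simp add: power_add mult_ac)
    also have "\<dots> \<le> A * B"
      by (intro mult_left_mono A B)
    finally show ?thesis .
  qed
  then show "\<exists>B. \<forall>x. (1 + norm x) ^ m * norm (a x * f x) \<le> B" by blast
qed

lemma poly_growth_add: assumes "poly_growth f" "poly_growth g" shows "poly_growth (\<lambda>x. f x + g x)"
proof -
  obtain A l where A: "0 \<le> A" "\<And>x. norm (f x) \<le> A * (1 + norm x) ^ l"
    using poly_growthD[OF assms(1)] by blast
  obtain B m where B: "0 \<le> B" "\<And>x. norm (g x) \<le> B * (1 + norm x) ^ m"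
    using poly_growthD[OF assms(2)] by blast
  have "norm (f x + g x) \<le> (A + B) * (1 + norm x) ^ (l + m)" for x
  proof -
    have "norm (f x + g x) \<le> A * (1 + norm x) ^ l + B * (1 + norm x) ^ m"
      using A(2)[of x] B(2)[of x] norm_triangle_ineq[of "f x" "g x"] by linarith
    also have "\<dots> \<le> A * (1 + norm x) ^ (l + m) + B * (1 + norm x) ^ (l + m)"
      by (intro add_mono mult_left_mono power_increasing A B) auto
    finally show ?thesis by (simp add: algebra_simps)
  qed
  then show ?thesis unfolding poly_growth_def by blast
qed

lemma poly_growth_mult: assumes "poly_growth f" "poly_growth g" shows "poly_growth (\<lambda>x. f x * g x)"
proof -
  obtain A l where A: "0 \<le> A" "\<And>x. norm (f x) \<le> A * (1 + norm x) ^ l"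
    using poly_growthD[OF assms(1)] by blast
  obtain B m where B: "0 \<le> B" "\<And>x. norm (g x) \<le> B * (1 + norm x) ^ m"
    using poly_growthD[OF assms(2)] by blast
  have "norm (f x * g x) \<le> (A * B) * (1 + norm x) ^ (l + m)" for x
    using mult_mono[OF A(2)[of x] B(2)[of x]] A(1) by (simp add: norm_mult power_add mult_ac)
  then show ?thesis unfolding poly_growth_def by blast
qed

lemma poly_growth_bounded: "(\<And>x. norm (f x) \<le> B) \<Longrightarrow> poly_growth f"
  unfolding poly_growth_def by (intro exI[of _ 0] exI[of _ B]) auto

text \<open>The derivatives of a concrete function, such as a character or the steps used below, are polynomial
expressions in that function and finitely many others. The algebra generated by a set makes it
possible to check derivatives on the generators only.\<close>

inductive_set alg :: "(real^'n::finite \<Rightarrow> complex) set \<Rightarrow> (real^'n \<Rightarrow> complex) set" for X where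
  base: "f \<in> X \<Longrightarrow> f \<in> alg X"
| const: "(\<lambda>_. c) \<in> alg X"
| add: "f \<in> alg X \<Longrightarrow> g \<in> alg X \<Longrightarrow> (\<lambda>x. f x + g x) \<in> alg X"
| mult: "f \<in> alg X \<Longrightarrow> g \<in> alg X \<Longrightarrow> (\<lambda>x. f x * g x) \<in> alg X"

text \<open>By the sum and product rules the algebra generated by \<open>X\<close> is closed under partial derivatives as
soon as it contains those of the generators, and polynomial growth is inherited from the generators.\<close>

lemma moderate_alg:
  assumes X: "\<And>f x. f \<in> X \<Longrightarrow> f differentiable at x" "\<And>f. f \<in> X \<Longrightarrow> poly_growth f"
    and dX: "\<And>f i. f \<in> X \<Longrightarrow> partial_deriv i f \<in> alg X"
    and f: "f \<in> alg X"
  shows "moderate f"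
proof -
  have diff: "f \<in> alg X \<Longrightarrow> f differentiable at x" for f x
    by (induction f rule: alg.induct) (auto intro: X)
  show ?thesis
    using f
  proof (rule smooth_with_coinduct)
    show "f \<in> alg X \<Longrightarrow> f differentiable at x" for f x by (rule diff)
    show "f \<in> alg X \<Longrightarrow> poly_growth f" for f
      by (induction f rule: alg.induct)
         (auto intro: X poly_growth_add poly_growth_mult poly_growth_bounded)
    show "f \<in> alg X \<Longrightarrow> partial_deriv i f \<in> alg X" for f i
      by (induction f rule: alg.induct)
         (auto simp: partial_deriv_add partial_deriv_mult diff intro: dX alg.intros)
  qed
qed

lemma moderate_const: "moderate (\<lambda>_. c)"
  by (rule moderate_alg[of "{}"]) (auto intro: alg.const)

lemma moderate_alg_moderate: "f \<in> alg (Collect moderate) \<Longrightarrow> moderate f"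
  by (rule moderate_alg[of "Collect moderate"]) (auto intro: moderateD alg.base)

lemma moderate_add: "moderate f \<Longrightarrow> moderate g \<Longrightarrow> moderate (\<lambda>x. f x + g x)"
  by (intro moderate_alg_moderate alg.add alg.base) auto

lemma moderate_mult: "moderate f \<Longrightarrow> moderate g \<Longrightarrow> moderate (\<lambda>x. f x * g x)"
  by (intro moderate_alg_moderate alg.mult alg.base) auto

lemma moderate_prod: "finite I \<Longrightarrow> (\<And>i. i \<in> I \<Longrightarrow> moderate (f i)) \<Longrightarrow> moderate (\<lambda>x. \<Prod>i\<in>I. f i x)"
  by (induction I rule: finite_induct) (auto intro: moderate_const moderate_add moderate_mult)

lemma moderate_sum: "finite I \<Longrightarrow> (\<And>i. i \<in> I \<Longrightarrow> moderate (f i)) \<Longrightarrow> moderate (\<lambda>x. \<Sum>i\<in>I. f i x)"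
  by (induction I rule: finite_induct) (auto intro: moderate_const moderate_add moderate_mult)

lemma moderate_power: "moderate f \<Longrightarrow> moderate (\<lambda>x. f x ^ n)"
  by (induction n) (auto intro: moderate_const moderate_add moderate_mult)

lemma has_derivative_coord:
  "((\<lambda>x::real^'n::finite. complex_of_real (x $ i)) has_derivative (\<lambda>h. of_real (h $ i))) (at x)"
  by (intro bounded_linear_imp_has_derivative bounded_linear_compose[OF bounded_linear_of_real]
        bounded_linear_vec_nth)

lemma moderate_coord: "moderate (\<lambda>x::real^'n::finite. complex_of_real (x $ i))"
proof (rule moderate_alg[of "{\<lambda>x. complex_of_real (x $ i)}"], safe?)
  fix j :: 'n and x :: "real^'n"
  show "(\<lambda>x. complex_of_real (x $ i)) differentiable at x"
    unfolding differentiable_def using has_derivative_coord by blast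
  have "partial_deriv j (\<lambda>x. complex_of_real (x $ i)) = (\<lambda>_. of_real (axis j 1 $ i))"
    by (rule ext) (rule partial_deriv_eq[OF has_derivative_coord])
  then show "partial_deriv j (\<lambda>x. complex_of_real (x $ i)) \<in> alg {\<lambda>x. complex_of_real (x $ i)}"
    by (metis alg.const)
  show "poly_growth (\<lambda>x::real^'n. complex_of_real (x $ i))"
    unfolding poly_growth_def
  proof (intro exI[of _ 1] allI)
    fix x :: "real^'n"
    show "norm (complex_of_real (x $ i)) \<le> 1 * (1 + norm x) ^ 1"
      using component_le_norm_cart[of x i] by simp
  qed
qed (auto intro: alg.base)

lemma has_derivative_cis_inner:
  "((\<lambda>x::real^'n::finite. cis (- (x \<bullet> \<xi>))) has_derivative (\<lambda>h. (h \<bullet> \<xi>) *\<^sub>R (- \<i> * cis (- (x \<bullet> \<xi>))))) (at x)"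
proof -
  have "((\<lambda>x. \<i> * complex_of_real (- (x \<bullet> \<xi>))) has_derivative (\<lambda>h. \<i> * complex_of_real (- (h \<bullet> \<xi>)))) (at x)"
    by (auto intro!: derivative_eq_intros)
  from has_derivative_compose[OF this DERIV_exp[THEN has_field_derivative_imp_has_derivative]]
  show ?thesis
    by (simp add: cis_conv_exp scaleR_conv_of_real mult_ac)
qed

lemma moderate_cis: "moderate (\<lambda>x::real^'n::finite. cis (- (x \<bullet> \<xi>)))"
proof (rule moderate_alg[of "{\<lambda>x. cis (- (x \<bullet> \<xi>))}"], safe?)
  fix j :: 'n and x :: "real^'n"
  show "(\<lambda>x. cis (- (x \<bullet> \<xi>))) differentiable at x"
    unfolding differentiable_def using has_derivative_cis_inner by blast
  have "partial_deriv j (\<lambda>x. cis (- (x \<bullet> \<xi>))) = (\<lambda>x. (of_real (axis j 1 \<bullet> \<xi>) * - \<i>) * cis (- (x \<bullet> \<xi>)))"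
    by (rule ext) (simp add: partial_deriv_eq[OF has_derivative_cis_inner] scaleR_conv_of_real)
  then show "partial_deriv j (\<lambda>x. cis (- (x \<bullet> \<xi>))) \<in> alg {\<lambda>x. cis (- (x \<bullet> \<xi>))}"
    by (simp only:) (intro alg.mult alg.const alg.base singletonI)
  show "poly_growth (\<lambda>x::real^'n. cis (- (x \<bullet> \<xi>)))"
    by (rule poly_growth_bounded[of _ 1]) auto
qed (auto intro: alg.base)

text \<open>The product rule leads out of the set of products of a moderate and a Schwartz function, but not out
of the sums of such products.\<close>

inductive_set moderate_span :: "(real^'n::finite \<Rightarrow> complex) set" where
  mult: "moderate a \<Longrightarrow> schwartz f \<Longrightarrow> (\<lambda>x. a x * f x) \<in> moderate_span"
| add: "f \<in> moderate_span \<Longrightarrow> g \<in> moderate_span \<Longrightarrow> (\<lambda>x. f x + g x) \<in> moderate_span"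

lemma schwartz_moderate_span: "f \<in> moderate_span \<Longrightarrow> schwartz f"
proof (rule schwartz_coinduct)
  show diff: "f \<in> moderate_span \<Longrightarrow> f differentiable at x" for f :: "real^'n::finite \<Rightarrow> complex" and x
    by (induction f rule: moderate_span.induct) (auto intro: differentiable_mult moderateD(1) schwartzD(1))
  show "f \<in> moderate_span \<Longrightarrow> rapid f" for f :: "real^'n::finite \<Rightarrow> complex"
    by (induction f rule: moderate_span.induct)
       (auto intro: rapid_add rapid_mult moderateD(2) schwartzD(2))
  show "f \<in> moderate_span \<Longrightarrow> partial_deriv i f \<in> moderate_span" for f :: "real^'n::finite \<Rightarrow> complex" and i
  proof (induction f rule: moderate_span.induct)
    case (mult a f)
    then show ?case
      by (simp add: partial_deriv_mult moderateD(1) schwartzD(1))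
        (intro moderate_span.intros moderateD(3) schwartzD(3))
  next
    case (add f g)
    then show ?case
      by (simp add: partial_deriv_add diff moderate_span.add)
  qed
qed

lemma schwartz_mult: "moderate a \<Longrightarrow> schwartz f \<Longrightarrow> schwartz (\<lambda>x. a x * f x)"
  by (rule schwartz_moderate_span, rule moderate_span.mult)

section \<open>The Gaussian\<close>

definition gauss :: "real^'n::finite \<Rightarrow> complex" where
  "gauss x = of_real (exp (- (norm x)\<^sup>2))"

lemma gauss_nonzero [simp]: "gauss x \<noteq> 0"
  by (simp add: gauss_def)

text \<open>This follows from \<open>1 + x \<le> exp x\<close> at \<open>x = r / m\<close>.\<close>

lemma power_le_exp:
  fixes r :: real
  assumes "0 \<le> r"
  shows "r ^ m \<le> real m ^ m * exp r"
proof (cases "m = 0")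
  case False
  have "r = real m * (r / real m)" using False by simp
  also have "\<dots> \<le> real m * exp (r / real m)"
    using exp_ge_add_one_self[of "r / real m"] by (intro mult_left_mono) linarith+
  finally have "r ^ m \<le> (real m * exp (r / real m)) ^ m"
    using assms by (intro power_mono)
  also have "\<dots> = real m ^ m * exp r"
    using False by (simp add: power_mult_distrib exp_of_nat_mult[symmetric])
  finally show ?thesis .
qed (use assms in simp)

lemma poly_mult_exp_bounded: "\<exists>B. \<forall>r\<ge>0. (1 + r) ^ m * exp (- r\<^sup>2) \<le> (B::real)"
proof (intro exI allI impI)
  fix r :: real assume r: "0 \<le> r"
  have "(1 + r) ^ m * exp (- r\<^sup>2) \<le> real m ^ m * exp (1 + r) * exp (- r\<^sup>2)"
    using r by (intro mult_right_mono power_le_exp) auto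
  also have "\<dots> = real m ^ m * exp (1 + r - r\<^sup>2)"
    by (simp only: exp_add[symmetric] mult.assoc) simp
  also have "\<dots> \<le> real m ^ m * exp 2"
  proof -
    have "0 \<le> (r - 1/2)\<^sup>2" by simp
    then have "1 + r - r\<^sup>2 \<le> 2" by (simp add: power2_eq_square algebra_simps)
    then show ?thesis by (intro mult_left_mono) auto
  qed
  finally show "(1 + r) ^ m * exp (- r\<^sup>2) \<le> real m ^ m * exp 2" .
qed

lemma rapid_gauss: "rapid gauss"
  unfolding rapid_def gauss_def
proof
  fix m
  obtain B :: real where "\<forall>r\<ge>0. (1 + r) ^ m * exp (- r\<^sup>2) \<le> B"
    using poly_mult_exp_bounded[of m] by blast
  then show "\<exists>B. \<forall>x::real^'a. (1 + norm x) ^ m * norm (complex_of_real (exp (- (norm x)\<^sup>2))) \<le> B"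
    by (intro exI[of _ B]) simp
qed

lemma has_derivative_gauss:
  fixes x :: "real^'n::finite"
  shows "(gauss has_derivative (\<lambda>h. of_real (- 2 * (x \<bullet> h)) * gauss x)) (at x)"
proof -
  have "((\<lambda>x::real^'n. exp (- (x \<bullet> x))) has_derivative (\<lambda>h. exp (- (x \<bullet> x)) * (- (x \<bullet> h + h \<bullet> x)))) (at x)"
    by (auto intro!: derivative_eq_intros)
  from has_derivative_of_real[OF this, where 'a = complex] show ?thesis
    by (simp add: gauss_def[abs_def] power2_norm_eq_inner inner_commute mult_ac)
qed

lemma partial_deriv_gauss:
  "partial_deriv i gauss = (\<lambda>x. ((- 2) * of_real (x $ i)) * gauss x)"
  by (rule ext) (simp add: partial_deriv_eq[OF has_derivative_gauss] inner_axis)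

text \<open>The products of a moderate function with the Gaussian are closed under partial derivatives, because
a derivative of the Gaussian is a polynomial times the Gaussian.\<close>

lemma schwartz_moderate_gauss: "moderate a \<Longrightarrow> schwartz (\<lambda>x. a x * gauss x)"
proof (rule schwartz_coinduct[of _ "{\<lambda>x. a x * gauss x | a. moderate a}"])
  have dg: "gauss differentiable at x" for x :: "real^'n::finite"
    unfolding differentiable_def using has_derivative_gauss by blast
  show "f \<in> {\<lambda>x. a x * gauss x |a. moderate a} \<Longrightarrow> f differentiable at x" for f and x :: "real^'n::finite"
    by safe (intro differentiable_mult dg moderateD(1))
  show "f \<in> {\<lambda>x. a x * gauss x |a. moderate a} \<Longrightarrow> rapid f" for f :: "real^'n::finite \<Rightarrow> complex"
    by safe (intro rapid_mult rapid_gauss moderateD(2))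
  fix f :: "real^'n::finite \<Rightarrow> complex" and i assume "f \<in> {\<lambda>x. a x * gauss x |a. moderate a}"
  then obtain a where a: "moderate a" "f = (\<lambda>x. a x * gauss x)" by blast
  have "partial_deriv i f = (\<lambda>x. (partial_deriv i a x + a x * ((- 2) * of_real (x $ i))) * gauss x)"
    unfolding a(2) by (simp add: partial_deriv_mult moderateD(1)[OF a(1)] dg partial_deriv_gauss algebra_simps)
  moreover have "moderate (\<lambda>x. partial_deriv i a x + a x * ((- 2) * of_real (x $ i)))"
    by (intro moderate_add moderate_mult moderate_const moderateD(3) a moderate_coord)
  ultimately show "partial_deriv i f \<in> {\<lambda>x. a x * gauss x |a. moderate a}"
    by (intro CollectI exI conjI)
qed blast

lemma schwartz_gauss: "schwartz gauss"
  using schwartz_moderate_gauss[OF moderate_const[of 1]] by simp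

section \<open>Integrability of rapidly decaying functions\<close>

lemma integrable_inverse_1_plus_square_lborel: "integrable lborel (\<lambda>x::real. 1 / (1 + x\<^sup>2))"
  using integrable_inverse_1_plus_square by (simp add: set_integrable_def inverse_eq_divide)

text \<open>The exponent is large enough for \<open>(1 + \<bar>x\<bar>)\<^bsup>-2N\<^esup> \<le> \<Prod>\<^sub>i 1 / (1 + x\<^sub>i\<^sup>2)\<close>, which reduces integrability to
dimension one.\<close>

definition decay :: "real^'n::finite \<Rightarrow> real" where
  "decay x = 1 / (1 + norm x) ^ (2 * CARD('n))"

lemma decay_nonneg [simp]: "0 \<le> decay x"
  by (simp add: decay_def)

lemma decay_measurable [measurable]: "decay \<in> borel_measurable borel"
  unfolding decay_def by measurable

lemma integrable_decay: "integrable lborel (decay :: real^'n::finite \<Rightarrow> real)"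
proof (rule integrableI_bounded)
  define h :: "real \<Rightarrow> real" where "h y = 1 / (1 + y\<^sup>2)" for y
  have h_nn: "0 \<le> h y" for y by (simp add: h_def add_nonneg_nonneg)
  have "ennreal (norm (decay x)) \<le> (\<Prod>b\<in>Basis. ennreal (h (x \<bullet> b)))" for x :: "real^'n"
  proof -
    have "(\<Prod>b\<in>(Basis::(real^'n) set). 1 + (x \<bullet> b)\<^sup>2) \<le> (\<Prod>b\<in>(Basis::(real^'n) set). (1 + norm x)\<^sup>2)"
    proof (intro prod_mono conjI)
      fix b :: "real^'n" assume "b \<in> Basis"
      then have "\<bar>x \<bullet> b\<bar> \<le> norm x" by (rule Basis_le_norm)
      then have "(x \<bullet> b)\<^sup>2 \<le> (norm x)\<^sup>2" by (simp add: abs_le_square_iff[symmetric])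
      then show "1 + (x \<bullet> b)\<^sup>2 \<le> (1 + norm x)\<^sup>2"
        using norm_ge_zero[of x] by (simp add: power2_sum add_increasing2)
    qed (simp add: add_nonneg_nonneg)
    also have "\<dots> = (1 + norm x) ^ (2 * CARD('n))"
      by (simp add: power_mult)
    finally have "decay x \<le> 1 / (\<Prod>b\<in>(Basis::(real^'n) set). 1 + (x \<bullet> b)\<^sup>2)"
      unfolding decay_def by (intro divide_left_mono mult_pos_pos prod_pos zero_less_power) (auto intro: add_pos_nonneg)
    also have "\<dots> = (\<Prod>b\<in>(Basis::(real^'n) set). h (x \<bullet> b))"
      by (simp add: h_def prod_dividef)
    finally show ?thesis
      by (simp add: prod_ennreal h_nn ennreal_leI)
  qed
  then have "(\<integral>\<^sup>+x. ennreal (norm (decay (x::real^'n))) \<partial>lborel) \<le> (\<integral>\<^sup>+x. (\<Prod>b\<in>Basis. ennreal (h ((x::real^'n) \<bullet> b))) \<partial>lborel)"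
    by (intro nn_integral_mono)
  also have "\<dots> = (\<Prod>b\<in>(Basis::(real^'n) set). (\<integral>\<^sup>+y. ennreal (h y) \<partial>lborel))"
    by (rule nn_integral_lborel_prod) (auto simp: h_def)
  also have "\<dots> < \<infinity>"
  proof -
    have "(\<integral>\<^sup>+y. ennreal (h y) \<partial>lborel) < \<infinity>"
      using integrable_inverse_1_plus_square_lborel h_nn
      by (simp add: integrable_iff_bounded h_def)
    then show ?thesis by (simp add: power_less_top_ennreal)
  qed
  finally show "(\<integral>\<^sup>+x. ennreal (norm (decay (x::real^'n))) \<partial>lborel) < \<infinity>" .
qed (simp add: borel_measurable_if_D)

lemma rapid_decayD:
  fixes f :: "real^'n::finite \<Rightarrow> complex"
  assumes "rapid f"
  shows "\<exists>B. 0 < B \<and> (\<forall>x. norm (f x) \<le> B * decay x)"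
proof -
  obtain B where B: "0 < B" "\<And>x. (1 + norm x) ^ (2 * CARD('n)) * norm (f x) \<le> B"
    using rapidD[OF assms, of "2 * CARD('n)"] by blast
  have "norm (f x) \<le> B * decay x" for x
  proof -
    have "0 < (1 + norm x) ^ (2 * CARD('n))" by (simp add: add_pos_nonneg)
    then show ?thesis using B(2)[of x] by (simp add: decay_def field_simps)
  qed
  with B(1) show ?thesis by blast
qed

lemma differentiable_imp_borel_measurable:
  fixes f :: "real^'n::finite \<Rightarrow> complex"
  assumes "\<And>x. f differentiable at x"
  shows "f \<in> borel_measurable borel"
  using assms by (intro borel_measurable_continuous_onI continuous_at_imp_continuous_on ballI differentiable_imp_continuous_within)

lemma moderate_measurable: "moderate f \<Longrightarrow> f \<in> borel_measurable borel"
  by (intro differentiable_imp_borel_measurable moderateD(1))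

lemma schwartz_measurable: "schwartz f \<Longrightarrow> f \<in> borel_measurable borel"
  by (intro differentiable_imp_borel_measurable schwartzD(1))

lemma integrable_rapid:
  assumes "rapid f" and [measurable]: "f \<in> borel_measurable borel"
  shows "integrable lborel f"
proof -
  obtain B where B: "0 < B" "\<And>x. norm (f x) \<le> B * decay x"
    using rapid_decayD[OF assms(1)] by blast
  show ?thesis
    by (rule Bochner_Integration.integrable_bound[where f = "\<lambda>x. B * decay x"])
       (use B in \<open>auto simp: integrable_decay\<close>)
qed

lemma integrable_schwartz: "schwartz f \<Longrightarrow> integrable lborel f"
  by (intro integrable_rapid schwartzD schwartz_measurable)

section \<open>A function is determined by the distribution that it represents\<close>

lemma representsD:
  assumes "represents f T" "schwartz \<phi>"
  shows "integrable lborel (\<lambda>x. f x * \<phi> x)" "T \<phi> = (LINT x|lborel. f x * \<phi> x)"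
  using assms by (auto simp: represents_def)

text \<open>Multiplication by the Gaussian, a Schwartz function without zeros, gives an integrable function.\<close>

lemma represents_measurable:
  fixes f :: "real^'n::finite \<Rightarrow> complex"
  assumes "represents f T"
  shows "f \<in> borel_measurable borel"
proof -
  have [measurable]: "gauss \<in> borel_measurable (borel :: (real^'n) measure)"
    by (rule schwartz_measurable[OF schwartz_gauss])
  have [measurable]: "(\<lambda>x. f x * gauss x) \<in> borel_measurable borel"
    using representsD(1)[OF assms schwartz_gauss] by (auto dest: borel_measurable_integrable)
  have "(\<lambda>x. f x * gauss x / gauss x) \<in> borel_measurable borel" by measurable
  then show ?thesis by simp
qed

text \<open>For \<open>k = 0\<close> this is the smooth step \<open>exp (- exp (- n (x\<^sub>i - a)))\<close>, which tends to the indicator of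
\<open>x\<^sub>i > a\<close> off the hyperplane \<open>x\<^sub>i = a\<close> as \<open>n\<close> grows. The derivatives of the step are linear combinations of the
members with larger \<open>k\<close>.\<close>

definition step_deriv :: "nat \<Rightarrow> 'n::finite \<Rightarrow> real \<Rightarrow> nat \<Rightarrow> real^'n \<Rightarrow> complex" where
  "step_deriv n i a k x =
    (let u = exp (- (real n * (x $ i - a))) in of_real (u ^ k * exp (- u)))"

text \<open>With \<open>u = exp (- n (x\<^sub>i - a))\<close> one has \<open>\<partial>\<^sub>i (u\<^sup>k e\<^sup>-\<^sup>u) = - n k u\<^sup>k e\<^sup>-\<^sup>u + n u\<^sup>k\<^sup>+\<^sup>1 e\<^sup>-\<^sup>u\<close>, so the family is closed under
derivatives up to linear combinations, and \<open>u\<^sup>k e\<^sup>-\<^sup>u\<close> is bounded for \<open>u > 0\<close>.\<close>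

lemma moderate_step_deriv: "moderate (step_deriv n i a k :: real^'n::finite \<Rightarrow> complex)"
proof (rule moderate_alg[of "range (step_deriv n i a)"])
  fix f :: "real^'n \<Rightarrow> complex" assume "f \<in> range (step_deriv n i a)"
  then obtain k where f: "f = step_deriv n i a k" by blast
  define u where "u x = exp (- (real n * (x $ i - a)))" for x :: "real^'n"
  have du: "(u has_derivative (\<lambda>h. - real n * (h $ i) * u x)) (at x)" for x
    unfolding u_def
    by (rule derivative_eq_intros bounded_linear_imp_has_derivative[OF bounded_linear_vec_nth] refl)+
       (simp add: algebra_simps)
  have f_eq: "f = (\<lambda>x. of_real (u x ^ k * exp (- u x)))"
    by (simp add: f step_deriv_def u_def Let_def fun_eq_iff)
  have df: "(f has_derivative (\<lambda>h. of_real (h $ i * (- real n * real k * (u x ^ k * exp (- u x))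
      + real n * (u x ^ Suc k * exp (- u x)))))) (at x)" for x
  proof -
    have "((\<lambda>x. u x ^ k * exp (- u x)) has_derivative (\<lambda>h. h $ i * (- real n * real k * (u x ^ k * exp (- u x))
      + real n * (u x ^ Suc k * exp (- u x))))) (at x)"
      by (rule derivative_eq_intros du refl)+ (cases k; simp add: algebra_simps fun_eq_iff)
    then show ?thesis unfolding f_eq by (rule has_derivative_of_real)
  qed
  show "f differentiable at x" for x
    unfolding differentiable_def using df by blast
  show "poly_growth f"
  proof (rule poly_growth_bounded)
    fix x
    have "u x ^ k * exp (- u x) \<le> (real k ^ k * exp (u x)) * exp (- u x)"
      by (intro mult_right_mono power_le_exp) (auto simp: u_def)
    then show "norm (f x) \<le> real k ^ k"
      by (simp add: f_eq norm_mult norm_power mult.assoc exp_add[symmetric]) (simp add: u_def)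
  qed
  fix j
  define A where "A = complex_of_real (axis j 1 $ i * (- real n * real k))"
  define B where "B = complex_of_real (axis j 1 $ i * real n)"
  have "partial_deriv j f = (\<lambda>x. A * step_deriv n i a k x + B * step_deriv n i a (Suc k) x)"
    by (rule ext, subst partial_deriv_eq[OF df])
       (simp add: A_def B_def step_deriv_def u_def Let_def algebra_simps)
  also have "\<dots> \<in> alg (range (step_deriv n i a))"
    by (intro alg.add alg.mult alg.const alg.base rangeI)
  finally show "partial_deriv j f \<in> alg (range (step_deriv n i a))" .
qed (auto intro: alg.base)

abbreviation step :: "nat \<Rightarrow> 'n::finite \<Rightarrow> real \<Rightarrow> real^'n \<Rightarrow> complex" where
  "step n i a \<equiv> step_deriv n i a 0"

lemma norm_step_le: "norm (step n i a x) \<le> 1"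
  by (simp add: step_deriv_def Let_def)

lemma step_limit:
  assumes "x $ i \<noteq> a"
  shows "(\<lambda>n. step n i a x) \<longlonglongrightarrow> of_bool (a < x $ i)"
proof (cases "a < x $ i")
  case True
  have "(\<lambda>n. exp (- exp (- (real n * (x $ i - a))))) \<longlonglongrightarrow> 1"
    using True by real_asymp
  then show ?thesis using True tendsto_of_real by (fastforce simp: step_deriv_def Let_def)
next
  case False
  with assms have "x $ i < a" by simp
  then have "(\<lambda>n. exp (- exp (- (real n * (x $ i - a))))) \<longlonglongrightarrow> 0"
    by real_asymp
  then show ?thesis using False tendsto_of_real by (fastforce simp: step_deriv_def Let_def)
qed

lemma AE_component_neq: "AE x in lborel. (x::real^'n::finite) $ i \<noteq> a"
proof -
  have "{x::real^'n. x $ i = a} = {x. axis i 1 \<bullet> x = a}"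
    by (simp add: inner_axis inner_commute)
  moreover have "negligible {x::real^'n. axis i 1 \<bullet> x = a}"
    by (rule negligible_hyperplane) (simp add: axis_eq_0_iff)
  ultimately have "{x::real^'n. x $ i = a} \<in> null_sets lebesgue"
    by (simp add: negligible_iff_null_sets)
  moreover have "{x::real^'n. x $ i = a} \<in> sets borel" by measurable
  ultimately have "{x::real^'n. x $ i = a} \<in> null_sets lborel"
    by (simp add: null_sets_def)
  then show ?thesis by (rule AE_I'[of _ _ ]) auto
qed

text \<open>Testing against the Gaussian times a product of steps and letting the steps become indicators shows
that \<open>h\<close> times the Gaussian has integral zero over every open quadrant \<open>{x. \<forall>i. a\<^sub>i < x\<^sub>i}\<close>. The
quadrants are stable under intersection and generate the Borel sets, so the integral vanishes over
every Borel set.\<close>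

lemma represents_zero_AE:
  fixes h :: "real^'n::finite \<Rightarrow> complex"
  assumes h: "represents h (\<lambda>_. 0)"
  shows "AE x in lborel. h x = 0"
proof -
  define g where "g x = h x * gauss x" for x
  have [measurable]: "h \<in> borel_measurable borel" by (rule represents_measurable[OF h])
  have [measurable]: "gauss \<in> borel_measurable (borel :: (real^'n) measure)"
    by (rule schwartz_measurable[OF schwartz_gauss])
  have g_int: "integrable lborel g"
    unfolding g_def by (rule representsD(1)[OF h schwartz_gauss])
  then have [measurable]: "g \<in> borel_measurable borel" by (auto dest: borel_measurable_integrable)
  have g_all: "(LINT x|lborel. g x) = 0"
    unfolding g_def using representsD(2)[OF h schwartz_gauss] by simp
  have quadrant: "(LINT x|lborel. g x * of_bool (\<forall>i. a $ i < x $ i)) = 0" for a :: "real^'n"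
  proof -
    have [measurable]: "step n i b \<in> borel_measurable borel" for n and i :: 'n and b
      by (rule moderate_measurable[OF moderate_step_deriv])
    have "(\<lambda>n. LINT x|lborel. g x * (\<Prod>i\<in>UNIV. step n i (a $ i) x)) \<longlonglongrightarrow>
        (LINT x|lborel. g x * of_bool (\<forall>i. a $ i < x $ i))"
    proof (rule integral_dominated_convergence[where w = "\<lambda>x. norm (g x)"])
      have "AE x in lborel. \<forall>i. (x::real^'n) $ i \<noteq> a $ i"
        by (subst AE_all_countable) (simp add: AE_component_neq)
      then show "AE x in lborel. (\<lambda>n. g x * (\<Prod>i\<in>UNIV. step n i (a $ i) x)) \<longlonglongrightarrow> g x * of_bool (\<forall>i. a $ i < x $ i)"
      proof eventually_elim
        fix x :: "real^'n" assume x: "\<forall>i. x $ i \<noteq> a $ i"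
        have "(\<lambda>n. \<Prod>i\<in>UNIV. step n i (a $ i) x) \<longlonglongrightarrow> (\<Prod>i\<in>UNIV. of_bool (a $ i < x $ i))"
          by (intro tendsto_prod step_limit) (use x in auto)
        also have "(\<Prod>i\<in>UNIV. of_bool (a $ i < x $ i)) = (of_bool (\<forall>i. a $ i < x $ i) :: complex)"
          by (auto simp: of_bool_def prod_zero_iff)
        finally show "(\<lambda>n. g x * (\<Prod>i\<in>UNIV. step n i (a $ i) x)) \<longlonglongrightarrow> g x * of_bool (\<forall>i. a $ i < x $ i)"
          by (intro tendsto_mult tendsto_const)
      qed
      show "AE x in lborel. norm (g x * (\<Prod>i\<in>UNIV. step n i (a $ i) x)) \<le> norm (g x)" for n
      proof (rule AE_I2)
        fix x
        have "norm (\<Prod>i\<in>UNIV. step n i (a $ i) x) \<le> 1"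
          unfolding prod_norm[symmetric] by (intro prod_le_1) (auto intro: norm_step_le)
        then show "norm (g x * (\<Prod>i\<in>UNIV. step n i (a $ i) x)) \<le> norm (g x)"
          by (simp add: norm_mult mult_left_le)
      qed
      have "(\<lambda>x. of_bool (\<forall>i. a $ i < x $ i) :: complex) \<in> borel_measurable borel"
        by measurable
      then show "(\<lambda>x. g x * of_bool (\<forall>i. a $ i < x $ i)) \<in> borel_measurable lborel" by measurable
    qed (use g_int in auto)
    moreover have "(LINT x|lborel. g x * (\<Prod>i\<in>UNIV. step n i (a $ i) x)) = 0" for n
    proof -
      have "schwartz (\<lambda>x. (\<Prod>i\<in>UNIV. step n i (a $ i) x) * gauss x)"
        by (intro schwartz_moderate_gauss moderate_prod moderate_step_deriv) auto
      from representsD(2)[OF h this] show ?thesis by (simp add: g_def mult_ac)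
    qed
    ultimately show ?thesis by (simp add: LIMSEQ_const_iff)
  qed
  have zero: "(LINT x|lborel. indicator A x *\<^sub>R g x) = 0" if "A \<in> sets borel" for A
  proof -
    let ?G = "range (\<lambda>a::real^'n. {x. eucl_less a x})"
    have A: "A \<in> sigma_sets UNIV ?G"
      using that by (simp add: borel_eq_greaterThan)
    have stable: "Int_stable ?G"
    proof (rule Int_stableI, safe)
      fix a b :: "real^'n"
      have "{x. eucl_less a x} \<inter> {x. eucl_less b x} = {x. eucl_less (sup a b) x}"
        by (auto simp: eucl_less_def inner_Basis_sup_left sup_max)
      then show "{x. eucl_less a x} \<inter> {x. eucl_less b x} \<in> ?G" by blast
    qed
    have "?G \<subseteq> Pow UNIV" by simp
    from stable this A show ?thesis
    proof (induction rule: sigma_sets_induct_disjoint)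
      case (basic A)
      then obtain a where A: "A = {x. eucl_less a x}" by blast
      have "indicator A x *\<^sub>R g x = g x * of_bool (\<forall>i. a $ i < x $ i)" for x
        by (auto simp: A eucl_less_def Basis_vec_def inner_axis)
      then show ?case using quadrant[of a] by simp
    next
      case (compl A)
      have [measurable]: "A \<in> sets borel" using compl(1) by (simp add: borel_eq_greaterThan)
      have "(LINT x|lborel. indicator (UNIV - A) x *\<^sub>R g x) = (LINT x|lborel. g x - indicator A x *\<^sub>R g x)"
        by (intro Bochner_Integration.integral_cong) (auto simp: indicator_def)
      also have "\<dots> = 0"
        using compl(2) g_all by (subst Bochner_Integration.integral_diff) (auto intro: g_int integrable_mult_indicator)
      finally show ?case .
    next
      case (union A)
      have [measurable]: "A i \<in> sets borel" for i using union(2) by (auto simp: borel_eq_greaterThan)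
      have "(LINT x:(\<Union>i. A i)|lborel. g x) = (\<Sum>i. LINT x:A i|lborel. g x)"
        by (rule lebesgue_integral_countable_add)
           (use union(1) in \<open>auto simp: disjoint_family_on_def set_integrable_def intro!: integrable_mult_indicator g_int\<close>)
      then show ?case using union(3) by (simp add: set_lebesgue_integral_def)
    qed auto
  qed
  have "AE x in lborel. Re (g x) = 0"
  proof (rule density_unique_real)
    show "(LINT x:A|lborel. Re (g x)) = (LINT x:A|lborel. 0)" if "A \<in> sets lborel" for A
    proof -
      have "integrable lborel (\<lambda>x. indicator A x *\<^sub>R g x)"
        by (rule integrable_mult_indicator[OF that g_int])
      from integral_Re[OF this] show ?thesis using zero[of A] that
        by (simp add: set_lebesgue_integral_def)
    qed
  qed (use g_int in auto)
  moreover have "AE x in lborel. Im (g x) = 0"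
  proof (rule density_unique_real)
    show "(LINT x:A|lborel. Im (g x)) = (LINT x:A|lborel. 0)" if "A \<in> sets lborel" for A
    proof -
      have "integrable lborel (\<lambda>x. indicator A x *\<^sub>R g x)"
        by (rule integrable_mult_indicator[OF that g_int])
      from integral_Im[OF this] show ?thesis using zero[of A] that
        by (simp add: set_lebesgue_integral_def)
    qed
  qed (use g_int in auto)
  ultimately show ?thesis
  proof eventually_elim
    fix x assume "Re (g x) = 0" "Im (g x) = 0"
    then have "g x = 0" by (simp add: complex_eq_iff)
    then show "h x = 0" by (simp add: g_def)
  qed
qed

text \<open>All norms in the statement are defined through a chosen density. This uniqueness is what allows
them to be computed with any other density of the same distribution.\<close>

theorem represents_unique_AE:
  assumes f: "represents f T" and g: "represents g T"
  shows "AE x in lborel. f x = g x"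
proof -
  have "represents (\<lambda>x. f x - g x) (\<lambda>_. 0)"
    unfolding represents_def
    using representsD[OF f] representsD[OF g] by (auto simp: left_diff_distrib)
  from represents_zero_AE[OF this] show ?thesis by simp
qed

corollary vrepresents_unique_AE:
  assumes f: "vrepresents f T" and g: "vrepresents g T"
  shows "AE x in lborel. f x = g x"
proof -
  have "AE x in lborel. \<forall>k. f x $ k = g x $ k"
    using assms by (subst AE_all_countable) (auto simp: vrepresents_def intro: represents_unique_AE)
  then show ?thesis by (simp add: vec_eq_iff)
qed

lemma vrepresents_density_of: "vrepresents f T \<Longrightarrow> vrepresents (density_of T) T"
  unfolding density_of_def by (rule someI[of "\<lambda>f. vrepresents f T"])

lemma density_of_AE: "vrepresents f T \<Longrightarrow> AE x in lborel. density_of T x = f x"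
  by (rule vrepresents_unique_AE[OF vrepresents_density_of])

section \<open>Curves in normed spaces\<close>

text \<open>The difference quotient form is the one to which dominated convergence applies.\<close>

lemma has_vector_derivative_iff_tendsto:
  "(f has_vector_derivative y) (at t within S) \<longleftrightarrow>
    ((\<lambda>r. (f r - f t) /\<^sub>R (r - t)) \<longlongrightarrow> y) (at t within S)"
proof -
  have "(f has_vector_derivative y) (at t within S) \<longleftrightarrow>
      ((\<lambda>r. norm (f r - f t - (r - t) *\<^sub>R y) / norm (r - t)) \<longlongrightarrow> 0) (at t within S)"
    by (simp add: has_vector_derivative_def has_derivative_iff_norm bounded_linear_scaleR_left)
  also have "\<dots> \<longleftrightarrow> ((\<lambda>r. norm ((f r - f t) /\<^sub>R (r - t) - y)) \<longlongrightarrow> 0) (at t within S)"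
  proof (intro Lim_cong_within refl)
    fix r assume "r \<noteq> t"
    then have "f r - f t - (r - t) *\<^sub>R y = (r - t) *\<^sub>R ((f r - f t) /\<^sub>R (r - t) - y)"
      by (simp add: scaleR_right_diff_distrib)
    then show "norm (f r - f t - (r - t) *\<^sub>R y) / norm (r - t) = norm ((f r - f t) /\<^sub>R (r - t) - y)"
      using \<open>r \<noteq> t\<close> by (simp only: norm_scaleR) simp
  qed
  also have "\<dots> \<longleftrightarrow> ((\<lambda>r. (f r - f t) /\<^sub>R (r - t)) \<longlongrightarrow> y) (at t within S)"
    by (simp add: tendsto_norm_zero_iff Lim_null[symmetric])
  finally show ?thesis .
qed

lemma antimono_from_derivative:
  fixes f f' :: "real \<Rightarrow> real"
  assumes "\<And>t. 0 \<le> t \<Longrightarrow> (f has_vector_derivative f' t) (at t within {0..})"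
    and "\<And>t. 0 \<le> t \<Longrightarrow> f' t \<le> 0" and "0 \<le> t"
  shows "f t \<le> f 0"
proof -
  have "\<exists>x\<in>{0..t}. f t - f 0 = (t - 0) *\<^sub>R f' x"
  proof (rule mvt_very_simple[OF \<open>0 \<le> t\<close>])
    fix x assume "0 \<le> x" "x \<le> t"
    then show "(f has_derivative (\<lambda>h. h *\<^sub>R f' x)) (at x within {0..t})"
      using assms(1)[of x] unfolding has_vector_derivative_def
      by (rule_tac has_derivative_subset) auto
  qed
  then obtain x where "0 \<le> x" "f t - f 0 = t * f' x" by auto
  then show ?thesis using assms(2)[of x] assms(3) mult_nonneg_nonpos[of t "f' x"] by simp
qed

section \<open>The Fourier transform of Schwartz functions\<close>

lemma has_vector_derivative_bound:
  fixes f :: "real \<Rightarrow> 'a::real_normed_vector"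
  assumes "convex S" "\<And>x. x \<in> S \<Longrightarrow> (f has_vector_derivative f' x) (at x within S)"
    and "\<And>x. x \<in> S \<Longrightarrow> norm (f' x) \<le> B" "x \<in> S" "y \<in> S"
  shows "norm (f x - f y) \<le> B * norm (x - y)"
proof (rule differentiable_bound[of S f "\<lambda>x h. h *\<^sub>R f' x"])
  show "onorm (\<lambda>h. h *\<^sub>R f' x) \<le> B" if "x \<in> S" for x
    using assms(3)[OF that] onorm_le[of "\<lambda>h. h *\<^sub>R f' x" "norm (f' x)"]
    by (simp add: mult.commute)
qed (use assms in \<open>auto simp: has_vector_derivative_def\<close>)

definition fourier_const :: "'n::finite itself \<Rightarrow> real" where
  "fourier_const _ = (2 * pi) powr (- real CARD('n) / 2)"

lemma fourier_const_nonneg [simp]: "0 \<le> fourier_const TYPE('n::finite)"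
  by (simp add: fourier_const_def)

lemma fourier_eq:
  fixes \<phi> :: "real^'n::finite \<Rightarrow> complex"
  shows "fourier \<phi> \<xi> = of_real (fourier_const TYPE('n)) * (LINT x|lborel. cis (- (x \<bullet> \<xi>)) * \<phi> x)"
  by (simp add: fourier_def fourier_const_def)

lemma cis_inner_measurable [measurable]:
  "(\<lambda>x::real^'n::finite. cis (- (x \<bullet> \<xi>))) \<in> borel_measurable borel"
  by (rule moderate_measurable[OF moderate_cis])

lemma integrable_cis_mult:
  fixes f :: "real^'n::finite \<Rightarrow> complex"
  assumes "integrable lborel f"
  shows "integrable lborel (\<lambda>x. cis (- (x \<bullet> \<xi>)) * f x)"
proof (rule Bochner_Integration.integrable_bound[OF assms])
  have [measurable]: "f \<in> borel_measurable borel" using assms by (auto dest: borel_measurable_integrable)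
  show "(\<lambda>x. cis (- (x \<bullet> \<xi>)) * f x) \<in> borel_measurable lborel" by measurable
qed (simp add: norm_mult)

lemma norm_fourier_le:
  fixes f :: "real^'n::finite \<Rightarrow> complex"
  shows "norm (fourier f \<xi>) \<le> fourier_const TYPE('n) * (LINT x|lborel. norm (f x))"
proof -
  have "norm (LINT x|lborel. cis (- (x \<bullet> \<xi>)) * f x) \<le> (LINT x|lborel. norm (cis (- (x \<bullet> \<xi>)) * f x))"
    by (rule integral_norm_bound)
  then show ?thesis
    by (simp add: fourier_eq norm_mult mult_left_mono)
qed

text \<open>The quadratic remainder makes the error in the derivative of the transform bounded by
\<open>\<bar>h\<bar>\<^sup>2 \<integral> \<bar>x\<bar>\<^sup>2 \<bar>\<phi>\<bar>\<close>, without a separate limit argument under the integral.\<close>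

lemma norm_cis_taylor: "norm (cis \<theta> - 1 - \<i> * of_real \<theta>) \<le> \<theta>\<^sup>2"
proof -
  have "norm (cis \<theta> - (\<Sum>k\<le>1. (\<i> * of_real \<theta>) ^ k / fact k)) \<le> \<bar>\<theta>\<bar> ^ Suc 1 / fact (Suc 1)"
    using iexp_approx1[of \<theta> 1] by (simp add: cis_conv_exp)
  then show ?thesis
    using norm_ge_zero[of "cis \<theta> - (1 + \<i> * of_real \<theta>)"]
    by (simp add: diff_diff_eq power2_eq_square del: norm_ge_zero)
qed

lemma schwartz_coord_mult:
  "schwartz \<phi> \<Longrightarrow> schwartz (\<lambda>x::real^'n::finite. - \<i> * of_real (x $ i) * \<phi> x)"
  by (intro schwartz_mult moderate_mult moderate_coord) (rule moderate_const)

lemma has_derivative_fourier: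
  fixes \<phi> :: "real^'n::finite \<Rightarrow> complex"
  assumes \<phi>: "schwartz \<phi>"
  shows "(fourier \<phi> has_derivative
    (\<lambda>h. \<Sum>i\<in>UNIV. of_real (h $ i) * fourier (\<lambda>x. - \<i> * of_real (x $ i) * \<phi> x) \<xi>)) (at \<xi>)"
proof -
  let ?c = "fourier_const TYPE('n)"
  define M where "M = (LINT x|lborel. (norm x)\<^sup>2 * norm (\<phi> x))"
  have [measurable]: "\<phi> \<in> borel_measurable borel" by (rule schwartz_measurable[OF \<phi>])
  have int_\<phi>: "integrable lborel (\<lambda>x. cis (- (x \<bullet> \<zeta>)) * \<phi> x)" for \<zeta>
    by (intro integrable_cis_mult integrable_schwartz \<phi>)
  have int_coord: "integrable lborel (\<lambda>x. cis (- (x \<bullet> \<xi>)) * (- \<i> * of_real (x $ i) * \<phi> x))" for i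
    by (intro integrable_cis_mult integrable_schwartz schwartz_coord_mult \<phi>)
  have int_M: "integrable lborel (\<lambda>x. (norm x)\<^sup>2 * norm (\<phi> x))"
  proof -
    have "schwartz (\<lambda>x. (\<Sum>i\<in>UNIV. of_real (x $ i) ^ 2) * \<phi> x)"
      by (intro schwartz_mult \<phi> moderate_sum moderate_power moderate_coord) auto
    from integrable_norm[OF integrable_schwartz[OF this]]
    have "integrable lborel (\<lambda>x. norm ((\<Sum>i\<in>UNIV. complex_of_real (x $ i) ^ 2)) * norm (\<phi> x))"
      by (simp add: norm_mult)
    moreover have "norm ((\<Sum>i\<in>UNIV. complex_of_real (x $ i) ^ 2)) = (norm x)\<^sup>2" for x :: "real^'n"
    proof -
      have "(\<Sum>i\<in>UNIV. complex_of_real (x $ i) ^ 2) = of_real (\<Sum>i\<in>UNIV. (x $ i)\<^sup>2)" by simp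
      also have "norm \<dots> = (\<Sum>i\<in>UNIV. (x $ i)\<^sup>2)"
        unfolding norm_of_real by (simp add: sum_nonneg)
      also have "\<dots> = (norm x)\<^sup>2"
        by (simp add: norm_vec_def L2_set_def sum_nonneg)
      finally show ?thesis .
    qed
    ultimately show ?thesis by simp
  qed
  have bound: "norm (fourier \<phi> (\<xi> + h) - fourier \<phi> \<xi>
      - (\<Sum>i\<in>UNIV. of_real (h $ i) * fourier (\<lambda>x. - \<i> * of_real (x $ i) * \<phi> x) \<xi>)) \<le> ?c * M * (norm h)\<^sup>2" for h
  proof -
    have lin: "(\<Sum>i\<in>UNIV. of_real (h $ i) * (cis (- (x \<bullet> \<xi>)) * (- \<i> * of_real (x $ i) * \<phi> x)))
        = cis (- (x \<bullet> \<xi>)) * (- \<i> * of_real (x \<bullet> h)) * \<phi> x" for x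
      by (simp add: inner_vec_def sum_distrib_left sum_distrib_right mult_ac sum_negf)
    have "fourier \<phi> (\<xi> + h) - fourier \<phi> \<xi>
      - (\<Sum>i\<in>UNIV. of_real (h $ i) * fourier (\<lambda>x. - \<i> * of_real (x $ i) * \<phi> x) \<xi>)
      = of_real ?c * ((LINT x|lborel. cis (- (x \<bullet> (\<xi> + h))) * \<phi> x) - (LINT x|lborel. cis (- (x \<bullet> \<xi>)) * \<phi> x)
       - (\<Sum>i\<in>UNIV. of_real (h $ i) * (LINT x|lborel. cis (- (x \<bullet> \<xi>)) * (- \<i> * of_real (x $ i) * \<phi> x))))"
      by (simp only: fourier_eq right_diff_distrib sum_distrib_left mult_ac)
    also have "(LINT x|lborel. cis (- (x \<bullet> (\<xi> + h))) * \<phi> x) - (LINT x|lborel. cis (- (x \<bullet> \<xi>)) * \<phi> x)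
       - (\<Sum>i\<in>UNIV. of_real (h $ i) * (LINT x|lborel. cis (- (x \<bullet> \<xi>)) * (- \<i> * of_real (x $ i) * \<phi> x)))
      = (LINT x|lborel. cis (- (x \<bullet> (\<xi> + h))) * \<phi> x - cis (- (x \<bullet> \<xi>)) * \<phi> x
       - (\<Sum>i\<in>UNIV. of_real (h $ i) * (cis (- (x \<bullet> \<xi>)) * (- \<i> * of_real (x $ i) * \<phi> x))))"
      by (subst Bochner_Integration.integral_diff Bochner_Integration.integral_sum,
          (intro Bochner_Integration.integrable_diff Bochner_Integration.integrable_sum integrable_mult_right int_\<phi> int_coord)+)+
         simp
    also have "norm (of_real ?c * \<dots>) \<le> ?c * (LINT x|lborel. (norm h)\<^sup>2 * ((norm x)\<^sup>2 * norm (\<phi> x)))"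
    proof -
      have "norm (LINT x|lborel. cis (- (x \<bullet> (\<xi> + h))) * \<phi> x - cis (- (x \<bullet> \<xi>)) * \<phi> x
       - (\<Sum>i\<in>UNIV. of_real (h $ i) * (cis (- (x \<bullet> \<xi>)) * (- \<i> * of_real (x $ i) * \<phi> x))))
       \<le> (LINT x|lborel. (norm h)\<^sup>2 * ((norm x)\<^sup>2 * norm (\<phi> x)))"
      proof (rule Bochner_Integration.integral_norm_bound_integral)
        fix x :: "real^'n"
        have "cis (- (x \<bullet> (\<xi> + h))) * \<phi> x - cis (- (x \<bullet> \<xi>)) * \<phi> x
          - (\<Sum>i\<in>UNIV. of_real (h $ i) * (cis (- (x \<bullet> \<xi>)) * (- \<i> * of_real (x $ i) * \<phi> x)))
          = cis (- (x \<bullet> \<xi>)) * (cis (- (x \<bullet> h)) - 1 - \<i> * of_real (- (x \<bullet> h))) * \<phi> x"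
          unfolding lin by (simp add: inner_add_right cis_mult[symmetric] algebra_simps del: cis_mult)
             (simp add: cis_mult add.commute)
        also have "norm \<dots> \<le> (norm h)\<^sup>2 * ((norm x)\<^sup>2 * norm (\<phi> x))"
        proof -
          have "norm (cis (- (x \<bullet> h)) - 1 - \<i> * of_real (- (x \<bullet> h))) \<le> (- (x \<bullet> h))\<^sup>2"
            by (rule norm_cis_taylor)
          also have "\<dots> \<le> (norm x * norm h)\<^sup>2"
            using Cauchy_Schwarz_ineq2[of x h] by (simp add: abs_le_square_iff[symmetric])
          finally have "norm (cis (- (x \<bullet> h)) - 1 - \<i> * of_real (- (x \<bullet> h))) * norm (\<phi> x) \<le> (norm x * norm h)\<^sup>2 * norm (\<phi> x)"
            by (intro mult_right_mono) auto
          then show ?thesis by (simp add: norm_mult power_mult_distrib mult_ac)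
        qed
        finally show "norm (cis (- (x \<bullet> (\<xi> + h))) * \<phi> x - cis (- (x \<bullet> \<xi>)) * \<phi> x
          - (\<Sum>i\<in>UNIV. of_real (h $ i) * (cis (- (x \<bullet> \<xi>)) * (- \<i> * of_real (x $ i) * \<phi> x))))
          \<le> (norm h)\<^sup>2 * ((norm x)\<^sup>2 * norm (\<phi> x))" .
      qed (intro Bochner_Integration.integrable_diff Bochner_Integration.integrable_sum integrable_mult_right
            int_\<phi> int_coord int_M)+
      then show ?thesis by (simp add: norm_mult mult_left_mono)
    qed
    also have "\<dots> = ?c * M * (norm h)\<^sup>2"
      by (simp add: M_def)
    finally show ?thesis .
  qed
  have scale: "norm (X /\<^sub>R n) \<le> a * n" if "0 < n" "norm X \<le> a * n\<^sup>2" for X :: complex and n a :: real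
    using that by (simp add: divide_inverse[symmetric] field_simps power2_eq_square)
  show ?thesis
  proof (rule has_derivativeI)
    show "bounded_linear (\<lambda>h. \<Sum>i\<in>UNIV. of_real (h $ i) * fourier (\<lambda>x. - \<i> * of_real (x $ i) * \<phi> x) \<xi>)"
      by (intro bounded_linear_sum bounded_linear_mult_const bounded_linear_compose[OF bounded_linear_of_real] bounded_linear_vec_nth)
    show "((\<lambda>\<zeta>. (fourier \<phi> \<zeta> - fourier \<phi> \<xi> - (\<Sum>i\<in>UNIV. of_real ((\<zeta> - \<xi>) $ i) *
        fourier (\<lambda>x. - \<i> * of_real (x $ i) * \<phi> x) \<xi>)) /\<^sub>R norm (\<zeta> - \<xi>)) \<longlongrightarrow> 0) (at \<xi>)"
    proof (rule Lim_null_comparison)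
      show "((\<lambda>\<zeta>. ?c * M * norm (\<zeta> - \<xi>)) \<longlongrightarrow> 0) (at \<xi>)"
        by (auto intro!: tendsto_eq_intros)
      show "\<forall>\<^sub>F \<zeta> in at \<xi>. norm ((fourier \<phi> \<zeta> - fourier \<phi> \<xi> - (\<Sum>i\<in>UNIV. of_real ((\<zeta> - \<xi>) $ i) *
        fourier (\<lambda>x. - \<i> * of_real (x $ i) * \<phi> x) \<xi>)) /\<^sub>R norm (\<zeta> - \<xi>)) \<le> ?c * M * norm (\<zeta> - \<xi>)"
        unfolding eventually_at_filter
      proof (intro always_eventually allI impI)
        fix \<zeta> :: "real^'n" assume "\<zeta> \<noteq> \<xi>"
        then have "0 < norm (\<zeta> - \<xi>)" by simp
        then show "norm ((fourier \<phi> \<zeta> - fourier \<phi> \<xi> - (\<Sum>i\<in>UNIV. of_real ((\<zeta> - \<xi>) $ i) *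
          fourier (\<lambda>x. - \<i> * of_real (x $ i) * \<phi> x) \<xi>)) /\<^sub>R norm (\<zeta> - \<xi>)) \<le> ?c * M * norm (\<zeta> - \<xi>)"
          using scale[OF _ bound[of "\<zeta> - \<xi>", unfolded add_diff_cancel_left' add.commute[of \<xi>] diff_add_cancel]]
          by simp
      qed
    qed
  qed
qed

lemma partial_deriv_fourier:
  assumes "schwartz \<phi>"
  shows "partial_deriv i (fourier \<phi>) = fourier (\<lambda>x. - \<i> * of_real (x $ i) * \<phi> x)"
proof
  fix \<xi>
  show "partial_deriv i (fourier \<phi>) \<xi> = fourier (\<lambda>x. - \<i> * of_real (x $ i) * \<phi> x) \<xi>"
    unfolding partial_deriv_eq[OF has_derivative_fourier[OF assms]]
    by (subst sum.remove[of _ i]) (auto simp: axis_def intro!: sum.neutral)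
qed

text \<open>By translation invariance the integral of each difference quotient of \<open>\<psi>\<close> in direction \<open>i\<close> is zero,
and the quotients converge to the derivative. By the mean value inequality they are dominated by values of the
derivative at distance at most one, and \<open>decay\<close> grows at most by the factor \<open>2\<^sup>2\<^sup>N\<close> under such a translation.\<close>

lemma integral_partial_deriv_zero:
  fixes \<psi> :: "real^'n::finite \<Rightarrow> complex"
  assumes \<psi>: "schwartz \<psi>"
  shows "(LINT x|lborel. partial_deriv i \<psi> x) = 0"
proof -
  define e :: "real^'n" where "e = axis i 1"
  have [simp]: "norm e = 1" by (simp add: e_def norm_axis_1)
  have [measurable]: "\<psi> \<in> borel_measurable borel" "partial_deriv i \<psi> \<in> borel_measurable borel"
    by (auto intro: schwartz_measurable schwartzD \<psi>)
  have d: "((\<lambda>r. \<psi> (x + r *\<^sub>R e)) has_vector_derivative partial_deriv i \<psi> (x + t *\<^sub>R e)) (at t within S)" for x t S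
  proof -
    have "(\<psi> has_derivative frechet_derivative \<psi> (at (x + t *\<^sub>R e))) (at (x + t *\<^sub>R e))"
      using schwartzD(1)[OF \<psi>] by (simp add: frechet_derivative_works)
    moreover have "((\<lambda>r. x + r *\<^sub>R e) has_vector_derivative e) (at t within S)"
      by (auto intro!: derivative_eq_intros)
    ultimately have "(\<psi> \<circ> (\<lambda>r. x + r *\<^sub>R e) has_vector_derivative frechet_derivative \<psi> (at (x + t *\<^sub>R e)) e) (at t within S)"
      by (intro vector_derivative_diff_chain_within) (auto intro: has_derivative_at_withinI)
    then show ?thesis by (simp add: o_def partial_deriv_def e_def)
  qed
  obtain B where B: "0 < B" "\<And>x. norm (partial_deriv i \<psi> x) \<le> B * decay x"
    using rapid_decayD[OF schwartzD(2)[OF schwartzD(3)[OF \<psi>]]] by blast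
  define K where "K = B * 2 ^ (2 * CARD('n))"
  define s where "s n x = real (Suc n) *\<^sub>R (\<psi> (x + inverse (real (Suc n)) *\<^sub>R e) - \<psi> x)" for n x
  have near: "norm (partial_deriv i \<psi> (x + t *\<^sub>R e)) \<le> K * decay x" if "0 \<le> t" "t \<le> 1" for x t
  proof -
    have "norm x \<le> norm (x + t *\<^sub>R e) + norm (t *\<^sub>R e)"
      using norm_triangle_ineq4[of "x + t *\<^sub>R e" "t *\<^sub>R e"] by simp
    then have "1 + norm x \<le> 2 * (1 + norm (x + t *\<^sub>R e))"
      using that norm_ge_zero[of "x + t *\<^sub>R e"] by (simp del: norm_ge_zero)
    then have "(1 + norm x) ^ (2 * CARD('n)) \<le> (2 * (1 + norm (x + t *\<^sub>R e))) ^ (2 * CARD('n))"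
      by (intro power_mono) auto
    then have "(1 + norm x) ^ (2 * CARD('n)) \<le> 2 ^ (2 * CARD('n)) * (1 + norm (x + t *\<^sub>R e)) ^ (2 * CARD('n))"
      by (simp only: power_mult_distrib)
    moreover have "0 < (1 + norm x) ^ (2 * CARD('n))" "0 < (1 + norm (x + t *\<^sub>R e)) ^ (2 * CARD('n))"
      by (intro zero_less_power add_pos_nonneg; simp)+
    ultimately have "decay (x + t *\<^sub>R e) \<le> 2 ^ (2 * CARD('n)) * decay x"
      by (simp add: decay_def field_simps)
    then have "B * decay (x + t *\<^sub>R e) \<le> K * decay x"
      using B(1) by (simp add: K_def mult.assoc)
    with B(2)[of "x + t *\<^sub>R e"] show ?thesis by simp
  qed
  have "(\<lambda>n. LINT x|lborel. s n x) \<longlonglongrightarrow> (LINT x|lborel. partial_deriv i \<psi> x)"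
  proof (rule integral_dominated_convergence[where w = "\<lambda>x. K * decay x"])
    show "integrable lborel (\<lambda>x. K * decay (x::real^'n))" by (simp add: integrable_decay)
    show "AE x in lborel. (\<lambda>n. s n x) \<longlonglongrightarrow> partial_deriv i \<psi> x"
    proof (rule AE_I2)
      fix x
      have "((\<lambda>r. (\<psi> (x + r *\<^sub>R e) - \<psi> x) /\<^sub>R r) \<longlongrightarrow> partial_deriv i \<psi> x) (at 0)"
        using d[of x 0 UNIV] by (simp add: has_vector_derivative_iff_tendsto)
      moreover have "filterlim (\<lambda>n. inverse (real (Suc n))) (at 0) sequentially"
        using LIMSEQ_inverse_real_of_nat by (auto simp: filterlim_at)
      ultimately have "(\<lambda>n. (\<psi> (x + inverse (real (Suc n)) *\<^sub>R e) - \<psi> x) /\<^sub>R inverse (real (Suc n))) \<longlonglongrightarrow> partial_deriv i \<psi> x"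
        by (rule filterlim_compose)
      then show "(\<lambda>n. s n x) \<longlonglongrightarrow> partial_deriv i \<psi> x" by (simp add: s_def)
    qed
    show "AE x in lborel. norm (s n x) \<le> K * decay x" for n
    proof (rule AE_I2)
      fix x
      define r where "r = inverse (real (Suc n))"
      have r: "0 < r" "r \<le> 1" by (simp_all add: r_def field_simps)
      have "norm (\<psi> (x + r *\<^sub>R e) - \<psi> (x + 0 *\<^sub>R e)) \<le> K * decay x * norm (r - 0)"
      proof (rule has_vector_derivative_bound[of "{0..1}"])
      qed (use r near d in auto)
      then have "norm (\<psi> (x + r *\<^sub>R e) - \<psi> x) / r \<le> K * decay x"
        using r(1) by (simp add: pos_divide_le_eq)
      moreover have "norm (s n x) = norm (\<psi> (x + r *\<^sub>R e) - \<psi> x) / r"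
        using r(1) unfolding s_def r_def[symmetric] by (simp add: r_def divide_inverse mult.commute del: of_nat_Suc)
      ultimately show "norm (s n x) \<le> K * decay x" by simp
    qed
    show "s n \<in> borel_measurable lborel" for n unfolding s_def by measurable
  qed measurable
  moreover have "(LINT x|lborel. s n x) = 0" for n
  proof -
    let ?r = "inverse (real (Suc n))"
    have i1: "integrable lborel \<psi>" by (rule integrable_schwartz[OF \<psi>])
    have dist: "lborel = distr lborel borel ((+) (?r *\<^sub>R e))" by (rule lborel_distr_plus[symmetric])
    have "(LINT x|lborel. \<psi> x) = (LINT x|distr lborel borel ((+) (?r *\<^sub>R e)). \<psi> x)"
      using dist by simp
    also have "\<dots> = (LINT x|lborel. \<psi> (?r *\<^sub>R e + x))"
      by (rule integral_distr) measurable
    finally have eq: "(LINT x|lborel. \<psi> (x + ?r *\<^sub>R e)) = (LINT x|lborel. \<psi> x)" by (simp add: add.commute)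
    have "integrable (distr lborel borel ((+) (?r *\<^sub>R e))) \<psi>"
      using dist i1 by simp
    then have i2: "integrable lborel (\<lambda>x. \<psi> (x + ?r *\<^sub>R e))"
      by (subst (asm) integrable_distr_eq) (auto simp: add.commute)
    show ?thesis
      unfolding s_def using eq Bochner_Integration.integral_diff[OF i2 i1] by (simp del: of_nat_Suc)
  qed
  ultimately show ?thesis by (simp add: LIMSEQ_const_iff)
qed

text \<open>Integration by parts: the derivative of the product of \<open>\<phi>\<close> with the character has integral zero.\<close>

lemma fourier_partial_deriv:
  fixes \<phi> :: "real^'n::finite \<Rightarrow> complex"
  assumes \<phi>: "schwartz \<phi>"
  shows "fourier (partial_deriv i \<phi>) \<xi> = \<i> * of_real (\<xi> $ i) * fourier \<phi> \<xi>"
proof -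
  have dc: "(\<lambda>x. cis (- (x \<bullet> \<xi>))) differentiable at x" for x :: "real^'n"
    by (rule moderateD(1)[OF moderate_cis])
  have "partial_deriv i (\<lambda>x. cis (- (x \<bullet> \<xi>)) * \<phi> x) =
      (\<lambda>x. (- \<i> * of_real (\<xi> $ i)) * (cis (- (x \<bullet> \<xi>)) * \<phi> x) + cis (- (x \<bullet> \<xi>)) * partial_deriv i \<phi> x)"
    unfolding partial_deriv_mult[OF dc schwartzD(1)[OF \<phi>]]
    by (simp add: fun_eq_iff partial_deriv_eq[OF has_derivative_cis_inner] inner_axis' scaleR_conv_of_real)
  moreover have "schwartz (\<lambda>x. cis (- (x \<bullet> \<xi>)) * \<phi> x)"
    by (intro schwartz_mult moderate_cis \<phi>)
  from integral_partial_deriv_zero[OF this, of i]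
  have "(LINT x|lborel. partial_deriv i (\<lambda>x. cis (- (x \<bullet> \<xi>)) * \<phi> x) x) = 0" .
  ultimately have "(LINT x|lborel. (- \<i> * of_real (\<xi> $ i)) * (cis (- (x \<bullet> \<xi>)) * \<phi> x) + cis (- (x \<bullet> \<xi>)) * partial_deriv i \<phi> x) = 0"
    by simp
  moreover have "integrable lborel (\<lambda>x. cis (- (x \<bullet> \<xi>)) * \<phi> x)"
     "integrable lborel (\<lambda>x. cis (- (x \<bullet> \<xi>)) * partial_deriv i \<phi> x)"
    by (intro integrable_cis_mult integrable_schwartz schwartzD(3) \<phi>)+
  ultimately have "(- \<i> * of_real (\<xi> $ i)) * (LINT x|lborel. cis (- (x \<bullet> \<xi>)) * \<phi> x)
      + (LINT x|lborel. cis (- (x \<bullet> \<xi>)) * partial_deriv i \<phi> x) = 0"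
    by (subst (asm) Bochner_Integration.integral_add) (auto intro: integrable_mult_right)
  then have "(LINT x|lborel. cis (- (x \<bullet> \<xi>)) * partial_deriv i \<phi> x)
      = \<i> * of_real (\<xi> $ i) * (LINT x|lborel. cis (- (x \<bullet> \<xi>)) * \<phi> x)"
    by (simp add: algebra_simps)
  then show ?thesis by (simp add: fourier_eq mult_ac)
qed

text \<open>Every further factor \<open>\<xi>\<^sub>i\<close> is absorbed by replacing \<open>\<phi>\<close> with \<open>\<partial>\<^sub>i \<phi>\<close>.\<close>

lemma rapid_fourier:
  fixes \<phi> :: "real^'n::finite \<Rightarrow> complex"
  assumes "schwartz \<phi>"
  shows "rapid (fourier \<phi>)"
  unfolding rapid_def
proof
  fix m
  show "\<exists>B. \<forall>\<xi>. (1 + norm \<xi>) ^ m * norm (fourier \<phi> \<xi>) \<le> B"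
    using assms
  proof (induction m arbitrary: \<phi>)
    case 0
    show ?case
      by (intro exI[of _ "fourier_const TYPE('n) * (LINT x|lborel. norm (\<phi> x))"]) (simp add: norm_fourier_le)
  next
    case (Suc m)
    obtain B0 where B0: "\<And>\<xi>. (1 + norm \<xi>) ^ m * norm (fourier \<phi> \<xi>) \<le> B0"
      using Suc by blast
    have "\<forall>i. \<exists>B. \<forall>\<xi>. (1 + norm \<xi>) ^ m * norm (fourier (partial_deriv i \<phi>) \<xi>) \<le> B"
      using Suc.IH schwartzD(3)[OF Suc.prems] by blast
    then obtain B where B: "\<And>i \<xi>. (1 + norm \<xi>) ^ m * norm (fourier (partial_deriv i \<phi>) \<xi>) \<le> B i"
      by metis
    have "(1 + norm \<xi>) ^ Suc m * norm (fourier \<phi> \<xi>) \<le> B0 + (\<Sum>i\<in>UNIV. B i)" for \<xi>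
    proof -
      have "(1 + norm \<xi>) ^ Suc m * norm (fourier \<phi> \<xi>)
          = (1 + norm \<xi>) ^ m * norm (fourier \<phi> \<xi>) + norm \<xi> * ((1 + norm \<xi>) ^ m * norm (fourier \<phi> \<xi>))"
        by (simp add: algebra_simps)
      also have "norm \<xi> * ((1 + norm \<xi>) ^ m * norm (fourier \<phi> \<xi>))
          \<le> (\<Sum>i\<in>UNIV. \<bar>\<xi> $ i\<bar>) * ((1 + norm \<xi>) ^ m * norm (fourier \<phi> \<xi>))"
        by (intro mult_right_mono norm_le_l1_cart) auto
      also have "\<dots> = (\<Sum>i\<in>UNIV. (1 + norm \<xi>) ^ m * norm (fourier (partial_deriv i \<phi>) \<xi>))"
        by (simp add: fourier_partial_deriv[OF Suc.prems] norm_mult sum_distrib_left sum_distrib_right mult_ac)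
      also have "\<dots> \<le> (\<Sum>i\<in>UNIV. B i)"
        by (intro sum_mono B)
      finally show ?thesis using B0[of \<xi>] by linarith
    qed
    then show ?case by blast
  qed
qed

text \<open>The set of transforms of Schwartz functions is closed under partial derivatives, because these
correspond to multiplication by coordinates before the transform.\<close>

theorem schwartz_fourier: "schwartz \<phi> \<Longrightarrow> schwartz (fourier \<phi>)"
proof (rule schwartz_coinduct[of _ "fourier ` Collect schwartz"])
  fix f :: "real^'n::finite \<Rightarrow> complex" and x assume "f \<in> fourier ` Collect schwartz"
  then show "f differentiable at x"
    unfolding differentiable_def using has_derivative_fourier by blast
next
  fix f :: "real^'n::finite \<Rightarrow> complex" and i assume "f \<in> fourier ` Collect schwartz"
  then show "partial_deriv i f \<in> fourier ` Collect schwartz"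
    using schwartz_coord_mult[of _ i] by (auto simp: partial_deriv_fourier)
qed (auto intro: rapid_fourier)

text \<open>For an integrable density the distributional transform is the classical one. This is Fubini's
theorem, applied after evaluating \<open>T\<close> at the transform of the test function, which is a Schwartz function.\<close>

theorem represents_fourier_integrable:
  fixes f :: "real^'n::finite \<Rightarrow> complex"
  assumes f: "integrable lborel f" and rep: "represents f T"
  shows "represents (fourier f) (dist_fourier T)"
  unfolding represents_def
proof (intro allI impI conjI)
  fix \<phi> :: "real^'n \<Rightarrow> complex" assume \<phi>: "schwartz \<phi>"
  have [measurable]: "f \<in> borel_measurable borel" using f by (auto dest: borel_measurable_integrable)
  have [measurable]: "\<phi> \<in> borel_measurable borel" by (rule schwartz_measurable[OF \<phi>])
  have cis_meas: "(\<lambda>p. cis (- ((fst p :: real^'n) \<bullet> snd p))) \<in> borel_measurable (borel \<Otimes>\<^sub>M borel)"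
    unfolding cis_conv_exp by measurable
  have int: "integrable (lborel \<Otimes>\<^sub>M lborel) (\<lambda>(\<xi>, x). f \<xi> * (cis (- (\<xi> \<bullet> x)) * \<phi> x))"
  proof (rule lborel_pair.Fubini_integrable)
    show "(\<lambda>(\<xi>, x). f \<xi> * (cis (- (\<xi> \<bullet> x)) * \<phi> x)) \<in> borel_measurable (lborel \<Otimes>\<^sub>M lborel)"
      using cis_meas by (simp add: case_prod_beta' cong: measurable_cong_sets)
    show "integrable lborel (\<lambda>\<xi>. LINT x|lborel. norm (case (\<xi>, x) of (\<xi>, x) \<Rightarrow> f \<xi> * (cis (- (\<xi> \<bullet> x)) * \<phi> x)))"
      using integrable_norm[OF f] by (simp add: norm_mult)
    show "AE \<xi> in lborel. integrable lborel (\<lambda>x. case (\<xi>, x) of (\<xi>, x) \<Rightarrow> f \<xi> * (cis (- (\<xi> \<bullet> x)) * \<phi> x))"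
      using integrable_cis_mult[OF integrable_schwartz[OF \<phi>]]
      by (auto simp: inner_commute intro!: AE_I2 integrable_mult_right)
  qed
  let ?c = "complex_of_real (fourier_const TYPE('n))"
  have eq1: "(LINT \<xi>|lborel. f \<xi> * (cis (- (\<xi> \<bullet> x)) * \<phi> x)) = (LINT \<xi>|lborel. cis (- (\<xi> \<bullet> x)) * f \<xi>) * \<phi> x" for x
    by (subst integral_mult_left_zero[symmetric]) (simp add: mult_ac)
  have eq2: "(LINT x|lborel. f \<xi> * (cis (- (\<xi> \<bullet> x)) * \<phi> x)) = f \<xi> * (LINT x|lborel. cis (- (x \<bullet> \<xi>)) * \<phi> x)" for \<xi>
    by (simp add: inner_commute)
  have "integrable lborel (\<lambda>x. LINT \<xi>|lborel. f \<xi> * (cis (- (\<xi> \<bullet> x)) * \<phi> x))"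
    using lborel_pair.integrable_snd[OF int] by simp
  then have "integrable lborel (\<lambda>x. ?c * ((LINT \<xi>|lborel. cis (- (\<xi> \<bullet> x)) * f \<xi>) * \<phi> x))"
    unfolding eq1 by (rule integrable_mult_right)
  then show "integrable lborel (\<lambda>x. fourier f x * \<phi> x)"
    by (simp add: fourier_eq mult_ac)
  have "dist_fourier T \<phi> = (LINT \<xi>|lborel. f \<xi> * fourier \<phi> \<xi>)"
    unfolding dist_fourier_def by (rule representsD(2)[OF rep schwartz_fourier[OF \<phi>]])
  also have "\<dots> = ?c * (LINT \<xi>|lborel. f \<xi> * (LINT x|lborel. cis (- (x \<bullet> \<xi>)) * \<phi> x))"
    by (rule trans[OF Bochner_Integration.integral_cong[OF refl] integral_mult_right_zero]) (simp add: fourier_eq)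
  also have "(LINT \<xi>|lborel. f \<xi> * (LINT x|lborel. cis (- (x \<bullet> \<xi>)) * \<phi> x))
      = (LINT \<xi>|lborel. LINT x|lborel. f \<xi> * (cis (- (\<xi> \<bullet> x)) * \<phi> x))"
    by (simp only: eq2)
  also have "\<dots> = (LINT x|lborel. LINT \<xi>|lborel. f \<xi> * (cis (- (\<xi> \<bullet> x)) * \<phi> x))"
    using lborel_pair.Fubini_integral[OF int] by simp
  also have "?c * \<dots> = (LINT x|lborel. fourier f x * \<phi> x)"
    unfolding eq1 by (simp add: fourier_eq mult.assoc)
  finally show "dist_fourier T \<phi> = (LINT x|lborel. fourier f x * \<phi> x)" .
qed

section \<open>Decay of the ordinary differential equation at one frequency\<close>

text \<open>In the unknowns \<open>v = \<tau> y'' + y'\<close>, \<open>w = \<tau> y' + y\<close>, \<open>z = y'\<close> the equation at a frequency with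
\<open>\<bar>\<xi>\<bar>\<^sup>2 = q\<close> becomes \<open>v' = - q w - \<delta> q z\<close>, \<open>w' = v\<close>, \<open>\<tau> z' = v - z\<close> with \<open>\<delta> = \<beta> - \<tau>\<close>. The weights are
chosen such that all indefinite terms cancel in the derivative of the energy, which is
\<open>- 2 \<delta> q \<bar>z\<bar>\<^sup>2\<close>.\<close>

definition energy :: "real \<Rightarrow> real \<Rightarrow> real \<Rightarrow> 'a::real_inner \<Rightarrow> 'a \<Rightarrow> 'a \<Rightarrow> real" where
  "energy \<tau> \<delta> q v w z = v \<bullet> v + q * (w \<bullet> w) + \<tau> * \<delta> * q * (z \<bullet> z)"

text \<open>The energy is dissipated through \<open>z\<close> only. The derivative of \<open>v \<bullet> w\<close> contains \<open>\<bar>v\<bar>\<^sup>2 - q \<bar>w\<bar>\<^sup>2\<close> and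
that of \<open>- \<tau> (v \<bullet> z)\<close> contains \<open>- \<bar>v\<bar>\<^sup>2\<close>, so that this combination contributes
\<open>- \<bar>v\<bar>\<^sup>2 - q \<bar>w\<bar>\<^sup>2\<close>.\<close>

definition cross :: "real \<Rightarrow> 'a::real_inner \<Rightarrow> 'a \<Rightarrow> 'a \<Rightarrow> real" where
  "cross \<tau> v w z = v \<bullet> w - 2 * \<tau> * (v \<bullet> z)"

lemma energy_nonneg:
  assumes "0 < \<tau>" "0 < \<delta>" "0 \<le> q"
  shows "0 \<le> energy \<tau> \<delta> q v w z"
  using assms by (simp add: energy_def)

text \<open>Young's inequality, from expanding the square of \<open>a \<plusminus> (c / 2e) b\<close>.\<close>

lemma inner_le_weighted:
  fixes a b :: "'a::real_inner"
  assumes "0 < e"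
  shows "\<bar>c * (a \<bullet> b)\<bar> \<le> e * (a \<bullet> a) + c\<^sup>2 / (4 * e) * (b \<bullet> b)"
proof -
  have nonneg: "0 \<le> e * (a \<bullet> a) + c\<^sup>2 / (4 * e) * (b \<bullet> b) + s * c * (a \<bullet> b)" if "s\<^sup>2 = 1" for s
  proof -
    have "0 \<le> e * ((a + (s * c / (2 * e)) *\<^sub>R b) \<bullet> (a + (s * c / (2 * e)) *\<^sub>R b))"
      using assms by simp
    also have "\<dots> = e * (a \<bullet> a) + s\<^sup>2 * c\<^sup>2 / (4 * e) * (b \<bullet> b) + s * c * (a \<bullet> b)"
      using assms by (simp add: inner_add_left inner_add_right inner_commute field_simps power2_eq_square)
    finally show ?thesis using that by simp
  qed
  show ?thesis using nonneg[of 1] nonneg[of "-1"] by simp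
qed

text \<open>The factor \<open>q / (1 + q)\<close> is the decay rate. It behaves like \<open>q\<close> for small frequencies, where the
energy controls \<open>w\<close> and \<open>z\<close> only with the weight \<open>q\<close>, and it stays bounded for large ones.\<close>

lemma ratio_bounds:
  fixes q :: real
  assumes "0 \<le> q"
  defines "\<rho> \<equiv> q / (1 + q)"
  shows "0 \<le> \<rho>" "\<rho> \<le> 1" "\<rho> \<le> q" "\<rho>\<^sup>2 \<le> q"
proof -
  show 1: "0 \<le> \<rho>" "\<rho> \<le> 1" using assms by (simp_all add: \<rho>_def)
  show 2: "\<rho> \<le> q"
    using assms mult_nonneg_nonneg[of q q] by (simp add: \<rho>_def field_simps)
  have "\<rho>\<^sup>2 \<le> \<rho>" using 1 by (simp add: power2_eq_square mult_left_le)
  with 2 show "\<rho>\<^sup>2 \<le> q" by simp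
qed

text \<open>Each product is split by Young's inequality with the whole factor \<open>\<rho>\<close> on the second vector. This
leaves \<open>\<rho>\<^sup>2 \<le> q\<close>, the weight that \<open>w\<close> and \<open>z\<close> have in the energy.\<close>

lemma cross_le_energy:
  fixes v w z :: "'a::real_inner"
  assumes "0 < \<tau>" "0 < \<delta>" "0 \<le> q"
  shows "q / (1 + q) * \<bar>cross \<tau> v w z\<bar> \<le> (1/2 + \<tau> + 1/\<delta>) * energy \<tau> \<delta> q v w z"
proof -
  define \<rho> where "\<rho> = q / (1 + q)"
  note \<rho> = ratio_bounds[OF assms(3), folded \<rho>_def]
  have vv: "0 \<le> v \<bullet> v" "0 \<le> w \<bullet> w" "0 \<le> z \<bullet> z" by simp_all
  have "\<bar>\<rho> * (v \<bullet> w)\<bar> \<le> 1/2 * (v \<bullet> v) + \<rho>\<^sup>2 / (4 * (1/2)) * (w \<bullet> w)"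
    by (rule inner_le_weighted) simp
  also have "\<dots> \<le> 1/2 * (v \<bullet> v) + q / 2 * (w \<bullet> w)"
    using \<rho>(4) vv by (intro add_mono mult_right_mono) auto
  finally have 1: "\<bar>\<rho> * (v \<bullet> w)\<bar> \<le> 1/2 * (v \<bullet> v) + q / 2 * (w \<bullet> w)" .
  have "\<bar>(2 * \<tau> * \<rho>) * (v \<bullet> z)\<bar> \<le> \<tau> * (v \<bullet> v) + (2 * \<tau> * \<rho>)\<^sup>2 / (4 * \<tau>) * (z \<bullet> z)"
    by (rule inner_le_weighted) fact
  also have "(2 * \<tau> * \<rho>)\<^sup>2 / (4 * \<tau>) = \<tau> * \<rho>\<^sup>2"
    using assms by (simp add: power2_eq_square)
  also have "\<tau> * (v \<bullet> v) + \<tau> * \<rho>\<^sup>2 * (z \<bullet> z) \<le> \<tau> * (v \<bullet> v) + \<tau> * q * (z \<bullet> z)"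
    using \<rho>(4) vv assms by (intro add_mono mult_right_mono mult_left_mono) auto
  finally have 2: "\<bar>(2 * \<tau> * \<rho>) * (v \<bullet> z)\<bar> \<le> \<tau> * (v \<bullet> v) + \<tau> * q * (z \<bullet> z)" .
  have e: "v \<bullet> v \<le> energy \<tau> \<delta> q v w z" "v \<bullet> v + q * (w \<bullet> w) \<le> energy \<tau> \<delta> q v w z"
    using assms by (simp_all add: energy_def)
  have e3: "\<tau> * (v \<bullet> v) + \<tau> * q * (z \<bullet> z) \<le> (\<tau> + 1/\<delta>) * energy \<tau> \<delta> q v w z"
  proof -
    have "\<tau> * q * (z \<bullet> z) \<le> 1/\<delta> * energy \<tau> \<delta> q v w z"
      using assms by (simp add: energy_def field_simps)
    moreover have "\<tau> * (v \<bullet> v) \<le> \<tau> * energy \<tau> \<delta> q v w z"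
      using e(1) assms(1) by (intro mult_left_mono) auto
    ultimately show ?thesis by (simp add: distrib_right)
  qed
  have "\<rho> * \<bar>cross \<tau> v w z\<bar> = \<bar>\<rho> * cross \<tau> v w z\<bar>"
    using \<rho>(1) by (simp add: abs_mult)
  also have "\<dots> = \<bar>\<rho> * (v \<bullet> w) - (2 * \<tau> * \<rho>) * (v \<bullet> z)\<bar>"
    by (simp add: cross_def algebra_simps)
  also have "\<dots> \<le> (1/2 * (v \<bullet> v) + q / 2 * (w \<bullet> w)) + (\<tau> * (v \<bullet> v) + \<tau> * q * (z \<bullet> z))"
    using 1 2 by linarith
  also have "\<dots> \<le> (1/2 + \<tau> + 1/\<delta>) * energy \<tau> \<delta> q v w z"
    using e(2) e3 by (simp add: distrib_right)
  finally show ?thesis by (simp add: \<rho>_def)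
qed

text \<open>The left-hand side is the derivative of \<open>energy + \<epsilon> \<rho> cross\<close> along the system. Young's inequality absorbs
the mixed terms of the cross part into half of the new damping of \<open>v\<close> and \<open>w\<close> and into \<open>M q \<bar>z\<bar>\<^sup>2\<close>, which
uses \<open>\<rho> \<le> 1\<close> and \<open>\<rho> \<le> q\<close>. For small \<open>\<epsilon>\<close> the latter is at most half of the dissipation of the energy.\<close>

lemma lyapunov_derivative_le:
  fixes v w z :: "'a::real_inner"
  assumes \<tau>: "0 < \<tau>" and \<delta>: "0 < \<delta>" and q: "0 \<le> q"
  defines "\<rho> \<equiv> q / (1 + q)" and "M \<equiv> (2 * \<tau> - \<delta>)\<^sup>2 / 2 + 2 * \<tau> * \<delta> + 2"
  assumes \<epsilon>: "0 < \<epsilon>" "\<epsilon> * M \<le> \<delta>" "\<epsilon> * (1/2 + \<tau> + 1/\<delta>) \<le> 1/2"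
    and \<kappa>: "0 < \<kappa>" "\<kappa> \<le> \<epsilon> / 3" "\<kappa> \<le> 2 / (3 * \<tau>)"
  shows "- 2 * \<delta> * q * (z \<bullet> z) + \<epsilon> * \<rho> * (- (v \<bullet> v) - q * (w \<bullet> w) + (2 * \<tau> - \<delta>) * q * (w \<bullet> z)
      + 2 * \<tau> * \<delta> * q * (z \<bullet> z) + 2 * (v \<bullet> z))
    \<le> - (\<kappa> * \<rho>) * (energy \<tau> \<delta> q v w z + \<epsilon> * \<rho> * cross \<tau> v w z)"
proof -
  note \<rho> = ratio_bounds[OF q, folded \<rho>_def]
  define x where "x = v \<bullet> v + q * (w \<bullet> w)"
  define y where "y = q * (z \<bullet> z)"
  have nn: "0 \<le> x" "0 \<le> y" "0 \<le> z \<bullet> z" using q by (simp_all add: x_def y_def)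
  have 1: "(2 * \<tau> - \<delta>) * (w \<bullet> z) \<le> 1/2 * (w \<bullet> w) + (2 * \<tau> - \<delta>)\<^sup>2 / 2 * (z \<bullet> z)"
    using inner_le_weighted[of "1/2" "2 * \<tau> - \<delta>" w z] by (simp add: abs_le_iff)
  have 2: "2 * (v \<bullet> z) \<le> 1/2 * (v \<bullet> v) + 2 * (z \<bullet> z)"
    using inner_le_weighted[of "1/2" 2 v z] by (simp add: abs_le_iff)
  have "- (v \<bullet> v) - q * (w \<bullet> w) + (2 * \<tau> - \<delta>) * q * (w \<bullet> z) + 2 * \<tau> * \<delta> * q * (z \<bullet> z) + 2 * (v \<bullet> z)
      \<le> - x / 2 + ((2 * \<tau> - \<delta>)\<^sup>2 / 2 + 2 * \<tau> * \<delta>) * y + 2 * (z \<bullet> z)"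
    using mult_left_mono[OF 1 q] 2
    by (simp add: x_def y_def algebra_simps add_divide_distrib diff_divide_distrib)
  then have "\<rho> * (- (v \<bullet> v) - q * (w \<bullet> w) + (2 * \<tau> - \<delta>) * q * (w \<bullet> z) + 2 * \<tau> * \<delta> * q * (z \<bullet> z) + 2 * (v \<bullet> z))
      \<le> \<rho> * (- x / 2 + ((2 * \<tau> - \<delta>)\<^sup>2 / 2 + 2 * \<tau> * \<delta>) * y + 2 * (z \<bullet> z))"
    using \<rho>(1) by (rule mult_left_mono)
  also have "\<dots> = - \<rho> * x / 2 + ((2 * \<tau> - \<delta>)\<^sup>2 / 2 + 2 * \<tau> * \<delta>) * (\<rho> * y) + 2 * (\<rho> * (z \<bullet> z))"
    by (simp add: algebra_simps)
  also have "\<dots> \<le> - \<rho> * x / 2 + ((2 * \<tau> - \<delta>)\<^sup>2 / 2 + 2 * \<tau> * \<delta>) * y + 2 * y"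
  proof -
    have "\<rho> * y \<le> y" using \<rho> nn by (simp add: mult_left_le_one_le)
    then have "((2 * \<tau> - \<delta>)\<^sup>2 / 2 + 2 * \<tau> * \<delta>) * (\<rho> * y) \<le> ((2 * \<tau> - \<delta>)\<^sup>2 / 2 + 2 * \<tau> * \<delta>) * y"
      using \<tau> \<delta> by (intro mult_left_mono) auto
    moreover have "\<rho> * (z \<bullet> z) \<le> y" unfolding y_def using \<rho> nn by (intro mult_right_mono)
    ultimately show ?thesis by simp
  qed
  also have "\<dots> = - \<rho> * x / 2 + M * y" by (simp add: M_def algebra_simps)
  finally have "\<epsilon> * \<rho> * (- (v \<bullet> v) - q * (w \<bullet> w) + (2 * \<tau> - \<delta>) * q * (w \<bullet> z) + 2 * \<tau> * \<delta> * q * (z \<bullet> z) + 2 * (v \<bullet> z))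
      \<le> \<epsilon> * (- \<rho> * x / 2 + M * y)"
    unfolding mult.assoc using \<epsilon>(1) by (intro mult_left_mono) auto
  also have "\<dots> = - (\<epsilon> / 2) * (\<rho> * x) + \<epsilon> * M * y" by (simp add: algebra_simps)
  also have "\<dots> \<le> - (\<epsilon> / 2) * (\<rho> * x) + \<delta> * y"
    using mult_right_mono[OF \<epsilon>(2) nn(2)] by simp
  finally have "- 2 * \<delta> * q * (z \<bullet> z) + \<epsilon> * \<rho> * (- (v \<bullet> v) - q * (w \<bullet> w) + (2 * \<tau> - \<delta>) * q * (w \<bullet> z)
      + 2 * \<tau> * \<delta> * q * (z \<bullet> z) + 2 * (v \<bullet> z)) \<le> - (\<epsilon> / 2) * (\<rho> * x) - \<delta> * y"
    by (simp add: y_def)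
  also have "\<dots> \<le> - (\<kappa> * \<rho>) * (3/2 * energy \<tau> \<delta> q v w z)"
  proof -
    have "\<kappa> * (3/2) * (\<rho> * x) \<le> \<epsilon> / 2 * (\<rho> * x)"
      using \<kappa>(2) nn \<rho> by (intro mult_right_mono mult_nonneg_nonneg) auto
    moreover have "\<kappa> * (3/2) * \<tau> \<le> 1" using \<kappa>(3) \<tau> by (simp add: field_simps)
    then have "\<kappa> * (3/2) * \<tau> * (\<delta> * (\<rho> * y)) \<le> 1 * (\<delta> * (\<rho> * y))"
      using nn \<rho> \<delta> by (intro mult_right_mono mult_nonneg_nonneg) auto
    moreover have "\<delta> * (\<rho> * y) \<le> \<delta> * y"
      using \<rho> nn \<delta> by (intro mult_left_mono) (auto simp: mult_left_le_one_le)
    ultimately have "\<kappa> * (3/2) * (\<rho> * x) + \<kappa> * (3/2) * \<tau> * (\<delta> * (\<rho> * y)) \<le> \<epsilon> / 2 * (\<rho> * x) + \<delta> * y"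
      by linarith
    moreover have "energy \<tau> \<delta> q v w z = x + \<tau> * \<delta> * y"
      by (simp add: energy_def x_def y_def algebra_simps)
    ultimately show ?thesis by (simp add: algebra_simps)
  qed
  also have "\<dots> \<le> - (\<kappa> * \<rho>) * (energy \<tau> \<delta> q v w z + \<epsilon> * \<rho> * cross \<tau> v w z)"
  proof -
    have "\<epsilon> * (\<rho> * \<bar>cross \<tau> v w z\<bar>) \<le> \<epsilon> * ((1/2 + \<tau> + 1/\<delta>) * energy \<tau> \<delta> q v w z)"
      unfolding \<rho>_def using cross_le_energy[OF \<tau> \<delta> q] \<epsilon>(1) by (intro mult_left_mono) auto
    also have "\<dots> \<le> 1/2 * energy \<tau> \<delta> q v w z"
      unfolding mult.assoc[symmetric] using \<epsilon>(3) energy_nonneg[OF \<tau> \<delta> q] by (rule mult_right_mono)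
    finally have "\<epsilon> * (\<rho> * \<bar>cross \<tau> v w z\<bar>) \<le> 1/2 * energy \<tau> \<delta> q v w z" .
    moreover have "\<epsilon> * \<rho> * cross \<tau> v w z \<le> \<epsilon> * (\<rho> * \<bar>cross \<tau> v w z\<bar>)"
      unfolding mult.assoc using \<epsilon>(1) \<rho>(1) by (intro mult_left_mono) auto
    ultimately have "energy \<tau> \<delta> q v w z + \<epsilon> * \<rho> * cross \<tau> v w z \<le> 3/2 * energy \<tau> \<delta> q v w z"
      by linarith
    then have "(\<kappa> * \<rho>) * (energy \<tau> \<delta> q v w z + \<epsilon> * \<rho> * cross \<tau> v w z) \<le> (\<kappa> * \<rho>) * (3/2 * energy \<tau> \<delta> q v w z)"
      using \<kappa>(1) \<rho>(1) by (intro mult_left_mono) auto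
    then show ?thesis by simp
  qed
  finally show ?thesis .
qed

text \<open>For small \<open>\<epsilon>\<close> the functional \<open>energy + \<epsilon> \<rho> cross\<close> lies between half and three halves of the
energy and decays at the rate \<open>\<kappa> \<rho>\<close>, which gives the factor three. The constants depend on \<open>\<tau>\<close> and
\<open>\<delta>\<close> but not on the frequency.\<close>

theorem energy_decay:
  fixes \<tau> \<delta> :: real
  assumes \<tau>: "0 < \<tau>" and \<delta>: "0 < \<delta>"
  shows "\<exists>c>0. \<forall>q\<ge>0. \<forall>v w z :: real \<Rightarrow> 'a::real_inner.
    (\<forall>t\<ge>0. (v has_vector_derivative - (q *\<^sub>R w t) - (\<delta> * q) *\<^sub>R z t) (at t within {0..}) \<and>
            (w has_vector_derivative v t) (at t within {0..}) \<and>
            (z has_vector_derivative (1 / \<tau>) *\<^sub>R (v t - z t)) (at t within {0..})) \<longrightarrow>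
    (\<forall>t\<ge>0. energy \<tau> \<delta> q (v t) (w t) (z t)
             \<le> 3 * exp (- c * (q / (1 + q)) * t) * energy \<tau> \<delta> q (v 0) (w 0) (z 0))"
proof -
  define M where "M = (2 * \<tau> - \<delta>)\<^sup>2 / 2 + 2 * \<tau> * \<delta> + 2"
  have M: "0 < M" using \<tau> \<delta> by (simp add: M_def add_nonneg_pos)
  define K where "K = 1/2 + \<tau> + 1/\<delta>"
  have K: "0 < K" using \<tau> \<delta> by (simp add: K_def add_pos_pos)
  define \<epsilon> where "\<epsilon> = min (\<delta> / M) (1 / (2 * K))"
  have \<epsilon>: "0 < \<epsilon>" "\<epsilon> * M \<le> \<delta>" "\<epsilon> * K \<le> 1/2"
    using M K \<delta> by (auto simp: \<epsilon>_def min_def field_simps)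
  define \<kappa> where "\<kappa> = min (\<epsilon> / 3) (2 / (3 * \<tau>))"
  have \<kappa>: "0 < \<kappa>" "\<kappa> \<le> \<epsilon> / 3" "\<kappa> \<le> 2 / (3 * \<tau>)"
    using \<epsilon> \<tau> by (auto simp: \<kappa>_def)
  show ?thesis
  proof (intro exI[of _ \<kappa>] conjI \<kappa>(1) allI impI)
    fix q :: real and v w z :: "real \<Rightarrow> 'a" and t :: real
    assume q: "0 \<le> q" and t: "0 \<le> t"
    assume "\<forall>t\<ge>0. (v has_vector_derivative - (q *\<^sub>R w t) - (\<delta> * q) *\<^sub>R z t) (at t within {0..}) \<and>
            (w has_vector_derivative v t) (at t within {0..}) \<and>
            (z has_vector_derivative (1 / \<tau>) *\<^sub>R (v t - z t)) (at t within {0..})"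
    then have dv: "(v has_vector_derivative - (q *\<^sub>R w t) - (\<delta> * q) *\<^sub>R z t) (at t within {0..})"
      and dw: "(w has_vector_derivative v t) (at t within {0..})"
      and dz: "(z has_vector_derivative (1 / \<tau>) *\<^sub>R (v t - z t)) (at t within {0..})"
      if "0 \<le> t" for t using that by auto
    define \<rho> where "\<rho> = q / (1 + q)"
    note \<rho> = ratio_bounds[OF q, folded \<rho>_def]
    define E where "E t = energy \<tau> \<delta> q (v t) (w t) (z t)" for t
    define F where "F t = cross \<tau> (v t) (w t) (z t)" for t
    define L where "L t = E t + \<epsilon> * \<rho> * F t" for t
    define L' where "L' t = - 2 * \<delta> * q * (z t \<bullet> z t) + \<epsilon> * \<rho> * (- (v t \<bullet> v t) - q * (w t \<bullet> w t)
      + (2 * \<tau> - \<delta>) * q * (w t \<bullet> z t) + 2 * \<tau> * \<delta> * q * (z t \<bullet> z t) + 2 * (v t \<bullet> z t))" for t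
    have dL: "(L has_vector_derivative L' t) (at t within {0..})" if t: "0 \<le> t" for t
    proof -
      have inner: "((\<lambda>s. f s \<bullet> g s) has_vector_derivative (f t \<bullet> g' + f' \<bullet> g t)) (at t within {0..})"
        if "(f has_vector_derivative f') (at t within {0..})" "(g has_vector_derivative g') (at t within {0..})"
        for f g :: "real \<Rightarrow> 'a" and f' g'
        using bounded_bilinear.has_vector_derivative[OF bounded_bilinear_inner that] .
      note i = inner[OF dv[OF t] dv[OF t]] inner[OF dw[OF t] dw[OF t]] inner[OF dz[OF t] dz[OF t]]
        inner[OF dv[OF t] dw[OF t]] inner[OF dv[OF t] dz[OF t]]
      show ?thesis
        unfolding L_def E_def F_def energy_def cross_def
        by (rule derivative_eq_intros i refl has_vector_derivative_mult_right | (simp; fail))+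
           (use \<tau> in \<open>simp add: L'_def inner_diff_left inner_diff_right inner_commute field_simps\<close>)
    qed
    have L'_le: "L' t \<le> - (\<kappa> * \<rho>) * L t" for t
      unfolding L'_def L_def E_def F_def \<rho>_def
      using lyapunov_derivative_le[OF \<tau> \<delta> q \<epsilon>[unfolded M_def K_def] \<kappa>] by simp
    have FE: "\<bar>\<epsilon> * \<rho> * F t\<bar> \<le> E t / 2" for t
    proof -
      have "\<bar>\<epsilon> * \<rho> * F t\<bar> = \<epsilon> * (\<rho> * \<bar>F t\<bar>)"
        using \<epsilon>(1) \<rho>(1) by (simp add: abs_mult)
      also have "\<dots> \<le> \<epsilon> * (K * E t)"
        unfolding \<rho>_def F_def E_def K_def using cross_le_energy[OF \<tau> \<delta> q] \<epsilon>(1) by (intro mult_left_mono) auto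
      also have "\<dots> \<le> 1/2 * E t"
        unfolding mult.assoc[symmetric] E_def using \<epsilon>(3) energy_nonneg[OF \<tau> \<delta> q] by (rule mult_right_mono)
      finally show ?thesis by simp
    qed
    have "exp (\<kappa> * \<rho> * t) * L t \<le> exp (\<kappa> * \<rho> * 0) * L 0"
    proof (rule antimono_from_derivative[OF _ _ t])
      fix s :: real assume s: "0 \<le> s"
      have "((\<lambda>s. exp (\<kappa> * \<rho> * s)) has_vector_derivative \<kappa> * \<rho> * exp (\<kappa> * \<rho> * s)) (at s within {0..})"
        unfolding has_real_derivative_iff_has_vector_derivative[symmetric]
        by (auto intro!: derivative_eq_intros)
      from has_vector_derivative_mult[OF this dL[OF s]]
      show "((\<lambda>s. exp (\<kappa> * \<rho> * s) * L s) has_vector_derivative exp (\<kappa> * \<rho> * s) * (L' s + \<kappa> * \<rho> * L s)) (at s within {0..})"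
        by (simp add: algebra_simps)
      show "exp (\<kappa> * \<rho> * s) * (L' s + \<kappa> * \<rho> * L s) \<le> 0"
        using L'_le[of s] by (simp add: mult_nonneg_nonpos)
    qed
    then have "exp (- (\<kappa> * \<rho> * t)) * (exp (\<kappa> * \<rho> * t) * L t) \<le> exp (- (\<kappa> * \<rho> * t)) * L 0"
      by (intro mult_left_mono) auto
    then have "L t \<le> exp (- (\<kappa> * \<rho> * t)) * L 0"
      by (simp add: mult.assoc[symmetric] exp_add[symmetric])
    moreover have "E t / 2 \<le> L t" using FE[of t] by (simp add: L_def abs_le_iff)
    moreover have "L 0 \<le> 3/2 * E 0" using FE[of 0] by (simp add: L_def abs_le_iff)
    then have "exp (- (\<kappa> * \<rho> * t)) * L 0 \<le> exp (- (\<kappa> * \<rho> * t)) * (3/2 * E 0)"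
      by (intro mult_left_mono) auto
    ultimately have "E t \<le> 3 * exp (- (\<kappa> * \<rho> * t)) * E 0" by linarith
    then show "energy \<tau> \<delta> q (v t) (w t) (z t)
        \<le> 3 * exp (- \<kappa> * (q / (1 + q)) * t) * energy \<tau> \<delta> q (v 0) (w 0) (z 0)"
      by (simp add: E_def \<rho>_def)
  qed
qed

section \<open>Solutions at one frequency\<close>

text \<open>The first two derivatives are explicit here because they enter the vector \<open>V\<close>.\<close>

definition mgt_curve ::
  "real \<Rightarrow> real \<Rightarrow> real^'n::finite \<Rightarrow> (real \<Rightarrow> complex) \<Rightarrow> (real \<Rightarrow> complex) \<Rightarrow> (real \<Rightarrow> complex) \<Rightarrow> bool" where
  "mgt_curve \<tau> \<beta> \<xi> y y' y'' \<longleftrightarrow>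
    (\<exists>y'''. \<forall>t\<ge>0. (y has_vector_derivative y' t) (at t within {0..}) \<and>
             (y' has_vector_derivative y'' t) (at t within {0..}) \<and>
             (y'' has_vector_derivative y''' t) (at t within {0..}) \<and>
             of_real \<tau> * y''' t + y'' t + of_real ((norm \<xi>)\<^sup>2) * y t
               + of_real (\<beta> * (norm \<xi>)\<^sup>2) * y' t = 0)"

lemma mgt_ode_iff_mgt_curve:
  "mgt_ode \<tau> \<beta> \<xi> a0 a1 a2 y \<longleftrightarrow>
    (\<exists>y' y''. mgt_curve \<tau> \<beta> \<xi> y y' y'' \<and> y 0 = a0 \<and> y' 0 = a1 \<and> y'' 0 = a2)"
  unfolding mgt_ode_def mgt_curve_def by blast

text \<open>The transform of \<open>V\<close> at the frequency \<open>\<xi>\<close>, in the same order of components; a spatial derivative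
becomes the factor \<open>\<i> \<xi>\<^sub>i\<close>.\<close>

definition V_freq ::
  "real \<Rightarrow> real^'n::finite \<Rightarrow> complex \<Rightarrow> complex \<Rightarrow> complex \<Rightarrow> complex ^ (unit + 'n + 'n)" where
  "V_freq \<tau> \<xi> a0 a1 a2 = (\<chi> k. case k of
       Inl _ \<Rightarrow> of_real \<tau> * a2 + a1
     | Inr (Inl i) \<Rightarrow> \<i> * of_real (\<xi> $ i) * (of_real \<tau> * a1 + a0)
     | Inr (Inr i) \<Rightarrow> \<i> * of_real (\<xi> $ i) * a1)"

lemma sum_UNIV_Plus:
  fixes f :: "'a::finite + 'b::finite \<Rightarrow> 'c::comm_monoid_add"
  shows "sum f UNIV = (\<Sum>x\<in>UNIV. f (Inl x)) + (\<Sum>y\<in>UNIV. f (Inr y))"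
  by (subst UNIV_Plus_UNIV[symmetric], subst sum.Plus) (auto simp: o_def)

lemma norm_V_freq:
  fixes \<xi> :: "real^'n::finite"
  shows "(norm (V_freq \<tau> \<xi> a0 a1 a2))\<^sup>2 = (norm (of_real \<tau> * a2 + a1))\<^sup>2
    + (norm \<xi>)\<^sup>2 * (norm (of_real \<tau> * a1 + a0))\<^sup>2 + (norm \<xi>)\<^sup>2 * (norm a1)\<^sup>2"
proof -
  have \<xi>: "(norm \<xi>)\<^sup>2 = (\<Sum>i\<in>UNIV. (\<xi> $ i)\<^sup>2)"
    by (simp add: norm_vec_def L2_set_def sum_nonneg)
  have "(norm (V_freq \<tau> \<xi> a0 a1 a2))\<^sup>2 = (\<Sum>k\<in>UNIV. (norm (V_freq \<tau> \<xi> a0 a1 a2 $ k))\<^sup>2)"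
    by (simp add: norm_vec_def L2_set_def sum_nonneg)
  also have "\<dots> = (norm (of_real \<tau> * a2 + a1))\<^sup>2 + ((\<Sum>i\<in>UNIV. (\<xi> $ i)\<^sup>2 * (norm (of_real \<tau> * a1 + a0))\<^sup>2)
      + (\<Sum>i\<in>UNIV. (\<xi> $ i)\<^sup>2 * (norm a1)\<^sup>2))"
    by (simp add: sum_UNIV_Plus V_freq_def norm_mult power_mult_distrib)
  finally show ?thesis by (simp add: \<xi> sum_distrib_right)
qed

lemma mgt_curve_first_order:
  fixes \<xi> :: "real^'n::finite"
  assumes \<tau>: "0 < \<tau>" and sol: "mgt_curve \<tau> \<beta> \<xi> y y' y''" and t: "0 \<le> t"
  defines "v \<equiv> \<lambda>t. \<tau> *\<^sub>R y'' t + y' t" and "w \<equiv> \<lambda>t. \<tau> *\<^sub>R y' t + y t"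
  shows "(v has_vector_derivative - ((norm \<xi>)\<^sup>2 *\<^sub>R w t) - ((\<beta> - \<tau>) * (norm \<xi>)\<^sup>2) *\<^sub>R y' t) (at t within {0..})"
    and "(w has_vector_derivative v t) (at t within {0..})"
    and "(y' has_vector_derivative (1 / \<tau>) *\<^sub>R (v t - y' t)) (at t within {0..})"
proof -
  from sol t obtain y''' where d: "(y has_vector_derivative y' t) (at t within {0..})"
    "(y' has_vector_derivative y'' t) (at t within {0..})"
    "(y'' has_vector_derivative y''' t) (at t within {0..})"
    and eq: "of_real \<tau> * y''' t + y'' t + of_real ((norm \<xi>)\<^sup>2) * y t + of_real (\<beta> * (norm \<xi>)\<^sup>2) * y' t = 0"
    unfolding mgt_curve_def by blast
  have "\<tau> *\<^sub>R y''' t + y'' t = - ((norm \<xi>)\<^sup>2 *\<^sub>R w t) - ((\<beta> - \<tau>) * (norm \<xi>)\<^sup>2) *\<^sub>R y' t"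
  proof -
    have "\<tau> *\<^sub>R y''' t + y'' t = - (of_real ((norm \<xi>)\<^sup>2) * y t) - of_real (\<beta> * (norm \<xi>)\<^sup>2) * y' t"
    proof -
      have "a + b = - c - d" if "a + b + c + d = 0" for a b c d :: complex
      proof -
        have "a + b = (a + b + c + d) - c - d" by simp
        then show ?thesis using that by simp
      qed
      from this[OF eq] show ?thesis by (simp only: scaleR_conv_of_real)
    qed
    then show ?thesis unfolding w_def by (simp add: scaleR_conv_of_real algebra_simps)
  qed
  moreover have "(v has_vector_derivative \<tau> *\<^sub>R y''' t + y'' t) (at t within {0..})"
    unfolding v_def by (auto intro!: derivative_eq_intros d)
  ultimately show "(v has_vector_derivative - ((norm \<xi>)\<^sup>2 *\<^sub>R w t) - ((\<beta> - \<tau>) * (norm \<xi>)\<^sup>2) *\<^sub>R y' t) (at t within {0..})"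
    by simp
  show "(w has_vector_derivative v t) (at t within {0..})"
    unfolding v_def w_def by (auto intro!: derivative_eq_intros d)
  show "(y' has_vector_derivative (1 / \<tau>) *\<^sub>R (v t - y' t)) (at t within {0..})"
    using d(2) \<tau> by (simp add: v_def)
qed

text \<open>The energy differs from \<open>\<bar>V\<bar>\<^sup>2\<close> only by the factor \<open>\<tau> (\<beta> - \<tau>)\<close> in the last term, so both are
comparable.\<close>

definition V_energy :: "real \<Rightarrow> real \<Rightarrow> real^'n::finite \<Rightarrow> complex \<Rightarrow> complex \<Rightarrow> complex \<Rightarrow> real" where
  "V_energy \<tau> \<beta> \<xi> a0 a1 a2 = energy \<tau> (\<beta> - \<tau>) ((norm \<xi>)\<^sup>2) (\<tau> *\<^sub>R a2 + a1) (\<tau> *\<^sub>R a1 + a0) a1"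

lemma V_energy_eq:
  "V_energy \<tau> \<beta> \<xi> a0 a1 a2 = (norm (of_real \<tau> * a2 + a1))\<^sup>2
    + (norm \<xi>)\<^sup>2 * (norm (of_real \<tau> * a1 + a0))\<^sup>2 + \<tau> * (\<beta> - \<tau>) * ((norm \<xi>)\<^sup>2 * (norm a1)\<^sup>2)"
  unfolding V_energy_def energy_def scaleR_conv_of_real power2_norm_eq_inner by simp

lemma V_energy_decay:
  assumes \<tau>: "0 < \<tau>" and \<beta>: "\<tau> < \<beta>"
  shows "\<exists>c>0. \<forall>\<xi>::real^'n::finite. \<forall>y y' y''. mgt_curve \<tau> \<beta> \<xi> y y' y'' \<longrightarrow> (\<forall>t\<ge>0.
    V_energy \<tau> \<beta> \<xi> (y t) (y' t) (y'' t)
      \<le> 3 * exp (- c * ((norm \<xi>)\<^sup>2 / (1 + (norm \<xi>)\<^sup>2)) * t) * V_energy \<tau> \<beta> \<xi> (y 0) (y' 0) (y'' 0))"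
proof -
  have "0 < \<beta> - \<tau>" using \<beta> by simp
  from energy_decay[OF \<tau> this, where 'a = complex] show ?thesis
  proof (elim exE conjE, intro exI conjI allI impI)
    fix c :: real and \<xi> :: "real^'n" and y y' y'' :: "real \<Rightarrow> complex" and t :: real
    assume decay: "\<forall>q\<ge>0. \<forall>v w z :: real \<Rightarrow> complex.
      (\<forall>t\<ge>0. (v has_vector_derivative - (q *\<^sub>R w t) - ((\<beta> - \<tau>) * q) *\<^sub>R z t) (at t within {0..}) \<and>
              (w has_vector_derivative v t) (at t within {0..}) \<and>
              (z has_vector_derivative (1 / \<tau>) *\<^sub>R (v t - z t)) (at t within {0..})) \<longrightarrow>
      (\<forall>t\<ge>0. energy \<tau> (\<beta> - \<tau>) q (v t) (w t) (z t)
               \<le> 3 * exp (- c * (q / (1 + q)) * t) * energy \<tau> (\<beta> - \<tau>) q (v 0) (w 0) (z 0))"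
    assume sol: "mgt_curve \<tau> \<beta> \<xi> y y' y''" and t: "0 \<le> t"
    show "V_energy \<tau> \<beta> \<xi> (y t) (y' t) (y'' t)
      \<le> 3 * exp (- c * ((norm \<xi>)\<^sup>2 / (1 + (norm \<xi>)\<^sup>2)) * t) * V_energy \<tau> \<beta> \<xi> (y 0) (y' 0) (y'' 0)"
      unfolding V_energy_def
      by (rule decay[rule_format, of "(norm \<xi>)\<^sup>2" "\<lambda>t. \<tau> *\<^sub>R y'' t + y' t" "\<lambda>t. \<tau> *\<^sub>R y' t + y t" y'])
         (use mgt_curve_first_order[OF \<tau> sol] t in auto)
  qed assumption
qed

theorem V_freq_decay:
  assumes \<tau>: "0 < \<tau>" and \<beta>: "\<tau> < \<beta>"
  shows "\<exists>K>0. \<exists>c>0. \<forall>\<xi>::real^'n::finite. \<forall>y y' y''. mgt_curve \<tau> \<beta> \<xi> y y' y'' \<longrightarrow> (\<forall>t\<ge>0.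
    (norm (V_freq \<tau> \<xi> (y t) (y' t) (y'' t)))\<^sup>2
      \<le> K * exp (- c * ((norm \<xi>)\<^sup>2 / (1 + (norm \<xi>)\<^sup>2)) * t) * (norm (V_freq \<tau> \<xi> (y 0) (y' 0) (y'' 0)))\<^sup>2)"
proof -
  define a where "a = min 1 (\<tau> * (\<beta> - \<tau>))"
  define b where "b = max 1 (\<tau> * (\<beta> - \<tau>))"
  have ab: "0 < a" "0 < b" using \<tau> \<beta> by (auto simp: a_def b_def)
  have lower: "a * (norm (V_freq \<tau> \<xi> a0 a1 a2))\<^sup>2 \<le> V_energy \<tau> \<beta> \<xi> a0 a1 a2"
    and upper: "V_energy \<tau> \<beta> \<xi> a0 a1 a2 \<le> b * (norm (V_freq \<tau> \<xi> a0 a1 a2))\<^sup>2"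
    for \<xi> :: "real^'n" and a0 a1 a2
  proof -
    let ?x = "(norm (of_real \<tau> * a2 + a1))\<^sup>2 + (norm \<xi>)\<^sup>2 * (norm (of_real \<tau> * a1 + a0))\<^sup>2"
    let ?y = "(norm \<xi>)\<^sup>2 * (norm a1)\<^sup>2"
    have "0 \<le> ?x" "0 \<le> ?y" by simp_all
    then have "a * ?x \<le> 1 * ?x" "a * ?y \<le> \<tau> * (\<beta> - \<tau>) * ?y" "1 * ?x \<le> b * ?x" "\<tau> * (\<beta> - \<tau>) * ?y \<le> b * ?y"
      by (intro mult_right_mono; simp add: a_def b_def)+
    then show "a * (norm (V_freq \<tau> \<xi> a0 a1 a2))\<^sup>2 \<le> V_energy \<tau> \<beta> \<xi> a0 a1 a2"
      "V_energy \<tau> \<beta> \<xi> a0 a1 a2 \<le> b * (norm (V_freq \<tau> \<xi> a0 a1 a2))\<^sup>2"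
      unfolding norm_V_freq V_energy_eq distrib_left by linarith+
  qed
  obtain c where c: "0 < c" and decay: "\<And>(\<xi>::real^'n) y y' y'' t. mgt_curve \<tau> \<beta> \<xi> y y' y'' \<Longrightarrow> 0 \<le> t \<Longrightarrow>
    V_energy \<tau> \<beta> \<xi> (y t) (y' t) (y'' t)
      \<le> 3 * exp (- c * ((norm \<xi>)\<^sup>2 / (1 + (norm \<xi>)\<^sup>2)) * t) * V_energy \<tau> \<beta> \<xi> (y 0) (y' 0) (y'' 0)"
    using V_energy_decay[OF \<tau> \<beta>] by blast
  show ?thesis
  proof (rule exI[of _ "3 * b / a"], intro conjI exI[of _ c] c allI impI)
    show "0 < 3 * b / a" using ab by simp
    fix \<xi> :: "real^'n" and y y' y'' :: "real \<Rightarrow> complex" and t :: real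
    assume sol: "mgt_curve \<tau> \<beta> \<xi> y y' y''" and t: "0 \<le> t"
    let ?e = "exp (- c * ((norm \<xi>)\<^sup>2 / (1 + (norm \<xi>)\<^sup>2)) * t)"
    have "a * (norm (V_freq \<tau> \<xi> (y t) (y' t) (y'' t)))\<^sup>2 \<le> 3 * ?e * V_energy \<tau> \<beta> \<xi> (y 0) (y' 0) (y'' 0)"
      by (rule order.trans[OF lower decay[OF sol t]])
    also have "\<dots> \<le> 3 * ?e * (b * (norm (V_freq \<tau> \<xi> (y 0) (y' 0) (y'' 0)))\<^sup>2)"
      by (intro mult_left_mono upper) auto
    finally show "(norm (V_freq \<tau> \<xi> (y t) (y' t) (y'' t)))\<^sup>2
      \<le> 3 * b / a * ?e * (norm (V_freq \<tau> \<xi> (y 0) (y' 0) (y'' 0)))\<^sup>2"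
      using ab by (simp add: field_simps)
  qed
qed

text \<open>Differentiation in time under the integral over all frequencies requires bounds on compact time intervals
that grow at most polynomially in \<open>\<xi>\<close>. A Gronwall argument for the third-order equation would give a bound
that grows exponentially with the frequency. Instead the energy bounds \<open>v = \<tau> y'' + y'\<close>, and \<open>\<tau> (y')' + y' = v\<close> is an
equation for \<open>y'\<close> whose coefficients do not depend on \<open>\<xi>\<close>.\<close>

lemma mgt_curve_bound:
  assumes \<tau>: "0 < \<tau>" and \<beta>: "\<tau> < \<beta>" and T: "0 \<le> T"
  shows "\<exists>C\<ge>0. \<forall>\<xi>::real^'n::finite. \<forall>y y' y''. mgt_curve \<tau> \<beta> \<xi> y y' y'' \<longrightarrow> (\<forall>t. 0 \<le> t \<and> t \<le> T \<longrightarrow>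
    norm (y' t) \<le> C * (1 + norm \<xi>) * (norm (y 0) + norm (y' 0) + norm (y'' 0)) \<and>
    norm (y'' t) \<le> C * (1 + norm \<xi>) * (norm (y 0) + norm (y' 0) + norm (y'' 0)))"
proof -
  obtain c where c: "0 < c" and decay: "\<And>(\<xi>::real^'n) y y' y'' t. mgt_curve \<tau> \<beta> \<xi> y y' y'' \<Longrightarrow> 0 \<le> t \<Longrightarrow>
    V_energy \<tau> \<beta> \<xi> (y t) (y' t) (y'' t)
      \<le> 3 * exp (- c * ((norm \<xi>)\<^sup>2 / (1 + (norm \<xi>)\<^sup>2)) * t) * V_energy \<tau> \<beta> \<xi> (y 0) (y' 0) (y'' 0)"
    using V_energy_decay[OF \<tau> \<beta>] by blast
  define D where "D = sqrt (\<tau> * (\<beta> - \<tau>))"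
  have D: "0 \<le> D" "D\<^sup>2 = \<tau> * (\<beta> - \<tau>)" using \<tau> \<beta> by (simp_all add: D_def)
  \<comment> \<open>The factor two is a bound for the square root of the three in the energy estimate.\<close>
  define A where "A = 2 * (2 + 2 * \<tau> + D)"
  have A: "1 \<le> A" using \<tau> D by (simp add: A_def)
  define C1 where "C1 = 1 + T * exp (T / \<tau>) / \<tau> * A"
  have C1: "0 \<le> C1" using \<tau> T A by (simp add: C1_def)
  define C where "C = C1 + (A + C1) / \<tau>"
  have "C1 \<le> C" "(A + C1) / \<tau> \<le> C" "0 \<le> C" using C1 \<tau> A by (simp_all add: C_def)
  show ?thesis
  proof (intro exI[of _ C] conjI \<open>0 \<le> C\<close> allI impI)
    fix \<xi> :: "real^'n" and y y' y'' :: "real \<Rightarrow> complex" and t :: real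
    assume sol: "mgt_curve \<tau> \<beta> \<xi> y y' y''" and "0 \<le> t \<and> t \<le> T"
    then have t: "0 \<le> t" "t \<le> T" by auto
    define N where "N = norm (y 0) + norm (y' 0) + norm (y'' 0)"
    define k where "k = norm \<xi>"
    define v where "v t = \<tau> *\<^sub>R y'' t + y' t" for t
    have k: "0 \<le> k" by (simp add: k_def)
    have N: "0 \<le> N" "norm (y 0) \<le> N" "norm (y' 0) \<le> N" "norm (y'' 0) \<le> N" by (simp_all add: N_def)
    have kN: "0 \<le> (1 + k) * N" "N \<le> (1 + k) * N" using k N(1) by (simp_all add: distrib_right)
    have v_le: "norm (v s) \<le> A * ((1 + k) * N)" if s: "0 \<le> s" for s
    proof -
      have n1: "norm (of_real \<tau> * y'' 0 + y' 0) \<le> (1 + \<tau>) * N"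
      proof -
        have "norm (of_real \<tau> * y'' 0 + y' 0) \<le> \<tau> * norm (y'' 0) + norm (y' 0)"
          using \<tau> norm_triangle_ineq[of "of_real \<tau> * y'' 0" "y' 0"] by (simp add: norm_mult)
        also have "\<dots> \<le> \<tau> * N + N" using \<tau> N by (intro add_mono mult_left_mono) auto
        finally show ?thesis by (simp add: algebra_simps)
      qed
      have n2: "norm (of_real \<tau> * y' 0 + y 0) \<le> (1 + \<tau>) * N"
      proof -
        have "norm (of_real \<tau> * y' 0 + y 0) \<le> \<tau> * norm (y' 0) + norm (y 0)"
          using \<tau> norm_triangle_ineq[of "of_real \<tau> * y' 0" "y 0"] by (simp add: norm_mult)
        also have "\<dots> \<le> \<tau> * N + N" using \<tau> N by (intro add_mono mult_left_mono) auto
        finally show ?thesis by (simp add: algebra_simps)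
      qed
      have "(norm (v s))\<^sup>2 \<le> V_energy \<tau> \<beta> \<xi> (y s) (y' s) (y'' s)"
        unfolding V_energy_eq v_def scaleR_conv_of_real using \<tau> \<beta> by simp
      also have "\<dots> \<le> 3 * exp (- c * ((norm \<xi>)\<^sup>2 / (1 + (norm \<xi>)\<^sup>2)) * s) * V_energy \<tau> \<beta> \<xi> (y 0) (y' 0) (y'' 0)"
        by (rule decay[OF sol s])
      also have "\<dots> \<le> 4 * V_energy \<tau> \<beta> \<xi> (y 0) (y' 0) (y'' 0)"
      proof (rule mult_right_mono)
        have "- c * ((norm \<xi>)\<^sup>2 / (1 + (norm \<xi>)\<^sup>2)) * s \<le> 0"
          using c s by (simp add: mult_nonneg_nonneg)
        then have "exp (- c * ((norm \<xi>)\<^sup>2 / (1 + (norm \<xi>)\<^sup>2)) * s) \<le> 1" by (simp only: exp_le_one_iff)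
        then show "3 * exp (- c * ((norm \<xi>)\<^sup>2 / (1 + (norm \<xi>)\<^sup>2)) * s) \<le> 4" by linarith
        show "0 \<le> V_energy \<tau> \<beta> \<xi> (y 0) (y' 0) (y'' 0)" unfolding V_energy_def using \<tau> \<beta> by (intro energy_nonneg) auto
      qed
      also have "\<dots> = 4 * ((norm (of_real \<tau> * y'' 0 + y' 0))\<^sup>2 + (k * norm (of_real \<tau> * y' 0 + y 0))\<^sup>2
          + (D * (k * norm (y' 0)))\<^sup>2)"
        by (simp add: V_energy_eq k_def D(2) power_mult_distrib)
      also have "\<dots> \<le> 4 * (norm (of_real \<tau> * y'' 0 + y' 0) + k * norm (of_real \<tau> * y' 0 + y 0) + D * (k * norm (y' 0)))\<^sup>2"
      proof -
        have sum_sq: "a\<^sup>2 + b\<^sup>2 + d\<^sup>2 \<le> (a + b + d)\<^sup>2" if "0 \<le> a" "0 \<le> b" "0 \<le> d" for a b d :: real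
          using that mult_nonneg_nonneg[of a b] mult_nonneg_nonneg[of a d] mult_nonneg_nonneg[of b d]
          by (simp add: power2_eq_square algebra_simps)
        show ?thesis by (intro mult_left_mono sum_sq) (use k D(1) in auto)
      qed
      also have "\<dots> \<le> 4 * ((1 + \<tau>) * ((1 + k) * N) + (1 + \<tau>) * ((1 + k) * N) + D * ((1 + k) * N))\<^sup>2"
      proof -
        have "norm (of_real \<tau> * y'' 0 + y' 0) \<le> (1 + \<tau>) * ((1 + k) * N)"
          using n1 kN(2) \<tau> by (smt (verit) mult_left_mono)
        moreover have "k * norm (of_real \<tau> * y' 0 + y 0) \<le> (1 + \<tau>) * ((1 + k) * N)"
          unfolding mult.left_commute[of "1 + \<tau>"] using n2 k by (intro mult_mono) auto
        moreover have "D * (k * norm (y' 0)) \<le> D * ((1 + k) * N)"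
          using D(1) k N by (intro mult_left_mono mult_mono) auto
        ultimately have "norm (of_real \<tau> * y'' 0 + y' 0) + k * norm (of_real \<tau> * y' 0 + y 0) + D * (k * norm (y' 0))
            \<le> (1 + \<tau>) * ((1 + k) * N) + (1 + \<tau>) * ((1 + k) * N) + D * ((1 + k) * N)"
          by linarith
        then show ?thesis
          using k D(1) by (intro mult_left_mono power_mono) auto
      qed
      also have "\<dots> = (A * ((1 + k) * N))\<^sup>2" by (simp add: A_def power2_eq_square algebra_simps)
      finally show ?thesis by (rule power2_le_imp_le) (use A kN(1) in auto)
    qed
    have dy': "(y' has_vector_derivative (1 / \<tau>) *\<^sub>R (v s - y' s)) (at s within {0..t})" if "0 \<le> s" for s
      unfolding v_def
      by (rule has_vector_derivative_within_subset[OF mgt_curve_first_order(3)[OF \<tau> sol that]]) auto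
    define B where "B = exp (T / \<tau>) / \<tau> * (A * ((1 + k) * N))"
    have B: "0 \<le> B" using \<tau> A kN by (simp add: B_def)
    \<comment> \<open>With the integrating factor the derivative involves \<open>v\<close> only.\<close>
    have "norm (exp (t / \<tau>) *\<^sub>R y' t - exp (0 / \<tau>) *\<^sub>R y' 0) \<le> B * norm (t - 0)"
    proof (rule has_vector_derivative_bound[of "{0..t}"])
      fix s assume s: "s \<in> {0..t}"
      have "((\<lambda>s. exp (s / \<tau>)) has_vector_derivative exp (s / \<tau>) / \<tau>) (at s within {0..t})"
        unfolding has_real_derivative_iff_has_vector_derivative[symmetric]
        using \<tau> by (auto intro!: derivative_eq_intros)
      from bounded_bilinear.has_vector_derivative[OF bounded_bilinear_scaleR this dy'] s
      have "((\<lambda>s. exp (s / \<tau>) *\<^sub>R y' s) has_vector_derivative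
        exp (s / \<tau>) *\<^sub>R (1 / \<tau>) *\<^sub>R (v s - y' s) + (exp (s / \<tau>) / \<tau>) *\<^sub>R y' s) (at s within {0..t})"
        by simp
      then show "((\<lambda>s. exp (s / \<tau>) *\<^sub>R y' s) has_vector_derivative (exp (s / \<tau>) / \<tau>) *\<^sub>R v s) (at s within {0..t})"
        by (simp add: scaleR_right_diff_distrib)
      have "exp (s / \<tau>) / \<tau> * norm (v s) \<le> exp (T / \<tau>) / \<tau> * (A * ((1 + k) * N))"
        using s t \<tau> v_le[of s] by (intro mult_mono divide_right_mono) (auto simp: divide_right_mono)
      then show "norm ((exp (s / \<tau>) / \<tau>) *\<^sub>R v s) \<le> B"
        using \<tau> by (simp add: B_def)
    qed (use t in auto)
    then have *: "norm (exp (t / \<tau>) *\<^sub>R y' t - y' 0) \<le> B * t" using t by simp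
    have "norm (y' t) \<le> norm (exp (t / \<tau>) *\<^sub>R y' t)"
      using t \<tau> by (simp add: mult_le_cancel_right1)
    also have "\<dots> \<le> norm (y' 0) + B * t"
      using * norm_triangle_sub[of "exp (t / \<tau>) *\<^sub>R y' t" "y' 0"] by linarith
    also have "\<dots> \<le> (1 + k) * N + B * T"
      using N kN B t by (intro add_mono mult_left_mono) auto
    also have "\<dots> = C1 * ((1 + k) * N)"
      by (simp add: C1_def B_def algebra_simps add_divide_distrib)
    finally have y'_le: "norm (y' t) \<le> C1 * ((1 + k) * N)" .
    also have "\<dots> \<le> C * ((1 + k) * N)"
      by (rule mult_right_mono[OF \<open>C1 \<le> C\<close> kN(1)])
    finally show "norm (y' t) \<le> C * (1 + norm \<xi>) * (norm (y 0) + norm (y' 0) + norm (y'' 0))"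
      by (simp add: k_def N_def mult.assoc)
    have "norm (y'' t) = norm (v t - y' t) / \<tau>"
      using \<tau> by (simp add: v_def)
    also have "\<dots> \<le> (A * ((1 + k) * N) + C1 * ((1 + k) * N)) / \<tau>"
      using \<tau> norm_triangle_ineq4[of "v t" "y' t"] v_le[OF t(1)] y'_le by (intro divide_right_mono) auto
    also have "\<dots> = (A + C1) / \<tau> * ((1 + k) * N)" by (simp add: algebra_simps add_divide_distrib)
    also have "\<dots> \<le> C * ((1 + k) * N)"
      by (rule mult_right_mono[OF \<open>(A + C1) / \<tau> \<le> C\<close> kN(1)])
    finally show "norm (y'' t) \<le> C * (1 + norm \<xi>) * (norm (y 0) + norm (y' 0) + norm (y'' 0))"
      by (simp add: k_def N_def mult.assoc)
  qed
qed

section \<open>Time derivatives of distributions\<close>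

lemma measurable_time_derivative:
  fixes F F' :: "'a \<Rightarrow> real \<Rightarrow> complex"
  assumes t: "0 \<le> t" and F: "\<And>r. 0 \<le> r \<Longrightarrow> (\<lambda>\<xi>. F \<xi> r) \<in> borel_measurable M"
    and d: "\<And>\<xi>. (F \<xi> has_vector_derivative F' \<xi> t) (at t within {0..})"
  shows "(\<lambda>\<xi>. F' \<xi> t) \<in> borel_measurable M"
proof (rule borel_measurable_LIMSEQ_metric)
  let ?r = "\<lambda>n. t + inverse (real (Suc n))"
  show "(\<lambda>\<xi>. (F \<xi> (?r n) - F \<xi> t) /\<^sub>R (?r n - t)) \<in> borel_measurable M" for n
    using t by (intro borel_measurable_scaleR borel_measurable_diff borel_measurable_const F) auto
  fix \<xi>
  have "((\<lambda>r. (F \<xi> r - F \<xi> t) /\<^sub>R (r - t)) \<longlongrightarrow> F' \<xi> t) (at t within {0..})"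
    using d[of \<xi>] by (simp add: has_vector_derivative_iff_tendsto)
  moreover have "filterlim ?r (at t within {0..}) sequentially"
    unfolding filterlim_at
  proof
    show "\<forall>\<^sub>F n in sequentially. ?r n \<in> {0..} \<and> ?r n \<noteq> t"
      using t by (intro always_eventually allI) (auto simp del: of_nat_Suc)
    show "?r \<longlonglongrightarrow> t" by (rule LIMSEQ_inverse_real_of_nat_add)
  qed
  ultimately show "(\<lambda>n. (F \<xi> (?r n) - F \<xi> t) /\<^sub>R (?r n - t)) \<longlonglongrightarrow> F' \<xi> t"
    by (rule filterlim_compose)
qed

text \<open>The bound on \<open>F'\<close> over a time interval dominates the difference quotients, by the mean value inequality.\<close>

lemma has_vector_derivative_integral:
  fixes F F' :: "'a \<Rightarrow> real \<Rightarrow> complex"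
  assumes t: "0 \<le> t" "t < T"
    and d: "\<And>\<xi> r. 0 \<le> r \<Longrightarrow> (F \<xi> has_vector_derivative F' \<xi> r) (at r within {0..})"
    and int: "\<And>r. 0 \<le> r \<Longrightarrow> integrable M (\<lambda>\<xi>. F \<xi> r)"
    and W: "integrable M W" "\<And>\<xi> r. 0 \<le> r \<Longrightarrow> r \<le> T \<Longrightarrow> norm (F' \<xi> r) \<le> W \<xi>"
  shows "integrable M (\<lambda>\<xi>. F' \<xi> t)"
    and "((\<lambda>r. LINT \<xi>|M. F \<xi> r) has_vector_derivative (LINT \<xi>|M. F' \<xi> t)) (at t within {0..})"
proof -
  have meas: "(\<lambda>\<xi>. F' \<xi> t) \<in> borel_measurable M"
    by (rule measurable_time_derivative[where F = F and F' = F' and t = t, OF t(1) _ d[OF t(1)]])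
       (use int in \<open>auto intro: borel_measurable_integrable\<close>)
  show "integrable M (\<lambda>\<xi>. F' \<xi> t)"
    by (rule Bochner_Integration.integrable_bound[OF W(1) meas])
       (use W(2)[of t] t in \<open>auto intro!: AE_I2 order.trans[OF _ abs_ge_self]\<close>)
  show "((\<lambda>r. LINT \<xi>|M. F \<xi> r) has_vector_derivative (LINT \<xi>|M. F' \<xi> t)) (at t within {0..})"
    unfolding has_vector_derivative_iff_tendsto tendsto_at_iff_sequentially
  proof (intro allI impI)
    fix X :: "nat \<Rightarrow> real" assume X: "\<forall>i. X i \<in> {0..} - {t}" "X \<longlonglongrightarrow> t"
    from order_tendstoD(2)[OF X(2) t(2)] obtain N where N: "\<And>n. n \<ge> N \<Longrightarrow> X n < T"
      by (auto simp: eventually_sequentially)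
    let ?Q = "\<lambda>n \<xi>. (F \<xi> (X (n + N)) - F \<xi> t) /\<^sub>R (X (n + N) - t)"
    have "(\<lambda>n. LINT \<xi>|M. ?Q n \<xi>) \<longlonglongrightarrow> (LINT \<xi>|M. F' \<xi> t)"
    proof (rule integral_dominated_convergence[OF meas _ W(1)])
      show "?Q n \<in> borel_measurable M" for n
        using X(1) t int[of t] int[of "X (n + N)"]
        by (intro borel_measurable_scaleR borel_measurable_diff borel_measurable_const)
           (auto intro: borel_measurable_integrable)
      show "AE \<xi> in M. (\<lambda>n. ?Q n \<xi>) \<longlonglongrightarrow> F' \<xi> t"
      proof (rule AE_I2)
        fix \<xi>
        have "((\<lambda>r. (F \<xi> r - F \<xi> t) /\<^sub>R (r - t)) \<longlongrightarrow> F' \<xi> t) (at t within {0..})"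
          using d[OF t(1)] by (simp add: has_vector_derivative_iff_tendsto)
        then have "((\<lambda>r. (F \<xi> r - F \<xi> t) /\<^sub>R (r - t)) \<circ> X) \<longlonglongrightarrow> F' \<xi> t"
          using X unfolding tendsto_at_iff_sequentially by blast
        from LIMSEQ_ignore_initial_segment[OF this, of N]
        show "(\<lambda>n. ?Q n \<xi>) \<longlonglongrightarrow> F' \<xi> t" by (simp add: o_def)
      qed
      show "AE \<xi> in M. norm (?Q n \<xi>) \<le> W \<xi>" for n
      proof (rule AE_I2)
        fix \<xi>
        let ?x = "X (n + N)"
        have x: "0 \<le> ?x" "?x \<noteq> t" "?x \<le> T" using X(1) N[of "n + N"] by auto
        have "norm (F \<xi> ?x - F \<xi> t) \<le> W \<xi> * norm (?x - t)"
          by (rule has_vector_derivative_bound[of "{0..T}"])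
             (use x t W(2) in \<open>auto intro!: has_vector_derivative_within_subset[OF d]\<close>)
        moreover have "0 < norm (?x - t)" using x by simp
        ultimately have "norm (F \<xi> ?x - F \<xi> t) / norm (?x - t) \<le> W \<xi>"
          by (simp add: pos_divide_le_eq)
        then show "norm (?Q n \<xi>) \<le> W \<xi>" by (simp add: divide_inverse mult.commute)
      qed
    qed
    also have "(\<lambda>n. LINT \<xi>|M. ?Q n \<xi>) = (\<lambda>n. ((LINT \<xi>|M. F \<xi> (X (n + N))) - (LINT \<xi>|M. F \<xi> t)) /\<^sub>R (X (n + N) - t))"
    proof
      fix n
      have "integrable M (\<lambda>\<xi>. F \<xi> (X (n + N)))" "integrable M (\<lambda>\<xi>. F \<xi> t)"
        using X(1) t by (auto intro!: int)
      then show "(LINT \<xi>|M. ?Q n \<xi>) = ((LINT \<xi>|M. F \<xi> (X (n + N))) - (LINT \<xi>|M. F \<xi> t)) /\<^sub>R (X (n + N) - t)"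
        by simp
    qed
    finally show "((\<lambda>r. ((LINT \<xi>|M. F \<xi> r) - (LINT \<xi>|M. F \<xi> t)) /\<^sub>R (r - t)) \<circ> X) \<longlonglongrightarrow> (LINT \<xi>|M. F' \<xi> t)"
      unfolding o_def by (rule LIMSEQ_offset)
  qed
qed

lemma at_within_atLeast_nontrivial: "0 \<le> (t::real) \<Longrightarrow> at t within {0..} \<noteq> bot"
proof -
  assume "0 \<le> t"
  then have "at t within {t..} \<le> at t within {0..}" by (intro at_le) auto
  moreover have "at t within {t..} \<noteq> bot"
    using trivial_limit_at_right_real[of t] by (simp add: at_within_Ici_at_right)
  ultimately show ?thesis by (metis bot.extremum_uniqueI)
qed

text \<open>The time derivative of a distribution is taken separately for each test function, hence it is the derivative
of an integral over the frequencies.\<close>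

lemma represents_time_deriv:
  fixes F F' :: "real^'n::finite \<Rightarrow> real \<Rightarrow> complex"
  assumes t: "0 \<le> t"
    and rep: "\<And>r. 0 \<le> r \<Longrightarrow> represents (\<lambda>\<xi>. F \<xi> r) (dist_fourier (U r))"
    and d: "\<And>\<xi> r. 0 \<le> r \<Longrightarrow> (F \<xi> has_vector_derivative F' \<xi> r) (at r within {0..})"
    and W: "\<And>\<xi> r. 0 \<le> r \<Longrightarrow> r \<le> t + 1 \<Longrightarrow> norm (F' \<xi> r) \<le> W \<xi>"
      "\<And>\<phi>. schwartz \<phi> \<Longrightarrow> integrable lborel (\<lambda>\<xi>. W \<xi> * norm (\<phi> \<xi>))"
  shows "represents (\<lambda>\<xi>. F' \<xi> t) (dist_fourier (time_deriv U t))"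
  unfolding represents_def
proof (intro allI impI)
  fix \<phi> :: "real^'n \<Rightarrow> complex" assume \<phi>: "schwartz \<phi>"
  have *: "integrable lborel (\<lambda>\<xi>. F' \<xi> t * \<phi> \<xi>)"
    "((\<lambda>r. LINT \<xi>|lborel. F \<xi> r * \<phi> \<xi>) has_vector_derivative (LINT \<xi>|lborel. F' \<xi> t * \<phi> \<xi>)) (at t within {0..})"
  proof -
    have dF: "((\<lambda>r. F \<xi> r * \<phi> \<xi>) has_vector_derivative F' \<xi> r * \<phi> \<xi>) (at r within {0..})" if "0 \<le> r" for \<xi> r
      by (rule bounded_linear.has_vector_derivative[OF bounded_linear_mult_left d[OF that]])
    have i: "integrable lborel (\<lambda>\<xi>. F \<xi> r * \<phi> \<xi>)" if "0 \<le> r" for r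
      by (rule representsD(1)[OF rep[OF that] \<phi>])
    have b: "norm (F' \<xi> r * \<phi> \<xi>) \<le> W \<xi> * norm (\<phi> \<xi>)" if "0 \<le> r" "r \<le> t + 1" for \<xi> r
      unfolding norm_mult by (intro mult_right_mono W(1) that) auto
    have "t < t + 1" by simp
    note has_vector_derivative_integral[OF t this dF i W(2)[OF \<phi>] b]
    then show "integrable lborel (\<lambda>\<xi>. F' \<xi> t * \<phi> \<xi>)"
      "((\<lambda>r. LINT \<xi>|lborel. F \<xi> r * \<phi> \<xi>) has_vector_derivative (LINT \<xi>|lborel. F' \<xi> t * \<phi> \<xi>)) (at t within {0..})"
      by blast+
  qed
  have "((\<lambda>r. U r (fourier \<phi>)) has_vector_derivative (LINT \<xi>|lborel. F' \<xi> t * \<phi> \<xi>)) (at t within {0..})"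
  proof (rule has_vector_derivative_transform[OF _ _ *(2)])
    show "U r (fourier \<phi>) = (LINT \<xi>|lborel. F \<xi> r * \<phi> \<xi>)" if "r \<in> {0..}" for r
      using representsD(2)[OF rep \<phi>] that by (simp add: dist_fourier_def)
  qed (use t in auto)
  then have "dist_fourier (time_deriv U t) \<phi> = (LINT \<xi>|lborel. F' \<xi> t * \<phi> \<xi>)"
    unfolding dist_fourier_def time_deriv_def
    by (rule vector_derivative_within[OF at_within_atLeast_nontrivial[OF t]])
  with *(1) show "integrable lborel (\<lambda>\<xi>. F' \<xi> t * \<phi> \<xi>) \<and>
    dist_fourier (time_deriv U t) \<phi> = (LINT \<xi>|lborel. F' \<xi> t * \<phi> \<xi>)" by blast
qed

text \<open>The weight \<open>1 + \<bar>\<xi>\<bar>\<close> is bounded by the polynomial \<open>2 + 2 \<bar>\<xi>\<bar>\<^sup>2\<close>, which can be moved to the test function.\<close>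

lemma integrable_growth_mult:
  fixes a :: "real^'n::finite \<Rightarrow> complex"
  assumes a: "represents a T" and \<phi>: "schwartz \<phi>"
  shows "integrable lborel (\<lambda>\<xi>. (1 + norm \<xi>) * norm (a \<xi>) * norm (\<phi> \<xi>))"
proof -
  define \<psi> where "\<psi> \<xi> = (2 + 2 * (\<Sum>i\<in>UNIV. of_real (\<xi> $ i) ^ 2)) * \<phi> \<xi>" for \<xi>
  have [measurable]: "\<phi> \<in> borel_measurable borel" "a \<in> borel_measurable borel"
    by (rule schwartz_measurable[OF \<phi>] represents_measurable[OF a])+
  have "schwartz \<psi>"
    unfolding \<psi>_def
    by (intro schwartz_mult \<phi> moderate_add moderate_mult moderate_const moderate_sum moderate_power moderate_coord) auto
  then have "integrable lborel (\<lambda>\<xi>. a \<xi> * \<psi> \<xi>)" by (rule representsD(1)[OF a])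
  then show ?thesis
  proof (rule Bochner_Integration.integrable_bound)
    show "AE \<xi> in lborel. norm ((1 + norm \<xi>) * norm (a \<xi>) * norm (\<phi> \<xi>)) \<le> norm (a \<xi> * \<psi> \<xi>)"
    proof (rule AE_I2)
      fix \<xi> :: "real^'n"
      have "2 + 2 * (\<Sum>i\<in>UNIV. complex_of_real (\<xi> $ i) ^ 2) = of_real (2 + 2 * (\<Sum>i\<in>UNIV. (\<xi> $ i)\<^sup>2))"
        by simp
      also have "(\<Sum>i\<in>UNIV. (\<xi> $ i)\<^sup>2) = (norm \<xi>)\<^sup>2"
        by (simp add: norm_vec_def L2_set_def sum_nonneg)
      finally have "norm (\<psi> \<xi>) = (2 + 2 * (norm \<xi>)\<^sup>2) * norm (\<phi> \<xi>)"
        unfolding \<psi>_def norm_mult by (simp only: norm_of_real) simp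
      moreover have "1 + norm \<xi> \<le> 2 + 2 * (norm \<xi>)\<^sup>2"
      proof -
        have "0 \<le> (norm \<xi> - 1/2)\<^sup>2" "0 \<le> norm \<xi> * norm \<xi>" by simp_all
        then have "norm \<xi> \<le> 1/4 + norm \<xi> * norm \<xi>" "0 \<le> norm \<xi> * norm \<xi>"
          by (simp_all add: power2_eq_square algebra_simps)
        then show ?thesis unfolding power2_eq_square by linarith
      qed
      ultimately have "(1 + norm \<xi>) * norm (\<phi> \<xi>) \<le> norm (\<psi> \<xi>)"
        by (simp add: mult_right_mono)
      then have "norm (a \<xi>) * ((1 + norm \<xi>) * norm (\<phi> \<xi>)) \<le> norm (a \<xi>) * norm (\<psi> \<xi>)"
        by (rule mult_left_mono) simp
      then show "norm ((1 + norm \<xi>) * norm (a \<xi>) * norm (\<phi> \<xi>)) \<le> norm (a \<xi> * \<psi> \<xi>)"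
        by (simp add: norm_mult abs_mult mult_ac)
    qed
  qed measurable
qed

section \<open>The transform of the vector \<open>V\<close>\<close>

text \<open>The spatial derivative is moved, with a minus sign, to the transform of the test function. Differentiating
that transform amounts to multiplying the test function by \<open>- \<i> \<xi>\<^sub>i\<close>, and the two signs cancel.\<close>

lemma vrepresents_V_vec:
  fixes a0 a1 a2 :: "real^'n::finite \<Rightarrow> complex"
  assumes "represents a0 (dist_fourier w0)" "represents a1 (dist_fourier w1)" "represents a2 (dist_fourier w2)"
  shows "vrepresents (\<lambda>\<xi>. V_freq \<tau> \<xi> (a0 \<xi>) (a1 \<xi>) (a2 \<xi>)) (vfourier (V_vec \<tau> w0 w1 w2))"
  unfolding vrepresents_def
proof
  fix k :: "unit + 'n + 'n"
  have rep: "integrable lborel (\<lambda>x. a0 x * \<phi> x)" "w0 (fourier \<phi>) = (LINT x|lborel. a0 x * \<phi> x)"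
    "integrable lborel (\<lambda>x. a1 x * \<phi> x)" "w1 (fourier \<phi>) = (LINT x|lborel. a1 x * \<phi> x)"
    "integrable lborel (\<lambda>x. a2 x * \<phi> x)" "w2 (fourier \<phi>) = (LINT x|lborel. a2 x * \<phi> x)"
    if "schwartz \<phi>" for \<phi>
    using assms that by (auto simp: represents_def dist_fourier_def)
  have lin: "integrable lborel (\<lambda>x. (of_real \<tau> * b x + a x) * \<phi> x)"
    "(LINT x|lborel. (of_real \<tau> * b x + a x) * \<phi> x) = of_real \<tau> * (LINT x|lborel. b x * \<phi> x) + (LINT x|lborel. a x * \<phi> x)"
    if "integrable lborel (\<lambda>x. a x * \<phi> x)" "integrable lborel (\<lambda>x. b x * \<phi> x)" for a b \<phi> :: "real^'n \<Rightarrow> complex"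
    using that by (simp_all add: distrib_right mult.assoc)
  have partial: "partial_deriv i (fourier \<phi>) = fourier (\<lambda>x. - \<i> * of_real (x $ i) * \<phi> x)"
    if "schwartz \<phi>" for i \<phi>
    using partial_deriv_fourier[OF that] .
  show "represents (\<lambda>\<xi>. V_freq \<tau> \<xi> (a0 \<xi>) (a1 \<xi>) (a2 \<xi>) $ k) (vfourier (V_vec \<tau> w0 w1 w2) k)"
  proof (cases k)
    case (Inl u)
    then show ?thesis
      by (auto simp: represents_def V_freq_def vfourier_def V_vec_def dist_fourier_def lin rep)
  next
    case (Inr k')
    show ?thesis
    proof (cases k')
      case (Inl i)
      show ?thesis unfolding represents_def
      proof (intro allI impI)
        fix \<phi> :: "real^'n \<Rightarrow> complex" assume \<phi>: "schwartz \<phi>"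
        define \<psi> where "\<psi> x = - \<i> * of_real (x $ i) * \<phi> x" for x
        have \<psi>: "schwartz \<psi>" unfolding \<psi>_def by (rule schwartz_coord_mult[OF \<phi>])
        have eq: "V_freq \<tau> \<xi> (a0 \<xi>) (a1 \<xi>) (a2 \<xi>) $ k * \<phi> \<xi> = - ((of_real \<tau> * a1 \<xi> + a0 \<xi>) * \<psi> \<xi>)" for \<xi>
          by (simp add: V_freq_def Inr Inl \<psi>_def)
        have "vfourier (V_vec \<tau> w0 w1 w2) k \<phi> = - (of_real \<tau> * w1 (fourier \<psi>) + w0 (fourier \<psi>))"
          by (simp add: vfourier_def V_vec_def Inr Inl dist_fourier_def dist_partial_def partial[OF \<phi>] \<psi>_def[abs_def])
        then show "integrable lborel (\<lambda>\<xi>. V_freq \<tau> \<xi> (a0 \<xi>) (a1 \<xi>) (a2 \<xi>) $ k * \<phi> \<xi>) \<and>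
          vfourier (V_vec \<tau> w0 w1 w2) k \<phi> = (LINT \<xi>|lborel. V_freq \<tau> \<xi> (a0 \<xi>) (a1 \<xi>) (a2 \<xi>) $ k * \<phi> \<xi>)"
          unfolding eq using rep[OF \<psi>] by (simp add: lin)
      qed
    next
      case (Inr i)
      show ?thesis unfolding represents_def
      proof (intro allI impI)
        fix \<phi> :: "real^'n \<Rightarrow> complex" assume \<phi>: "schwartz \<phi>"
        define \<psi> where "\<psi> x = - \<i> * of_real (x $ i) * \<phi> x" for x
        have \<psi>: "schwartz \<psi>" unfolding \<psi>_def by (rule schwartz_coord_mult[OF \<phi>])
        have eq: "V_freq \<tau> \<xi> (a0 \<xi>) (a1 \<xi>) (a2 \<xi>) $ k * \<phi> \<xi> = - (a1 \<xi> * \<psi> \<xi>)" for \<xi>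
          by (simp add: V_freq_def \<open>k = Inr k'\<close> Inr \<psi>_def)
        have "vfourier (V_vec \<tau> w0 w1 w2) k \<phi> = - w1 (fourier \<psi>)"
          by (simp add: vfourier_def V_vec_def \<open>k = Inr k'\<close> Inr dist_fourier_def dist_partial_def partial[OF \<phi>] \<psi>_def[abs_def])
        then show "integrable lborel (\<lambda>\<xi>. V_freq \<tau> \<xi> (a0 \<xi>) (a1 \<xi>) (a2 \<xi>) $ k * \<phi> \<xi>) \<and>
          vfourier (V_vec \<tau> w0 w1 w2) k \<phi> = (LINT \<xi>|lborel. V_freq \<tau> \<xi> (a0 \<xi>) (a1 \<xi>) (a2 \<xi>) $ k * \<phi> \<xi>)"
          unfolding eq using rep[OF \<psi>] by simp
      qed
    qed
  qed
qed

text \<open>The connection between the distributional solution and the solutions at the single frequencies: the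
transform of \<open>V\<close> may be computed frequency by frequency, both for the solution and for the initial data.\<close>

theorem mgt_solution_fourier:
  fixes u :: "real \<Rightarrow> 'n::finite dist"
  assumes \<tau>: "0 < \<tau>" and \<beta>: "\<tau> < \<beta>" and sol: "mgt_solution \<tau> \<beta> u0 u1 u2 u"
  shows "\<exists>y y' y'' :: real^'n \<Rightarrow> real \<Rightarrow> complex.
    (\<forall>\<xi>. mgt_curve \<tau> \<beta> \<xi> (y \<xi>) (y' \<xi>) (y'' \<xi>)) \<and>
    (\<forall>t\<ge>0. vrepresents (\<lambda>\<xi>. V_freq \<tau> \<xi> (y \<xi> t) (y' \<xi> t) (y'' \<xi> t)) (vfourier (V_sol \<tau> u t))) \<and>
    vrepresents (\<lambda>\<xi>. V_freq \<tau> \<xi> (y \<xi> 0) (y' \<xi> 0) (y'' \<xi> 0)) (vfourier (V_vec \<tau> u0 u1 u2))"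
proof -
  from sol obtain a0 a1 a2 y where rep0: "represents a0 (dist_fourier u0)" "represents a1 (dist_fourier u1)" "represents a2 (dist_fourier u2)"
    and rep: "\<And>t. 0 \<le> t \<Longrightarrow> represents (\<lambda>\<xi>. y \<xi> t) (dist_fourier (u t))"
    and ode: "\<And>\<xi>. mgt_ode \<tau> \<beta> \<xi> (a0 \<xi>) (a1 \<xi>) (a2 \<xi>) (y \<xi>)"
    unfolding mgt_solution_def by blast
  from ode have "\<forall>\<xi>. \<exists>y' y''. mgt_curve \<tau> \<beta> \<xi> (y \<xi>) y' y'' \<and> y \<xi> 0 = a0 \<xi> \<and> y' 0 = a1 \<xi> \<and> y'' 0 = a2 \<xi>"
    unfolding mgt_ode_iff_mgt_curve by blast
  then obtain y' y'' where curve: "\<And>\<xi>. mgt_curve \<tau> \<beta> \<xi> (y \<xi>) (y' \<xi>) (y'' \<xi>)"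
    and init: "\<And>\<xi>. y \<xi> 0 = a0 \<xi>" "\<And>\<xi>. y' \<xi> 0 = a1 \<xi>" "\<And>\<xi>. y'' \<xi> 0 = a2 \<xi>"
    by metis
  have d: "(y \<xi> has_vector_derivative y' \<xi> t) (at t within {0..})"
      "(y' \<xi> has_vector_derivative y'' \<xi> t) (at t within {0..})" if "0 \<le> t" for \<xi> t
    using curve[of \<xi>] that unfolding mgt_curve_def by blast+
  have dom: "\<exists>W. (\<forall>\<xi> r. 0 \<le> r \<longrightarrow> r \<le> t + 1 \<longrightarrow> norm (y' \<xi> r) \<le> W \<xi> \<and> norm (y'' \<xi> r) \<le> W \<xi>)
      \<and> (\<forall>\<phi>. schwartz \<phi> \<longrightarrow> integrable lborel (\<lambda>\<xi>. W \<xi> * norm (\<phi> \<xi>)))" if t: "0 \<le> t" for t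
  proof -
    have "0 \<le> t + 1" using t by simp
    from mgt_curve_bound[OF \<tau> \<beta> this, where 'n = 'n] obtain C where C: "\<And>\<xi> r. 0 \<le> r \<Longrightarrow> r \<le> t + 1 \<Longrightarrow>
      norm (y' \<xi> r) \<le> C * (1 + norm \<xi>) * (norm (a0 \<xi>) + norm (a1 \<xi>) + norm (a2 \<xi>)) \<and>
      norm (y'' \<xi> r) \<le> C * (1 + norm \<xi>) * (norm (a0 \<xi>) + norm (a1 \<xi>) + norm (a2 \<xi>))"
      using curve init by metis
    show ?thesis
    proof (intro exI[of _ "\<lambda>\<xi>. C * (1 + norm \<xi>) * (norm (a0 \<xi>) + norm (a1 \<xi>) + norm (a2 \<xi>))"] conjI allI impI)
      fix \<phi> :: "real^'n \<Rightarrow> complex" assume \<phi>: "schwartz \<phi>"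
      have "integrable lborel (\<lambda>\<xi>. C * ((1 + norm \<xi>) * norm (a0 \<xi>) * norm (\<phi> \<xi>) + (1 + norm \<xi>) * norm (a1 \<xi>) * norm (\<phi> \<xi>)
          + (1 + norm \<xi>) * norm (a2 \<xi>) * norm (\<phi> \<xi>)))"
        by (intro integrable_mult_right Bochner_Integration.integrable_add integrable_growth_mult[OF _ \<phi>]; rule rep0)
      then show "integrable lborel (\<lambda>\<xi>. C * (1 + norm \<xi>) * (norm (a0 \<xi>) + norm (a1 \<xi>) + norm (a2 \<xi>)) * norm (\<phi> \<xi>))"
        by (simp add: algebra_simps)
    qed (use C in blast)+
  qed
  have rep': "represents (\<lambda>\<xi>. y' \<xi> t) (dist_fourier (time_deriv u t))" if t: "0 \<le> t" for t
  proof -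
    from dom[OF t] obtain W where W: "\<And>\<xi> r. 0 \<le> r \<Longrightarrow> r \<le> t + 1 \<Longrightarrow> norm (y' \<xi> r) \<le> W \<xi>"
      "\<And>\<phi>. schwartz \<phi> \<Longrightarrow> integrable lborel (\<lambda>\<xi>. W \<xi> * norm (\<phi> \<xi>))" by blast
    show ?thesis by (rule represents_time_deriv[OF t rep d(1) W])
  qed
  have rep'': "represents (\<lambda>\<xi>. y'' \<xi> t) (dist_fourier (time_deriv (time_deriv u) t))" if t: "0 \<le> t" for t
  proof -
    from dom[OF t] obtain W where W: "\<And>\<xi> r. 0 \<le> r \<Longrightarrow> r \<le> t + 1 \<Longrightarrow> norm (y'' \<xi> r) \<le> W \<xi>"
      "\<And>\<phi>. schwartz \<phi> \<Longrightarrow> integrable lborel (\<lambda>\<xi>. W \<xi> * norm (\<phi> \<xi>))" by blast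
    show ?thesis by (rule represents_time_deriv[OF t rep' d(2) W])
  qed
  show ?thesis
  proof (intro exI conjI allI impI)
    show "mgt_curve \<tau> \<beta> \<xi> (y \<xi>) (y' \<xi>) (y'' \<xi>)" for \<xi> by (rule curve)
    show "vrepresents (\<lambda>\<xi>. V_freq \<tau> \<xi> (y \<xi> t) (y' \<xi> t) (y'' \<xi> t)) (vfourier (V_sol \<tau> u t))" if "0 \<le> t" for t
      unfolding V_sol_def by (intro vrepresents_V_vec rep rep' rep'' that)
    show "vrepresents (\<lambda>\<xi>. V_freq \<tau> \<xi> (y \<xi> 0) (y' \<xi> 0) (y'' \<xi> 0)) (vfourier (V_vec \<tau> u0 u1 u2))"
      unfolding init by (intro vrepresents_V_vec rep0)
  qed
qed

section \<open>Splitting into low and high frequencies\<close>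

lemma integral_scale:
  fixes f :: "real^'n::finite \<Rightarrow> real"
  assumes a: "0 < a" and f: "integrable lborel f"
  shows "integrable lborel (\<lambda>x. f (a *\<^sub>R x))"
    and "(LINT x|lborel. f (a *\<^sub>R x)) = (LINT x|lborel. f x) / a ^ CARD('n)"
proof -
  have [measurable]: "f \<in> borel_measurable borel" using f by (auto dest: borel_measurable_integrable)
  have eq: "lborel = density (distr lborel borel (\<lambda>x. 0 + a *\<^sub>R (x :: real^'n))) (\<lambda>_. \<bar>a\<bar> ^ DIM(real^'n))"
    by (rule lborel_affine) (use a in simp)
  have "integrable (density (distr lborel borel (\<lambda>x. 0 + a *\<^sub>R (x :: real^'n))) (\<lambda>_. \<bar>a\<bar> ^ DIM(real^'n))) f"
    using f eq by simp
  then have "integrable lborel (\<lambda>x. a ^ CARD('n) * f (a *\<^sub>R x))"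
    using a by (simp add: integrable_density integrable_distr_eq ennreal_power)
  then show "integrable lborel (\<lambda>x. f (a *\<^sub>R x))"
    using a by simp
  have "(LINT x|lborel. f x) = (LINT x|density (distr lborel borel (\<lambda>x. 0 + a *\<^sub>R (x :: real^'n))) (\<lambda>_. \<bar>a\<bar> ^ DIM(real^'n)). f x)"
    using eq by simp
  also have "\<dots> = a ^ CARD('n) * (LINT x|lborel. f (a *\<^sub>R x))"
    using a by (simp add: integral_density integral_distr ennreal_power)
  finally show "(LINT x|lborel. f (a *\<^sub>R x)) = (LINT x|lborel. f x) / a ^ CARD('n)"
    using a by simp
qed

text \<open>The constant in the low frequency estimate, by scaling.\<close>

definition gauss_moment :: "'n::finite itself \<Rightarrow> nat \<Rightarrow> real" where
  "gauss_moment _ j = (LINT x|lborel. norm (x::real^'n) ^ (2 * j) * exp (- (norm x)\<^sup>2))"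

lemma integrable_gauss_moment:
  "integrable lborel (\<lambda>x::real^'n::finite. norm x ^ (2 * j) * exp (- (norm x)\<^sup>2))"
proof -
  have m: "moderate (\<lambda>x::real^'n. (\<Sum>i\<in>UNIV. of_real (x $ i) ^ 2) ^ j)"
    by (intro moderate_power moderate_sum moderate_coord) auto
  have "integrable lborel (\<lambda>x::real^'n. norm ((\<Sum>i\<in>UNIV. of_real (x $ i) ^ 2) ^ j * gauss x))"
    by (intro integrable_norm integrable_schwartz schwartz_moderate_gauss m)
  moreover have "norm ((\<Sum>i\<in>UNIV. of_real (x $ i) ^ 2) ^ j * gauss x) = norm x ^ (2 * j) * exp (- (norm x)\<^sup>2)"
    for x :: "real^'n"
  proof -
    have "(\<Sum>i\<in>UNIV. complex_of_real (x $ i) ^ 2) = of_real ((norm x)\<^sup>2)"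
      by (simp add: norm_vec_def L2_set_def sum_nonneg)
    then show ?thesis
      by (simp add: gauss_def norm_mult norm_power power_mult)
  qed
  ultimately show ?thesis by simp
qed

lemma gauss_moment_scaled:
  assumes a: "0 < a"
  shows "integrable lborel (\<lambda>x::real^'n::finite. norm x ^ (2 * j) * exp (- (a * (norm x)\<^sup>2)))"
    and "(LINT x|lborel. norm (x::real^'n) ^ (2 * j) * exp (- (a * (norm x)\<^sup>2)))
      = gauss_moment TYPE('n) j * a powr (- real CARD('n) / 2 - real j)"
proof -
  have sq: "0 < sqrt a" using a by simp
  have "norm (sqrt a *\<^sub>R x) ^ (2 * j) * exp (- (norm (sqrt a *\<^sub>R x))\<^sup>2) = a ^ j * (norm x ^ (2 * j) * exp (- (a * (norm x)\<^sup>2)))"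
    for x :: "real^'n"
    using a by (simp add: power_mult_distrib power_mult)
  note eq = this
  have "integrable lborel (\<lambda>x::real^'n. a ^ j * (norm x ^ (2 * j) * exp (- (a * (norm x)\<^sup>2))))"
    using integral_scale(1)[OF sq integrable_gauss_moment[of j], where 'n = 'n] by (simp only: eq)
  then show "integrable lborel (\<lambda>x::real^'n. norm x ^ (2 * j) * exp (- (a * (norm x)\<^sup>2)))"
    using a by simp
  have "a ^ j * (LINT x|lborel. norm (x::real^'n) ^ (2 * j) * exp (- (a * (norm x)\<^sup>2)))
      = gauss_moment TYPE('n) j / sqrt a ^ CARD('n)"
    using integral_scale(2)[OF sq integrable_gauss_moment[of j], where 'n = 'n]
    by (simp only: eq gauss_moment_def integral_mult_right_zero)
  moreover have "sqrt a ^ CARD('n) = a powr (real CARD('n) / 2)"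
    using a by (simp add: powr_half_sqrt[symmetric] powr_realpow[symmetric] powr_powr)
  moreover have "a ^ j = a powr real j" using a by (simp add: powr_realpow)
  ultimately have moment: "a powr real j * (LINT x|lborel. norm (x::real^'n) ^ (2 * j) * exp (- (a * (norm x)\<^sup>2)))
      = gauss_moment TYPE('n) j / a powr (real CARD('n) / 2)"
    by simp
  have exponent: "a powr (- real CARD('n) / 2 - real j) = 1 / (a powr (real CARD('n) / 2) * a powr real j)"
  proof -
    have "- real CARD('n) / 2 - real j = - (real CARD('n) / 2 + real j)" by simp
    then show ?thesis by (simp only: powr_minus_divide powr_add)
  qed
  have solve: "J = g * w" if "P * J = g / Q" "w = 1 / (Q * P)" "0 < P" "0 < Q" for P Q J g w :: real
    unfolding that(2) using that(1,3,4) by (simp add: field_simps)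
  show "(LINT x|lborel. norm (x::real^'n) ^ (2 * j) * exp (- (a * (norm x)\<^sup>2)))
      = gauss_moment TYPE('n) j * a powr (- real CARD('n) / 2 - real j)"
    by (rule solve[OF moment exponent]) (use a in auto)
qed

lemma gauss_moment_nonneg: "0 \<le> gauss_moment TYPE('n::finite) j"
  unfolding gauss_moment_def by (rule Bochner_Integration.integral_nonneg) simp

text \<open>For \<open>\<bar>\<xi>\<bar> \<le> 1\<close> the rate \<open>\<bar>\<xi>\<bar>\<^sup>2 / (1 + \<bar>\<xi>\<bar>\<^sup>2)\<close> is at least \<open>\<bar>\<xi>\<bar>\<^sup>2 / 2\<close>, so the integrand is at most a
Gaussian times the bound \<open>M\<close> of \<open>g0\<close>, and scaling gives the power of \<open>1 + t\<close>. For \<open>\<bar>\<xi>\<bar> \<ge> 1\<close> the rate is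
at least \<open>1 / 2\<close>, which gives exponential decay and no loss of derivatives.\<close>

theorem frequency_splitting:
  fixes g0 g :: "real^'n::finite \<Rightarrow> real"
  assumes c: "0 < c" and K: "0 \<le> K" and t: "0 \<le> t" and M: "0 \<le> M"
    and bnd: "AE \<xi> in lborel. g0 \<xi> \<le> M" and g0: "\<And>\<xi>. 0 \<le> g0 \<xi>"
    and g: "\<And>\<xi>. g \<xi> \<le> K * exp (- c * ((norm \<xi>)\<^sup>2 / (1 + (norm \<xi>)\<^sup>2)) * t) * g0 \<xi>"
    and int0: "integrable lborel (\<lambda>\<xi>. norm \<xi> ^ (2 * j) * g0 \<xi>)"
    and int: "integrable lborel (\<lambda>\<xi>. norm \<xi> ^ (2 * j) * g \<xi>)"
  shows "(LINT \<xi>|lborel. norm \<xi> ^ (2 * j) * g \<xi>)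
    \<le> K * exp (c / 2) * M * gauss_moment TYPE('n) j * (c / 2 * (1 + t)) powr (- real CARD('n) / 2 - real j)
      + K * exp (- (c / 2) * t) * (LINT \<xi>|lborel. norm \<xi> ^ (2 * j) * g0 \<xi>)"
proof -
  let ?a = "c / 2 * (1 + t)"
  have a: "0 < ?a" using c t by simp
  have le: "AE \<xi> in lborel. norm \<xi> ^ (2 * j) * g \<xi> \<le> K * exp (c / 2) * M * (norm \<xi> ^ (2 * j) * exp (- (?a * (norm \<xi>)\<^sup>2)))
      + K * exp (- (c / 2) * t) * (norm \<xi> ^ (2 * j) * g0 \<xi>)"
    using bnd
  proof eventually_elim
    fix \<xi> :: "real^'n" assume M_bnd: "g0 \<xi> \<le> M"
    let ?q = "(norm \<xi>)\<^sup>2"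
    have q: "0 \<le> ?q" by simp
    have nn: "0 \<le> K * exp (c / 2) * M * (norm \<xi> ^ (2 * j) * exp (- (?a * ?q)))"
      "0 \<le> K * exp (- (c / 2) * t) * (norm \<xi> ^ (2 * j) * g0 \<xi>)"
      using K M g0[of \<xi>] by simp_all
    have "norm \<xi> ^ (2 * j) * g \<xi> \<le> norm \<xi> ^ (2 * j) * (K * exp (- c * (?q / (1 + ?q)) * t) * g0 \<xi>)"
      by (rule mult_left_mono[OF g]) simp
    also have "\<dots> \<le> K * exp (c / 2) * M * (norm \<xi> ^ (2 * j) * exp (- (?a * ?q)))
      + K * exp (- (c / 2) * t) * (norm \<xi> ^ (2 * j) * g0 \<xi>)"
    proof (cases "?q \<le> 1")
      case True
      have "?q / 2 \<le> ?q / (1 + ?q)"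
        using True q by (intro divide_left_mono mult_pos_pos) (auto intro: add_pos_nonneg)
      then have "c * (?q / 2) * t \<le> c * (?q / (1 + ?q)) * t"
        using c t by (intro mult_right_mono mult_left_mono) auto
      moreover have "?a * ?q = c * (?q / 2) * t + c / 2 * ?q" by (simp add: algebra_simps)
      moreover have "c / 2 * ?q \<le> c / 2 * 1" using True c by (intro mult_left_mono) auto
      \<comment> \<open>Replacing \<open>t\<close> by \<open>1 + t\<close> costs the constant \<open>exp (c / 2)\<close>, since \<open>\<bar>\<xi>\<bar> \<le> 1\<close>; it avoids the singularity of the power of \<open>t\<close> at \<open>t = 0\<close>.\<close>
      ultimately have "- c * (?q / (1 + ?q)) * t \<le> c / 2 + - (?a * ?q)" by linarith
      then have "exp (- c * (?q / (1 + ?q)) * t) \<le> exp (c / 2) * exp (- (?a * ?q))"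
        by (simp only: exp_add[symmetric] exp_le_cancel_iff)
      then have "K * exp (- c * (?q / (1 + ?q)) * t) * g0 \<xi> \<le> K * (exp (c / 2) * exp (- (?a * ?q))) * M"
        using K M_bnd g0[of \<xi>] by (intro mult_mono mult_left_mono mult_nonneg_nonneg) auto
      then have "norm \<xi> ^ (2 * j) * (K * exp (- c * (?q / (1 + ?q)) * t) * g0 \<xi>)
          \<le> norm \<xi> ^ (2 * j) * (K * (exp (c / 2) * exp (- (?a * ?q))) * M)"
        by (rule mult_left_mono) simp
      then show ?thesis using nn(2) by (simp add: mult_ac)
    next
      case False
      then have "1 / 2 \<le> ?q / (1 + ?q)" by (simp add: field_simps)
      then have "c * (1 / 2) * t \<le> c * (?q / (1 + ?q)) * t"
        using c t by (intro mult_right_mono mult_left_mono) auto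
      then have "exp (- c * (?q / (1 + ?q)) * t) \<le> exp (- (c / 2) * t)" by simp
      then have "norm \<xi> ^ (2 * j) * (K * exp (- c * (?q / (1 + ?q)) * t) * g0 \<xi>)
          \<le> norm \<xi> ^ (2 * j) * (K * exp (- (c / 2) * t) * g0 \<xi>)"
        using K g0[of \<xi>] by (intro mult_left_mono mult_right_mono) auto
      then show ?thesis using nn(1) by (simp add: mult_ac)
    qed
    finally show "norm \<xi> ^ (2 * j) * g \<xi> \<le> K * exp (c / 2) * M * (norm \<xi> ^ (2 * j) * exp (- (?a * ?q)))
      + K * exp (- (c / 2) * t) * (norm \<xi> ^ (2 * j) * g0 \<xi>)" .
  qed
  note G = gauss_moment_scaled[OF a, where j = j and 'n = 'n]
  have "(LINT \<xi>|lborel. norm \<xi> ^ (2 * j) * g \<xi>)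
      \<le> (LINT \<xi>|lborel. K * exp (c / 2) * M * (norm \<xi> ^ (2 * j) * exp (- (?a * (norm \<xi>)\<^sup>2)))
      + K * exp (- (c / 2) * t) * (norm \<xi> ^ (2 * j) * g0 \<xi>))"
    by (intro integral_mono_AE le int Bochner_Integration.integrable_add integrable_mult_right int0 G(1))
  also have "\<dots> = K * exp (c / 2) * M * (LINT \<xi>|lborel. norm (\<xi>::real^'n) ^ (2 * j) * exp (- (?a * (norm \<xi>)\<^sup>2)))
      + K * exp (- (c / 2) * t) * (LINT \<xi>|lborel. norm \<xi> ^ (2 * j) * g0 \<xi>)"
    by (subst Bochner_Integration.integral_add[OF integrable_mult_right[OF G(1)] integrable_mult_right[OF int0]])
       (simp only: integral_mult_right_zero)
  finally show ?thesis unfolding G(2) by (simp add: mult.assoc)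
qed

section \<open>Norms in terms of the transform\<close>

lemma vrepresents_measurable:
  fixes f :: "real^'n::finite \<Rightarrow> complex^'k::finite"
  assumes "vrepresents f T"
  shows "f \<in> borel_measurable borel"
proof -
  have [measurable]: "(\<lambda>x. f x $ k) \<in> borel_measurable borel" for k
    using assms by (auto simp: vrepresents_def intro: represents_measurable)
  show ?thesis
    unfolding borel_measurable_euclidean_space[of f]
    by (auto simp: Basis_vec_def inner_axis)
qed

lemma deriv_L2_norm_eq:
  assumes "vrepresents g (vfourier T)"
  shows "deriv_L2_norm j T = sqrt (LINT \<xi>|lborel. norm \<xi> ^ (2 * j) * (norm (g \<xi>))\<^sup>2)"
proof -
  have [measurable]: "g \<in> borel_measurable borel" "density_of (vfourier T) \<in> borel_measurable borel"
    using assms vrepresents_density_of[OF assms] by (auto intro: vrepresents_measurable)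
  have "(LINT \<xi>|lborel. norm \<xi> ^ (2 * j) * (norm (density_of (vfourier T) \<xi>))\<^sup>2)
      = (LINT \<xi>|lborel. norm \<xi> ^ (2 * j) * (norm (g \<xi>))\<^sup>2)"
  proof (rule integral_cong_AE)
    show "AE \<xi> in lborel. norm \<xi> ^ (2 * j) * (norm (density_of (vfourier T) \<xi>))\<^sup>2 = norm \<xi> ^ (2 * j) * (norm (g \<xi>))\<^sup>2"
      using density_of_AE[OF assms] by eventually_elim simp
  qed measurable
  then show ?thesis by (simp add: deriv_L2_norm_def)
qed

text \<open>The bound \<open>\<bar>f^\<bar> \<le> (2\<pi>)\<^bsup>-N/2\<^esup> \<parallel>f\<parallel>\<^sub>1\<close> is summed over the components, which costs a factor
equal to their number.\<close>

lemma norm_transform_le_L1_norm: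
  fixes T :: "('k::finite, 'n::finite) vdist"
  assumes L1: "in_L1 T" and g: "vrepresents g (vfourier T)"
  shows "AE \<xi> in lborel. norm (g \<xi>) \<le> real CARD('k) * fourier_const TYPE('n) * L1_norm T"
proof -
  from L1 obtain f where f: "vrepresents f T" "integrable lborel f" unfolding in_L1_def by blast
  have [measurable]: "f \<in> borel_measurable borel" "density_of T \<in> borel_measurable borel"
    using f vrepresents_density_of[OF f(1)] by (auto intro: vrepresents_measurable)
  have L1_eq: "L1_norm T = (LINT x|lborel. norm (f x))"
    unfolding L1_norm_def
  proof (rule integral_cong_AE)
    show "AE x in lborel. norm (density_of T x) = norm (f x)"
      using density_of_AE[OF f(1)] by eventually_elim simp
  qed measurable
  have int: "integrable lborel (\<lambda>x. f x $ k)" for k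
    using integrable_bounded_linear[OF bounded_linear_vec_nth f(2)] .
  have "represents (fourier (\<lambda>x. f x $ k)) (dist_fourier (T k))" for k
    using f(1) by (intro represents_fourier_integrable int) (simp add: vrepresents_def)
  moreover have "represents (\<lambda>\<xi>. g \<xi> $ k) (dist_fourier (T k))" for k
    using g by (simp add: vrepresents_def vfourier_def)
  ultimately have "AE \<xi> in lborel. g \<xi> $ k = fourier (\<lambda>x. f x $ k) \<xi>" for k
    by (intro represents_unique_AE)
  then have "AE \<xi> in lborel. \<forall>k. g \<xi> $ k = fourier (\<lambda>x. f x $ k) \<xi>"
    by (subst AE_all_countable) blast
  then show ?thesis
  proof eventually_elim
    fix \<xi> assume eq: "\<forall>k. g \<xi> $ k = fourier (\<lambda>x. f x $ k) \<xi>"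
    have "norm (g \<xi>) \<le> (\<Sum>k\<in>UNIV. norm (g \<xi> $ k))"
      unfolding norm_vec_def by (rule L2_set_le_sum) simp
    also have "\<dots> \<le> (\<Sum>k\<in>(UNIV::'k set). fourier_const TYPE('n) * L1_norm T)"
    proof (rule sum_mono)
      fix k
      have "norm (g \<xi> $ k) \<le> fourier_const TYPE('n) * (LINT x|lborel. norm (f x $ k))"
        using eq norm_fourier_le by metis
      also have "\<dots> \<le> fourier_const TYPE('n) * L1_norm T"
        unfolding L1_eq
        by (intro mult_left_mono integral_mono integrable_norm int f(2) Finite_Cartesian_Product.norm_nth_le) auto
      finally show "norm (g \<xi> $ k) \<le> fourier_const TYPE('n) * L1_norm T" .
    qed
    finally show "norm (g \<xi>) \<le> real CARD('k) * fourier_const TYPE('n) * L1_norm T"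
      by simp
  qed
qed

lemma in_Hs_imp_integrable:
  fixes T :: "('k::finite, 'n::finite) vdist"
  assumes Hs: "in_Hs s T" and g: "vrepresents g (vfourier T)" and j: "real j \<le> s"
  shows "integrable lborel (\<lambda>\<xi>. (1 + (norm \<xi>)\<^sup>2) ^ j * (norm (g \<xi>))\<^sup>2)"
proof -
  from Hs obtain h where h: "vrepresents h (vfourier T)"
    and int: "integrable lborel (\<lambda>\<xi>. (1 + (norm \<xi>)\<^sup>2) powr s * (norm (h \<xi>))\<^sup>2)"
    unfolding in_Hs_def by blast
  have [measurable]: "g \<in> borel_measurable borel" by (rule vrepresents_measurable[OF g])
  show ?thesis
  proof (rule Bochner_Integration.integrable_bound[OF int])
    show "AE \<xi> in lborel. norm ((1 + (norm \<xi>)\<^sup>2) ^ j * (norm (g \<xi>))\<^sup>2) \<le> norm ((1 + (norm \<xi>)\<^sup>2) powr s * (norm (h \<xi>))\<^sup>2)"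
      using vrepresents_unique_AE[OF g h]
    proof eventually_elim
      fix \<xi> assume eq: "g \<xi> = h \<xi>"
      have "(1 + (norm \<xi>)\<^sup>2) ^ j = (1 + (norm \<xi>)\<^sup>2) powr real j"
        by (simp add: powr_realpow add_pos_nonneg)
      also have "\<dots> \<le> (1 + (norm \<xi>)\<^sup>2) powr s"
        using j by (intro powr_mono) auto
      finally have "(1 + (norm \<xi>)\<^sup>2) ^ j * (norm (g \<xi>))\<^sup>2 \<le> (1 + (norm \<xi>)\<^sup>2) powr s * (norm (h \<xi>))\<^sup>2"
        unfolding eq by (rule mult_right_mono) simp
      then show "norm ((1 + (norm \<xi>)\<^sup>2) ^ j * (norm (g \<xi>))\<^sup>2) \<le> norm ((1 + (norm \<xi>)\<^sup>2) powr s * (norm (h \<xi>))\<^sup>2)"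
        by simp
    qed
  qed measurable
qed

theorem theorem2p6:
  fixes \<tau> \<beta> s :: real
  assumes "0 < \<tau>" and "\<tau> < \<beta>" and "1 \<le> s"
  shows "\<exists>C>0. \<exists>c>0. \<forall>(u0 :: 'n::finite dist) u1 u2 u.
    mgt_solution \<tau> \<beta> u0 u1 u2 u \<longrightarrow>
    in_L1 (V_vec \<tau> u0 u1 u2) \<longrightarrow> in_Hs s (V_vec \<tau> u0 u1 u2) \<longrightarrow>
    (\<forall>j::nat. real j \<le> s \<longrightarrow> (\<forall>t\<ge>0.
      in_Hs (real j) (V_sol \<tau> u t) \<and>
      deriv_L2_norm j (V_sol \<tau> u t)
        \<le> C * (1 + t) powr (- real CARD('n) / 4 - real j / 2) * L1_norm (V_vec \<tau> u0 u1 u2)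
          + C * exp (- c * t) * deriv_L2_norm j (V_vec \<tau> u0 u1 u2)))"
proof -
  from V_freq_decay[OF assms(1,2), where 'n = 'n] obtain K c where K: "0 < K" and c: "0 < c"
    and decay: "\<And>(\<xi>::real^'n) y y' y'' t. mgt_curve \<tau> \<beta> \<xi> y y' y'' \<Longrightarrow> 0 \<le> t \<Longrightarrow>
      (norm (V_freq \<tau> \<xi> (y t) (y' t) (y'' t)))\<^sup>2
      \<le> K * exp (- c * ((norm \<xi>)\<^sup>2 / (1 + (norm \<xi>)\<^sup>2)) * t) * (norm (V_freq \<tau> \<xi> (y 0) (y' 0) (y'' 0)))\<^sup>2"
    by blast
  define B where "B = real CARD(unit + 'n + 'n) * fourier_const TYPE('n)"
  have B: "0 \<le> B" by (simp add: B_def)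
  define p where "p j = - real CARD('n) / 2 - real j" for j :: nat
  define D where "D j = K * exp (c / 2) * B\<^sup>2 * gauss_moment TYPE('n) j * (c / 2) powr p j" for j
  have D: "0 \<le> D j" for j
    using K by (simp add: D_def gauss_moment_nonneg)
  \<comment> \<open>The sum makes the constant independent of \<open>j\<close>.\<close>
  define C where "C = 1 + sqrt K + (\<Sum>j\<le>nat \<lfloor>s\<rfloor>. sqrt (D j))"
  have C: "0 < C" "sqrt K \<le> C"
    using K D by (auto simp: C_def intro!: add_pos_nonneg sum_nonneg add_nonneg_nonneg)
  have CD: "sqrt (D j) \<le> C" if "real j \<le> s" for j
  proof -
    have "j \<le> nat \<lfloor>s\<rfloor>" using that by (simp add: le_nat_floor)
    then have "sqrt (D j) \<le> (\<Sum>j\<le>nat \<lfloor>s\<rfloor>. sqrt (D j))"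
      by (intro member_le_sum) (auto simp: D)
    moreover have "0 \<le> sqrt K" using K by simp
    ultimately show ?thesis unfolding C_def by linarith
  qed
  show ?thesis
  proof (rule exI[of _ C], intro conjI C(1), rule exI[of _ "c / 4"], intro conjI allI impI)
    show "0 < c / 4" using c by simp
    fix u0 u1 u2 :: "'n dist" and u :: "real \<Rightarrow> 'n dist" and j :: nat and t :: real
    assume sol: "mgt_solution \<tau> \<beta> u0 u1 u2 u" and L1: "in_L1 (V_vec \<tau> u0 u1 u2)"
      and Hs: "in_Hs s (V_vec \<tau> u0 u1 u2)" and j: "real j \<le> s" and t: "0 \<le> t"
    from mgt_solution_fourier[OF assms(1,2) sol] obtain y y' y'' :: "real^'n \<Rightarrow> real \<Rightarrow> complex"
      where curve: "\<And>\<xi>. mgt_curve \<tau> \<beta> \<xi> (y \<xi>) (y' \<xi>) (y'' \<xi>)"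
      and repV: "\<forall>t\<ge>0. vrepresents (\<lambda>\<xi>. V_freq \<tau> \<xi> (y \<xi> t) (y' \<xi> t) (y'' \<xi> t)) (vfourier (V_sol \<tau> u t))"
      and rep0: "vrepresents (\<lambda>\<xi>. V_freq \<tau> \<xi> (y \<xi> 0) (y' \<xi> 0) (y'' \<xi> 0)) (vfourier (V_vec \<tau> u0 u1 u2))"
      by blast
    define G where "G t \<xi> = V_freq \<tau> \<xi> (y \<xi> t) (y' \<xi> t) (y'' \<xi> t)" for t \<xi>
    have rep: "vrepresents (G t) (vfourier (V_sol \<tau> u t))" "vrepresents (G 0) (vfourier (V_vec \<tau> u0 u1 u2))"
      using repV t rep0 by (simp_all add: G_def[abs_def])
    have [measurable]: "G t \<in> borel_measurable borel" "G 0 \<in> borel_measurable borel"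
      using rep by (auto intro: vrepresents_measurable)
    have G_decay: "(norm (G t \<xi>))\<^sup>2 \<le> K * exp (- c * ((norm \<xi>)\<^sup>2 / (1 + (norm \<xi>)\<^sup>2)) * t) * (norm (G 0 \<xi>))\<^sup>2" for \<xi>
      unfolding G_def by (rule decay[OF curve t])
    have G_le: "(norm (G t \<xi>))\<^sup>2 \<le> K * (norm (G 0 \<xi>))\<^sup>2" for \<xi>
    proof -
      have "- c * ((norm \<xi>)\<^sup>2 / (1 + (norm \<xi>)\<^sup>2)) * t \<le> 0"
        using c t by (simp add: mult_nonneg_nonneg)
      then have "exp (- c * ((norm \<xi>)\<^sup>2 / (1 + (norm \<xi>)\<^sup>2)) * t) \<le> 1" by (simp only: exp_le_one_iff)
      then have "K * exp (- c * ((norm \<xi>)\<^sup>2 / (1 + (norm \<xi>)\<^sup>2)) * t) * (norm (G 0 \<xi>))\<^sup>2 \<le> K * 1 * (norm (G 0 \<xi>))\<^sup>2"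
        using K by (intro mult_right_mono mult_left_mono) auto
      with G_decay[of \<xi>] show ?thesis by simp
    qed
    have int0: "integrable lborel (\<lambda>\<xi>. (1 + (norm \<xi>)\<^sup>2) ^ j * (norm (G 0 \<xi>))\<^sup>2)"
      by (rule in_Hs_imp_integrable[OF Hs rep(2) j])
    have int: "integrable lborel (\<lambda>\<xi>. (1 + (norm \<xi>)\<^sup>2) ^ j * (norm (G t \<xi>))\<^sup>2)"
    proof (rule Bochner_Integration.integrable_bound[OF integrable_mult_right[OF int0, of K]])
      show "AE \<xi> in lborel. norm ((1 + (norm \<xi>)\<^sup>2) ^ j * (norm (G t \<xi>))\<^sup>2) \<le> norm (K * ((1 + (norm \<xi>)\<^sup>2) ^ j * (norm (G 0 \<xi>))\<^sup>2))"
      proof (rule AE_I2)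
        fix \<xi> :: "real^'n"
        have "(1 + (norm \<xi>)\<^sup>2) ^ j * (norm (G t \<xi>))\<^sup>2 \<le> (1 + (norm \<xi>)\<^sup>2) ^ j * (K * (norm (G 0 \<xi>))\<^sup>2)"
          by (intro mult_left_mono G_le) simp
        then show "norm ((1 + (norm \<xi>)\<^sup>2) ^ j * (norm (G t \<xi>))\<^sup>2) \<le> norm (K * ((1 + (norm \<xi>)\<^sup>2) ^ j * (norm (G 0 \<xi>))\<^sup>2))"
          using K by (simp add: mult_ac)
      qed
    qed measurable
    show "in_Hs (real j) (V_sol \<tau> u t)"
      unfolding in_Hs_def
    proof (intro exI[of _ "G t"] conjI rep(1))
      have "(1 + (norm \<xi>)\<^sup>2) powr real j = (1 + (norm \<xi>)\<^sup>2) ^ j" for \<xi> :: "real^'n"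
        by (simp add: powr_realpow add_pos_nonneg)
      then show "integrable lborel (\<lambda>\<xi>. (1 + (norm \<xi>)\<^sup>2) powr real j * (norm (G t \<xi>))\<^sup>2)"
        using int by simp
    qed
    have weight: "integrable lborel (\<lambda>\<xi>. norm \<xi> ^ (2 * j) * (norm (h \<xi>))\<^sup>2)"
      if "integrable lborel (\<lambda>\<xi>. (1 + (norm \<xi>)\<^sup>2) ^ j * (norm (h \<xi>))\<^sup>2)" and [measurable]: "h \<in> borel_measurable borel"
      for h :: "real^'n \<Rightarrow> complex^(unit + 'n + 'n)"
    proof (rule Bochner_Integration.integrable_bound[OF that(1)])
      show "AE \<xi> in lborel. norm (norm \<xi> ^ (2 * j) * (norm (h \<xi>))\<^sup>2) \<le> norm ((1 + (norm \<xi>)\<^sup>2) ^ j * (norm (h \<xi>))\<^sup>2)"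
      proof (rule AE_I2)
        fix \<xi> :: "real^'n"
        have "((norm \<xi>)\<^sup>2) ^ j \<le> (1 + (norm \<xi>)\<^sup>2) ^ j" by (intro power_mono) auto
        then show "norm (norm \<xi> ^ (2 * j) * (norm (h \<xi>))\<^sup>2) \<le> norm ((1 + (norm \<xi>)\<^sup>2) ^ j * (norm (h \<xi>))\<^sup>2)"
          by (simp add: power_mult mult_right_mono)
      qed
    qed measurable
    define L where "L = L1_norm (V_vec \<tau> u0 u1 u2)"
    have L: "0 \<le> L" unfolding L_def L1_norm_def by (rule Bochner_Integration.integral_nonneg) simp
    define I where "I = (LINT \<xi>|lborel. norm \<xi> ^ (2 * j) * (norm (G 0 \<xi>))\<^sup>2)"
    have I: "0 \<le> I" unfolding I_def by (rule Bochner_Integration.integral_nonneg) simp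
    have M: "AE \<xi> in lborel. (norm (G 0 \<xi>))\<^sup>2 \<le> (B * L)\<^sup>2"
      using norm_transform_le_L1_norm[OF L1 rep(2)]
      by eventually_elim (auto simp: B_def L_def intro!: power_mono)
    have "(LINT \<xi>|lborel. norm \<xi> ^ (2 * j) * (norm (G t \<xi>))\<^sup>2)
      \<le> K * exp (c / 2) * (B * L)\<^sup>2 * gauss_moment TYPE('n) j * (c / 2 * (1 + t)) powr (- real CARD('n) / 2 - real j)
        + K * exp (- (c / 2) * t) * (LINT \<xi>|lborel. norm \<xi> ^ (2 * j) * (norm (G 0 \<xi>))\<^sup>2)"
      by (rule frequency_splitting[OF c _ t _ M _ G_decay]) (use K in \<open>auto intro!: weight int int0\<close>)
    also have "\<dots> = D j * (1 + t) powr p j * L\<^sup>2 + K * exp (- (c / 2) * t) * I"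
    proof -
      have "(c / 2 * (1 + t)) powr p j = (c / 2) powr p j * (1 + t) powr p j"
        using c t by (intro powr_mult)
      then show ?thesis
        unfolding p_def[symmetric] D_def I_def by (simp add: power_mult_distrib)
    qed
    finally have "sqrt (LINT \<xi>|lborel. norm \<xi> ^ (2 * j) * (norm (G t \<xi>))\<^sup>2)
        \<le> sqrt (D j * (1 + t) powr p j * L\<^sup>2 + K * exp (- (c / 2) * t) * I)"
      by (rule real_sqrt_le_mono)
    also have "\<dots> \<le> sqrt (D j * (1 + t) powr p j * L\<^sup>2) + sqrt (K * exp (- (c / 2) * t) * I)"
      using D K I by (intro sqrt_add_le_add_sqrt) auto
    also have "sqrt (D j * (1 + t) powr p j * L\<^sup>2) = sqrt (D j) * (1 + t) powr (- real CARD('n) / 4 - real j / 2) * L"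
    proof -
      have "sqrt ((1 + t) powr p j) = (1 + t) powr (p j / 2)"
        using t by (simp add: powr_half_sqrt[symmetric] powr_powr)
      also have "p j / 2 = - real CARD('n) / 4 - real j / 2" by (simp add: p_def field_simps)
      finally show ?thesis using L by (simp add: real_sqrt_mult)
    qed
    also have "sqrt (K * exp (- (c / 2) * t) * I) = sqrt K * exp (- (c / 4) * t) * sqrt I"
    proof -
      have "exp (- (c / 2) * t) = (exp (- (c / 4) * t))\<^sup>2"
        by (simp add: exp_double[symmetric] power2_eq_square exp_add[symmetric])
      then have "sqrt (exp (- (c / 2) * t)) = exp (- (c / 4) * t)" by simp
      then show ?thesis by (simp only: real_sqrt_mult)
    qed
    also have "sqrt (D j) * (1 + t) powr (- real CARD('n) / 4 - real j / 2) * L + sqrt K * exp (- (c / 4) * t) * sqrt I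
      \<le> C * (1 + t) powr (- real CARD('n) / 4 - real j / 2) * L + C * exp (- (c / 4) * t) * sqrt I"
      using CD[OF j] C(2) L I by (intro add_mono mult_right_mono) auto
    finally show "deriv_L2_norm j (V_sol \<tau> u t)
        \<le> C * (1 + t) powr (- real CARD('n) / 4 - real j / 2) * L1_norm (V_vec \<tau> u0 u1 u2)
          + C * exp (- (c / 4) * t) * deriv_L2_norm j (V_vec \<tau> u0 u1 u2)"
      unfolding deriv_L2_norm_eq[OF rep(1)] deriv_L2_norm_eq[OF rep(2)] L_def I_def .
  qed
qed

end
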